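(* Let $n\in\mathbb{N}^*$, let $\Omega\subset\mathbb{R}^n$ be a bounded domain with smooth boundary, and let $A,g,m,\xi,p$ satisfy the standing assumptions listed in the context: $A$ is bounded, continuous and satisfies the coercivity condition with constant $c_0>0$; $g$ is positive, nonincreasing and differentiable with $g(0)>0$ and $1-\int_0^{+\infty}g(s)\,ds=l>0$; $g'(t)\le-\xi(t)g^p(t)$ for all $t\ge 0$, with $p\in[1,3/2)$ and $\xi:\mathbb{R}^+\to\mathbb{R}^+$ nonincreasing and differentiable; $2\le m\le \frac{2n}{n-2}$ if $n\ge 3$, and $m\ge 2$ if $n=1,2$. Let $u$ be the (global) solution of $$\begin{cases} A(t)|u_t|^{m-2}u_t-\Delta u+\int_0^t g(t-s)\Delta u(x,s)\,ds=0 & \text{in }\Omega\times(0,+\infty),\\ u(x,t)=0 & \text{on }\partial\Omega\times\mathbb{R}^+,\\ u(x,0)=u_0(x) & \text{in }\Omega,\end{cases}$$ and let $E$ be its energy, $$E(t)=\frac12\int_0^t g(t-\tau)\|\nabla u(\cdot,t)-\nabla u(\cdot,\tau)\|_2^2\,d\tau+\frac12\Big(1-\int_0^t g(s)\,ds\Big)\|\nabla u(\cdot,t)\|_2^2 .$$ Then there exist two strictly positive constants $\lambda_0$ and $\lambda_1$ such that, for all $t\in\mathbb{R}^+$, $$E(t)\le\lambda_0 e^{-\lambda_1\int_0^t\xi(s)\,ds}\qquad\text{if }p=1,$$ $$E(t)\le\lambda_0\Big(1+\int_0^t\xi^{2p-1}(s)\,ds\Big)^{\frac{-1}{2p-2}}\qquad\text{if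 }p>1.$$ Moreover, if $p>1$ and $\xi$ and $p$ satisfy $$\int_0^{+\infty}\Big(1+\int_0^t\xi^{2p-1}(s)\,ds\Big)^{\frac{-1}{2p-2}}dt<+\infty,$$ then, for all $t\in\mathbb{R}^+$, $$E(t)\le\lambda_0\Big(1+\int_0^t\xi^{p}(s)\,ds\Big)^{\frac{-1}{p-1}} .$$
   Context: Notation: $\mathbb{R}^+=[0,+\infty)$; $(\cdot,\cdot)$ and $|\cdot|$ are the inner product and norm of $\mathbb{R}^n$; $\|\cdot\|_q$ is the norm of $(L^q(\Omega))^n$ (and, for gradients, the corresponding $L^q$ norm of matrix-valued functions). The unknown $u$ is $\mathbb{R}^n$-valued. Standing assumptions. $A:\mathbb{R}^+\to M_n(\mathbb{R})$ is a bounded continuous map into the real $n\times n$ matrices such that, for some constant $c_0>0$, $(A(t)v,v)\ge c_0|v|^2$ for all $t\in\mathbb{R}^+$, $v\in\mathbb{R}^n$. The relaxation function $g:\mathbb{R}^+\to\mathbb{R}^+$ is positive, nonincreasing and differentiable, with $g(0)>0$ and $1-\int_0^{+\infty}g(s)\,ds=l>0$. There exist a constant $p\in[1,3/2)$ and a nonincreasing differentiable function $\xi:\mathbb{R}^+\to\mathbb{R}^+$ such that $g'(t)\le-\xi(t)g^p(t)$ for all $t\in\mathbb{R}^+$ (here $g^p(t)=(g(t))^p$, and similarly for powers of $\xi$). The exponent $m$ satisfies $2\le m\le\frac{2n}{n-2}$ if $n\ge3$, and $m\ge2$ if $n=1,2$. Solution. A (weak) solution on $[0,T]$ is a function $u\in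 C([0,T);(H_0^1(\Omega))^n)\cap C^1((0,T);(L^m(\Omega))^n)$ with $u(\cdot,0)=u_0$ such that, for all $t\in[0,T)$ and all $\phi\in C([0,T);(H_0^1(\Omega))^n)$, the following integrals exist and $$\int_0^t\int_\Omega\Big(\nabla u(x,s)-\int_0^s g(s-\tau)\nabla u(x,\tau)\,d\tau\Big)\cdot\nabla\phi(x,s)\,dx\,ds+\int_0^t\int_\Omega A(s)|u_t|^{m-2}u_t(x,s)\cdot\phi(x,s)\,dx\,ds=0 .$$ Existence of a solution is assumed, and it is taken to be global, i.e. a solution on $[0,T]$ for every $T>0$. The constants $\lambda_0,\lambda_1$ may depend on the solution $u$. *)

theory Defs
  imports "HOL-Analysis.Analysis"
begin

text \<open>Elements of function spaces over \<open>\<Omega>\<close> are represented by functions on the whole space whose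
  values outside \<open>\<Omega>\<close> are irrelevant; equality in the space is equality almost everywhere on
  \<open>\<Omega>\<close>. The norm of \<^typ>\<open>real^'n^'n\<close> is the Frobenius norm.\<close>

definition Lq :: "'a::euclidean_space set \<Rightarrow> real \<Rightarrow> ('a \<Rightarrow> 'b::euclidean_space) set" where
  "Lq \<Omega> q = {f. f \<in> borel_measurable (lebesgue_on \<Omega>) \<and>
                 integrable (lebesgue_on \<Omega>) (\<lambda>x. norm (f x) powr q)}"

definition Lq_norm :: "'a::euclidean_space set \<Rightarrow> real \<Rightarrow> ('a \<Rightarrow> 'b::euclidean_space) \<Rightarrow> real" where
  "Lq_norm \<Omega> q f = (LINT x|lebesgue_on \<Omega>. norm (f x) powr q) powr (1 / q)"

primrec Ck :: "nat \<Rightarrow> ('a::euclidean_space \<Rightarrow> 'b::euclidean_space) \<Rightarrow> bool" where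
  "Ck 0 f \<longleftrightarrow> continuous_on UNIV f"
| "Ck (Suc k) f \<longleftrightarrow> (\<forall>x. f differentiable (at x)) \<and>
     (\<forall>v. Ck k (\<lambda>x. frechet_derivative f (at x) v))"

definition smooth :: "('a::euclidean_space \<Rightarrow> 'b::euclidean_space) \<Rightarrow> bool" where
  "smooth f \<longleftrightarrow> (\<forall>k. Ck k f)"

text \<open>Near each boundary point, after a rotation taking the unit vector \<open>e\<close> to the last coordinate
  direction, \<open>\<Omega>\<close> is the part lying strictly above the graph of a smooth function of the other
  coordinates. That \<open>\<gamma>\<close> depends only on those coordinates is its invariance along \<open>e\<close>.\<close>

definition smooth_boundary :: "'a::euclidean_space set \<Rightarrow> bool" where
  "smooth_boundary \<Omega> \<longleftrightarrow>
     (\<forall>x0\<in>frontier \<Omega>. \<exists>r>0. \<exists>e. \<exists>\<gamma>::'a \<Rightarrow> real.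
        norm e = 1 \<and> smooth \<gamma> \<and> (\<forall>x s. \<gamma> (x + s *\<^sub>R e) = \<gamma> x) \<and>
        \<Omega> \<inter> ball x0 r = {x \<in> ball x0 r. x \<bullet> e > \<gamma> x})"

definition test_function :: "'a::euclidean_space set \<Rightarrow> ('a \<Rightarrow> 'b::euclidean_space) \<Rightarrow> bool" where
  "test_function \<Omega> \<phi> \<longleftrightarrow>
     smooth \<phi> \<and> compact (closure {x. \<phi> x \<noteq> 0}) \<and> closure {x. \<phi> x \<noteq> 0} \<subseteq> \<Omega>"

text \<open>\<open>G x $ i $ j\<close> is the distributional derivative of the \<open>i\<close>-th component in direction \<open>j\<close>.
  Only square integrable gradients are considered.\<close>

definition weak_gradient ::
  "(real^'n) set \<Rightarrow> (real^'n \<Rightarrow> real^'n) \<Rightarrow> (real^'n \<Rightarrow> real^'n^'n) \<Rightarrow> bool" where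
  "weak_gradient \<Omega> v G \<longleftrightarrow> G \<in> Lq \<Omega> 2 \<and>
     (\<forall>\<psi>::real^'n \<Rightarrow> real. test_function \<Omega> \<psi> \<longrightarrow>
       (\<forall>i j. (LINT x|lebesgue_on \<Omega>. v x $ i * frechet_derivative \<psi> (at x) (axis j 1)) =
              - (LINT x|lebesgue_on \<Omega>. G x $ i $ j * \<psi> x)))"

text \<open>A weak gradient is unique up to a null set.\<close>

definition grad :: "(real^'n) set \<Rightarrow> (real^'n \<Rightarrow> real^'n) \<Rightarrow> real^'n \<Rightarrow> real^'n^'n" where
  "grad \<Omega> v = (SOME G. weak_gradient \<Omega> v G)"

definition H1 :: "(real^'n) set \<Rightarrow> (real^'n \<Rightarrow> real^'n) set" where
  "H1 \<Omega> = {v \<in> Lq \<Omega> 2. \<exists>G. weak_gradient \<Omega> v G}"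

definition H1_norm :: "(real^'n) set \<Rightarrow> (real^'n \<Rightarrow> real^'n) \<Rightarrow> real" where
  "H1_norm \<Omega> v = sqrt ((Lq_norm \<Omega> 2 v)\<^sup>2 + (Lq_norm \<Omega> 2 (grad \<Omega> v))\<^sup>2)"

definition H10 :: "(real^'n) set \<Rightarrow> (real^'n \<Rightarrow> real^'n) set" where
  "H10 \<Omega> = {v \<in> H1 \<Omega>. \<exists>\<phi>. (\<forall>k. test_function \<Omega> (\<phi> k)) \<and>
                (\<lambda>k::nat. H1_norm \<Omega> (\<lambda>x. \<phi> k x - v x)) \<longlonglongrightarrow> 0}"

definition cont_H10 :: "real set \<Rightarrow> (real^'n) set \<Rightarrow> (real \<Rightarrow> real^'n \<Rightarrow> real^'n) \<Rightarrow> bool" where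
  "cont_H10 I \<Omega> u \<longleftrightarrow> (\<forall>t\<in>I. u t \<in> H10 \<Omega> \<and>
     ((\<lambda>s. H1_norm \<Omega> (\<lambda>x. u s x - u t x)) \<longlongrightarrow> 0) (at t within I))"

definition C1_Lq_with_derivative ::
  "real set \<Rightarrow> (real^'n) set \<Rightarrow> real \<Rightarrow> (real \<Rightarrow> real^'n \<Rightarrow> real^'n) \<Rightarrow>
   (real \<Rightarrow> real^'n \<Rightarrow> real^'n) \<Rightarrow> bool" where
  "C1_Lq_with_derivative I \<Omega> q u u' \<longleftrightarrow> (\<forall>t\<in>I. u t \<in> Lq \<Omega> q \<and> u' t \<in> Lq \<Omega> q \<and>
     ((\<lambda>s. Lq_norm \<Omega> q (\<lambda>x. (1 / (s - t)) *\<^sub>R (u s x - u t x) - u' t x)) \<longlongrightarrow> 0) (at t within I) \<and>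
     ((\<lambda>s. Lq_norm \<Omega> q (\<lambda>x. u' s x - u' t x)) \<longlongrightarrow> 0) (at t within I))"

text \<open>For the memory integral, which is taken pointwise in \<open>x\<close>, to make sense, the gradients of
  \<open>u \<tau>\<close> must be represented by a function \<open>Du\<close> that is jointly measurable in \<open>(\<tau>, x)\<close>. Such a
  representative exists for every \<open>u\<close> in \<open>C([0,T); H\<^sub>0\<^sup>1)\<close>, and the integrals do not depend on its
  choice.\<close>

definition gradient_field ::
  "real \<Rightarrow> (real^'n) set \<Rightarrow> (real \<Rightarrow> real^'n \<Rightarrow> real^'n) \<Rightarrow> (real \<Rightarrow> real^'n \<Rightarrow> real^'n^'n) \<Rightarrow> bool" where
  "gradient_field T \<Omega> u Du \<longleftrightarrow>
     (\<lambda>z. Du (fst z) (snd z)) \<in> borel_measurable (restrict_space borel ({0..<T} \<times> \<Omega>)) \<and>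
     (\<forall>t\<in>{0..<T}. weak_gradient \<Omega> (u t) (Du t))"

definition memory ::
  "(real \<Rightarrow> real) \<Rightarrow> (real \<Rightarrow> real^'n \<Rightarrow> real^'n^'n) \<Rightarrow> real \<Rightarrow> real^'n \<Rightarrow> real^'n^'n" where
  "memory g Du s x = (LINT \<tau>:{0..s}|lborel. g (s - \<tau>) *\<^sub>R Du \<tau> x)"

definition weak_solution ::
  "real \<Rightarrow> (real^'n) set \<Rightarrow> (real \<Rightarrow> real^'n^'n) \<Rightarrow> (real \<Rightarrow> real) \<Rightarrow> real \<Rightarrow>
   (real^'n \<Rightarrow> real^'n) \<Rightarrow> (real \<Rightarrow> real^'n \<Rightarrow> real^'n) \<Rightarrow> bool" where
  "weak_solution T \<Omega> A g m u0 u \<longleftrightarrow>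
     cont_H10 {0..<T} \<Omega> u \<and>
     (AE x in lebesgue_on \<Omega>. u 0 x = u0 x) \<and>
     (\<exists>Du ut. gradient_field T \<Omega> u Du \<and> C1_Lq_with_derivative {0<..<T} \<Omega> m u ut \<and>
       (\<forall>s\<in>{0..<T}. AE x in lebesgue_on \<Omega>. set_integrable lborel {0..s} (\<lambda>\<tau>. g (s - \<tau>) *\<^sub>R Du \<tau> x)) \<and>
       (\<forall>t\<in>{0..<T}. \<forall>\<phi>. cont_H10 {0..<T} \<Omega> \<phi> \<longrightarrow>
         (let F = (\<lambda>s x. (Du s x - memory g Du s x) \<bullet> grad \<Omega> (\<phi> s) x);
              D = (\<lambda>s x. (A s *v (norm (ut s x) powr (m - 2) *\<^sub>R ut s x)) \<bullet> \<phi> s x)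
          in (\<forall>s\<in>{0<..<t}. integrable (lebesgue_on \<Omega>) (F s) \<and> integrable (lebesgue_on \<Omega>) (D s)) \<and>
             set_integrable lborel {0<..<t} (\<lambda>s. LINT x|lebesgue_on \<Omega>. F s x) \<and>
             set_integrable lborel {0<..<t} (\<lambda>s. LINT x|lebesgue_on \<Omega>. D s x) \<and>
             (LINT s:{0<..<t}|lborel. LINT x|lebesgue_on \<Omega>. F s x) +
             (LINT s:{0<..<t}|lborel. LINT x|lebesgue_on \<Omega>. D s x) = 0)))"

definition energy ::
  "(real^'n) set \<Rightarrow> (real \<Rightarrow> real) \<Rightarrow> (real \<Rightarrow> real^'n \<Rightarrow> real^'n) \<Rightarrow> real \<Rightarrow> real" where
  "energy \<Omega> g u t =
     1/2 * (LINT \<tau>:{0..t}|lborel.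
       g (t - \<tau>) * (Lq_norm \<Omega> 2 (\<lambda>x. grad \<Omega> (u t) x - grad \<Omega> (u \<tau>) x))\<^sup>2) +
     1/2 * (1 - (LINT s:{0..t}|lborel. g s)) * (Lq_norm \<Omega> 2 (grad \<Omega> (u t)))\<^sup>2"

end

theory Submission
  imports Defs
begin

text \<open>
  Write \<open>K(t,s)\<close> for the inner product of \<open>\<nabla>u(t)\<close> and \<open>\<nabla>u(s)\<close> and
  \<open>W(t,r) = K(t,r) - \<integral>\<^sub>0\<^sup>t g(t-s) K(s,r) ds\<close>. Testing the equation with the
  time-independent function \<open>u(r)\<close> shows that \<open>W(t,r)\<close> is minus the pairing of the damping
  term \<open>A(t)|u\<^sub>t|\<^bsup>m-2\<^esup>u\<^sub>t\<close> with \<open>u(r)\<close>. As \<open>u\<^sub>t\<close> has values in \<open>L\<^sup>m\<close> only, it is not an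
  admissible test function; the dissipation of the energy comes from an exact formula for
  \<open>E(t+h) - E(t)\<close> in terms of increments of \<open>W\<close>, which after division by \<open>h\<close> converge because \<open>u\<close>
  is \<open>C\<^sup>1\<close> in \<open>L\<^sup>m\<close>. The upper right Dini derivative of \<open>E\<close> is at most \<open>-X\<close>, where \<open>X\<close> is the sum of
  the damping power \<open>P\<close> and of \<open>\<integral>\<^sub>0\<^sup>t \<xi>(t-s) g\<^sup>p(t-s) \<parallel>\<nabla>u(t) - \<nabla>u(s)\<parallel>\<^sup>2 ds / 2\<close>.
  Testing with \<open>u(t)\<close> and using the Sobolev embedding of \<open>H\<^sub>0\<^sup>1\<close> in \<open>L\<^sup>m\<close> bounds \<open>E\<close> by a multiple of \<open>P\<close>
  plus the memory part of the energy. Hoelder's inequality then gives \<open>X \<ge> c (\<xi> E)\<^sup>r\<close>, where \<open>r = 1\<close> for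
  \<open>p = 1\<close>, \<open>r = 2p - 1\<close> in general (because \<open>\<xi> g\<^bsup>1/2\<^esup>\<close> is integrable when \<open>p < 3/2\<close>) and \<open>r = p\<close> when
  \<open>E\<close> is integrable. The resulting differential inequality is integrated.
\<close>

section \<open>Scalar tools\<close>

text \<open>The energy depends on \<open>u\<close> only through the Gram kernel of its gradients, so
  decay is proved for an abstract kernel; the equation enters through \<open>P\<close>, two
  one-sided limits and one bound for \<open>W t t\<close>. The energy need not be differentiable, so
  each rate comes from tangent-line inequalities for \<open>ln\<close> or a power, applied to finite
  increments. The exponents come from writing \<open>g\<close> as \<open>g^p\<close> to the power
  \<open>\<theta>\<close> times \<open>g^b\<close> to the power \<open>1 - \<theta>\<close>, where
  \<open>p \<theta> + b (1 - \<theta>) = 1\<close>. Taking \<open>b = 1/2\<close> gives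
  \<open>1/\<theta> = 2p - 1\<close>; here \<open>\<xi> g^(1/2)\<close> is integrable because
  \<open>(3/2 - p) \<xi> g^(1/2)\<close> is at most minus the derivative of
  \<open>g^(3/2 - p)\<close>. Taking \<open>b = 0\<close> gives \<open>1/\<theta> = p\<close>, but
  no decaying weight is left, and \<open>\<parallel>\<nabla>u(t) - \<nabla>u(s)\<parallel>\<^sup>2
  \<le> 8 E(s) / l\<close> has to be integrable in \<open>s\<close> by itself. The Sobolev bound
  keeps the homogeneous form \<open>K^(m/2)\<close>, with \<open>K\<close> the squared norm of the
  gradient. As \<open>E\<close> decreases, \<open>K^(m/2)\<close> is at most a constant depending on
  \<open>E(0)\<close> times \<open>K\<close>, and a small factor lets this be absorbed.\<close>

lemma dini_nonincreasing:
  fixes f :: "real \<Rightarrow> real"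
  assumes "a \<le> b" and cont: "continuous_on {a..b} f"
    and dini: "\<And>t e. a < t \<Longrightarrow> t < b \<Longrightarrow> e > 0 \<Longrightarrow>
      eventually (\<lambda>h. f (t + h) \<le> f t + e * h) (at_right 0)"
  shows "f b \<le> f a"
proof -
  have main: "f b \<le> f c + e * (b - c)" if c: "a < c" "c \<le> b" and e: "e > 0" for c e
  proof -
    \<comment> \<open>Continuity argument: \<open>S\<close> collects the points up to which
      \<open>f\<close> stays below the line of slope \<open>e\<close> starting at \<open>c\<close>.
      Continuity extends the bound to the supremum, and the Dini bound pushes past the supremum
      unless it is \<open>b\<close>.\<close>
    define S where "S = {x \<in> {c..b}. \<forall>y\<in>{c..x}. f y - e * (y - c) \<le> f c}"
    have cS: "c \<in> S" using c by (auto simp: S_def)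
    have bdd: "bdd_above S" by (auto simp: S_def intro!: bdd_aboveI[of _ b])
    define s where "s = Sup S"
    have cs: "c \<le> s" unfolding s_def by (rule cSup_upper[OF cS bdd])
    have sb: "s \<le> b" unfolding s_def by (rule cSup_least) (use cS in \<open>auto simp: S_def\<close>)
    have less: "f y - e * (y - c) \<le> f c" if "c \<le> y" "y < s" for y
    proof -
      from that obtain x where "x \<in> S" "y < x" unfolding s_def
        using less_cSup_iff[OF _ bdd] cS by auto
      then show ?thesis using that by (auto simp: S_def)
    qed
    have at_s: "f s - e * (s - c) \<le> f c"
    proof (cases "c = s")
      case False
      with cs have "c < s" by simp
      have "continuous_on {c..s} (\<lambda>y. f y - e * (y - c))"
        by (intro continuous_intros continuous_on_subset[OF cont]) (use c sb in auto)
      then have "((\<lambda>y. f y - e * (y - c)) \<longlongrightarrow> f s - e * (s - c)) (at s within {c..s})"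
        using \<open>c < s\<close> by (auto simp: continuous_on_def)
      then have "((\<lambda>y. f y - e * (y - c)) \<longlongrightarrow> f s - e * (s - c)) (at_left s)"
        using \<open>c < s\<close> by (simp add: at_within_Icc_at_left)
      moreover have "eventually (\<lambda>y. f y - e * (y - c) \<le> f c) (at_left s)"
        using eventually_at_left_real[OF \<open>c < s\<close>] by eventually_elim (auto intro!: less)
      ultimately show ?thesis by (rule tendsto_upperbound) simp
    qed auto
    have "s = b"
    proof (rule ccontr)
      assume "s \<noteq> b"
      with sb have "s < b" by simp
      from dini[of s e] c cs \<open>s < b\<close> e
      have "eventually (\<lambda>h. f (s + h) \<le> f s + e * h) (at_right 0)" by auto
      then obtain d where d: "d > 0" "\<And>h. 0 < h \<Longrightarrow> h < d \<Longrightarrow> f (s + h) \<le> f s + e * h"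
        by (auto simp: eventually_at_right_field)
      define x where "x = min b (s + d / 2)"
      have x: "s < x" "x \<le> b" "x < s + d" using d \<open>s < b\<close> by (auto simp: x_def)
      have "f y - e * (y - c) \<le> f c" if "y \<in> {c..x}" for y
      proof (cases "y \<le> s")
        case True then show ?thesis using less[of y] at_s that by (cases "y = s") auto
      next
        case False
        then have "f (s + (y - s)) \<le> f s + e * (y - s)" using d x that by (intro d(2)) auto
        then show ?thesis using at_s by (simp add: algebra_simps)
      qed
      then have "x \<in> S" using x c cs by (auto simp: S_def)
      then have "x \<le> s" unfolding s_def by (rule cSup_upper[OF _ bdd])
      then show False using x by simp
    qed
    then show ?thesis using at_s by simp
  qed
  \<comment> \<open>Starting at \<open>c > a\<close> avoids a Dini bound at \<open>a\<close> itself;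
    the endpoint is recovered by letting \<open>c\<close> tend to \<open>a\<close>. The
    \<open>+ 1\<close> in the slope chosen below covers \<open>c = b\<close>.\<close>
  have main2: "f b \<le> f c" if "a < c" "c \<le> b" for c
  proof (rule field_le_epsilon)
    fix e :: real assume "e > 0"
    have "f b \<le> f c + e / (b - c + 1) * (b - c)" using main[OF that, of "e / (b - c + 1)"] that \<open>e > 0\<close> by simp
    also have "e / (b - c + 1) * (b - c) \<le> e" using that \<open>e > 0\<close> by (simp add: field_simps)
    finally show "f b \<le> f c + e" by simp
  qed
  show ?thesis
  proof (cases "a = b")
    case False
    with assms have "a < b" by simp
    have "(f \<longlongrightarrow> f a) (at a within {a..b})"
      using cont \<open>a < b\<close> by (auto simp: continuous_on_def)
    then have "(f \<longlongrightarrow> f a) (at_right a)" using \<open>a < b\<close> by (simp add: at_within_Icc_at_right)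
    moreover have "eventually (\<lambda>c. f b \<le> f c) (at_right a)"
      using eventually_at_right_real[OF \<open>a < b\<close>] by eventually_elim (auto intro!: main2)
    ultimately show ?thesis by (rule tendsto_lowerbound) simp
  qed auto
qed

text \<open>Rescaling moves the endpoint into the integrand. Continuity of parameter integrals over
  a fixed interval then covers integrals with moving endpoints and, after division by
  \<open>h\<close>, short averages down to \<open>h = 0\<close>.\<close>

lemma integral_unit_interval:
  fixes F :: "real \<Rightarrow> real"
  assumes "continuous_on UNIV F" "h \<ge> 0"
  shows "integral {a..a+h} F = h * integral {0..1} (\<lambda>\<sigma>. F (a + h * \<sigma>))"
proof (cases "h = 0")
  case False
  with assms have h: "h > 0" by simp
  have "(F has_integral integral {a..a+h} F) (cbox a (a+h))"
    using assms by (auto intro!: integrable_integral integrable_continuous_real continuous_on_subset[OF assms(1)])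
  from has_integral_affinity[OF this, of h a] h
  have "((\<lambda>x. F (h * x + a)) has_integral (inverse h) * integral {a..a+h} F) ((\<lambda>x. x / h - a / h) ` {a..a+h})"
    by (simp add: divide_inverse algebra_simps)
  moreover have "(\<lambda>x. x / h - a / h) ` {a..a+h} = {0..1}"
  proof -
    have "y \<in> (\<lambda>x. x / h - a / h) ` {a..a+h}" if "y \<in> {0..1}" for y
      using that h by (intro image_eqI[of _ _ "a + h * y"]) (auto simp: field_simps mult_left_le)
    then show ?thesis using h by (auto simp: field_simps)
  qed
  ultimately have "integral {0..1} (\<lambda>\<sigma>. F (a + h * \<sigma>)) = inverse h * integral {a..a+h} F"
    by (intro integral_unique) (simp add: add.commute)
  then show ?thesis using h by simp
qed auto

lemma continuous_on_unit_integral: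
  fixes H :: "real \<Rightarrow> real \<Rightarrow> real"
  assumes "continuous_on UNIV (\<lambda>z. H (fst z) (snd z))"
  shows "continuous_on UNIV (\<lambda>t. integral {0..1} (H t))"
proof -
  have "continuous_on UNIV (\<lambda>t. integral (cbox 0 1) (H t))"
    using assms by (intro integral_continuous_on_param) (auto simp: split_def intro: continuous_on_subset)
  then show ?thesis by simp
qed

lemma continuous_on_integral_upto:
  fixes H :: "real \<Rightarrow> real \<Rightarrow> real"
  assumes H: "continuous_on UNIV (\<lambda>z. H (fst z) (snd z))"
  shows "continuous_on {0..} (\<lambda>t. integral {0..t} (H t))"
proof -
  have "integral {0..t} (H t) = t * integral {0..1} (\<lambda>s. H t (t * s))" if "t \<ge> 0" for t
    using integral_unit_interval[of "H t" t 0] that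
      continuous_on_compose2[OF H, of UNIV "\<lambda>s. (t, s)"] by (simp add: continuous_intros)
  moreover have "continuous_on {0..} (\<lambda>t. t * integral {0..1} (\<lambda>s. H t (t * s)))"
    by (intro continuous_intros continuous_on_subset[OF continuous_on_unit_integral]
        continuous_on_compose2[OF H, of _ "\<lambda>z. (fst z, fst z * snd z)", simplified]) auto
  ultimately show ?thesis by (subst continuous_on_cong[OF refl]) auto
qed

lemma continuous_tendsto_right:
  fixes f :: "real \<Rightarrow> real"
  assumes "continuous_on UNIV f"
  shows "(f \<longlongrightarrow> f a) (at_right a)"
proof -
  have "(f \<longlongrightarrow> f a) (at a)" using assms by (auto simp: continuous_on_def)
  then show ?thesis by (rule tendsto_within_subset) simp
qed

text \<open>After rescaling, the average is a continuous function of \<open>h\<close> whose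
  integrand at \<open>h = 0\<close> is the constant \<open>H 0 a\<close>. The integrand may depend
  on \<open>h\<close> because the energy increment contains \<open>K (t + h) s\<close>.\<close>

lemma short_integral_tendsto:
  fixes H :: "real \<Rightarrow> real \<Rightarrow> real"
  assumes H: "continuous_on UNIV (\<lambda>z. H (fst z) (snd z))"
  shows "((\<lambda>h. integral {a..a+h} (H h) / h) \<longlongrightarrow> H 0 a) (at_right 0)"
proof -
  have c: "continuous_on UNIV (\<lambda>h. integral {0..1} (\<lambda>s. H h (a + h * s)))"
    by (intro continuous_intros continuous_on_unit_integral
        continuous_on_compose2[OF H, of _ "\<lambda>z. (fst z, a + fst z * snd z)", simplified])
  have "((\<lambda>h. integral {0..1} (\<lambda>s. H h (a + h * s))) \<longlongrightarrow> integral {0..1} (\<lambda>s. H 0 (a + 0 * s))) (at_right 0)"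
    by (rule continuous_tendsto_right[OF c])
  moreover have "eventually (\<lambda>h. integral {0..1} (\<lambda>s. H h (a + h * s)) = integral {a..a+h} (H h) / h) (at_right 0)"
    using eventually_at_right_less[of 0]
  proof eventually_elim
    case (elim h)
    then show ?case using integral_unit_interval[of "H h" h a]
      continuous_on_compose2[OF H, of UNIV "\<lambda>s. (h, s)"] by (simp add: continuous_intros)
  qed
  ultimately show ?thesis by (auto intro: Lim_transform_eventually)
qed

lemma integral_linear_combination:
  fixes f f' :: "real \<Rightarrow> real"
  assumes "f integrable_on S" "f' integrable_on S"
  shows "integral S (\<lambda>s. a * f s + b * f' s) = a * integral S f + b * integral S f'"
    and "(\<lambda>s. a * f s + b * f' s) integrable_on S"
proof -
  have "((\<lambda>s. a * f s + b * f' s) has_integral (a * integral S f + b * integral S f')) S"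
    by (intro has_integral_add has_integral_mult_right integrable_integral assms)
  then show "integral S (\<lambda>s. a * f s + b * f' s) = a * integral S f + b * integral S f'"
    "(\<lambda>s. a * f s + b * f' s) integrable_on S"
    by (auto simp: integral_unique integrable_on_def)
qed

text \<open>The two terms on the right are scaled so that the powers of \<open>c\<close> cancel in
  their weighted geometric mean, which is at most the maximum and hence the sum. Keeping
  \<open>c\<close> free under an integral and fixing it afterwards plays the role of Hoelder's
  inequality.\<close>

lemma weighted_young:
  fixes x y \<theta> c :: real
  assumes "x \<ge> 0" "y \<ge> 0" "0 \<le> \<theta>" "\<theta> \<le> 1" "c > 0"
  shows "x powr \<theta> * y powr (1 - \<theta>) \<le> c powr (\<theta> - 1) * x + c powr \<theta> * y"
proof (cases "x = 0 \<or> y = 0")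
  case False
  then have xy: "x > 0" "y > 0" using assms by auto
  define a b where "a = c powr (\<theta> - 1) * x" and "b = c powr \<theta> * y"
  have ab: "a > 0" "b > 0" using xy assms by (auto simp: a_def b_def)
  have "a powr \<theta> * b powr (1 - \<theta>) = c powr ((\<theta> - 1) * \<theta>) * x powr \<theta> * (c powr (\<theta> * (1 - \<theta>)) * y powr (1 - \<theta>))"
    using xy assms by (simp add: a_def b_def powr_mult powr_powr)
  also have "\<dots> = (c powr ((\<theta> - 1) * \<theta>) * c powr (\<theta> * (1 - \<theta>))) * (x powr \<theta> * y powr (1 - \<theta>))" by simp
  also have "c powr ((\<theta> - 1) * \<theta>) * c powr (\<theta> * (1 - \<theta>)) = 1"
    using assms by (simp flip: powr_add) (simp add: algebra_simps)
  finally have "x powr \<theta> * y powr (1 - \<theta>) = a powr \<theta> * b powr (1 - \<theta>)" by simp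
  also have "\<dots> \<le> max a b powr \<theta> * max a b powr (1 - \<theta>)"
    using ab assms by (intro mult_mono powr_mono2) auto
  also have "\<dots> = max a b" using ab by (simp flip: powr_add)
  also have "\<dots> \<le> a + b" using ab by simp
  finally show ?thesis by (simp add: a_def b_def)
qed (use assms in auto)

section \<open>Decay of the energy of a positive definite kernel\<close>

text \<open>\<open>K s t\<close> stands for the inner product of the gradients at times
  \<open>s\<close> and \<open>t\<close>; the Hilbert space survives only in \<open>K_sym\<close>,
  \<open>K_pos\<close>, \<open>q_pos\<close> and \<open>K_CS\<close>. \<open>g_decr\<close> is the
  differential inequality for \<open>g\<close> over a finite step, with the right side evaluated at
  the right endpoint by monotonicity.\<close>

locale memory_energy =
  fixes K :: "real \<Rightarrow> real \<Rightarrow> real" and g \<xi> :: "real \<Rightarrow> real" and p l :: real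
    and P :: "real \<Rightarrow> real"
  assumes K_cont: "continuous_on UNIV (\<lambda>z. K (fst z) (snd z))"
    and K_sym: "K s t = K t s"
    and K_pos: "K t t \<ge> 0"
    and q_pos: "K s s - 2 * K s t + K t t \<ge> 0"
    and K_CS: "(K s t - K t t)\<^sup>2 \<le> (K s s - 2 * K s t + K t t) * K t t"
    and g_cont: "continuous_on UNIV g"
    and g_pos: "g t \<ge> 0"
    and g_antimono: "0 \<le> s \<Longrightarrow> s \<le> t \<Longrightarrow> g t \<le> g s"
    and g_int: "t \<ge> 0 \<Longrightarrow> l \<le> 1 - integral {0..t} g"
    and l_pos: "l > 0"
    and g_decr: "0 \<le> s \<Longrightarrow> h \<ge> 0 \<Longrightarrow> h * (\<xi> (s + h) * g (s + h) powr p) \<le> g s - g (s + h)"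
    and \<xi>_cont: "continuous_on UNIV \<xi>"
    and \<xi>_pos: "\<xi> t \<ge> 0"
    and \<xi>_antimono: "0 \<le> s \<Longrightarrow> s \<le> t \<Longrightarrow> \<xi> t \<le> \<xi> s"
    and p_ge: "1 \<le> p" and p_less: "p < 3/2"
    and P_pos: "t > 0 \<Longrightarrow> P t \<ge> 0"
begin

definition q :: "real \<Rightarrow> real \<Rightarrow> real" where
  "q t s = K t t - 2 * K t s + K s s"

definition W :: "real \<Rightarrow> real \<Rightarrow> real" where
  "W t r = K t r - integral {0..t} (\<lambda>s. g (t - s) * K s r)"

definition memq :: "real \<Rightarrow> real" where
  "memq t = integral {0..t} (\<lambda>s. g (t - s) * q t s)"

definition en :: "real \<Rightarrow> real" where
  "en t = 1/2 * memq t + 1/2 * (1 - integral {0..t} g) * K t t"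

definition dissip :: "real \<Rightarrow> real" where
  "dissip t = P t + 1/2 * integral {0..t} (\<lambda>s. \<xi> (t - s) * g (t - s) powr p * q t s)"

lemma cont_K [continuous_intros]:
  "continuous_on S a \<Longrightarrow> continuous_on S b \<Longrightarrow> continuous_on S (\<lambda>x. K (a x) (b x))"
  using continuous_on_compose2[OF K_cont, of S "\<lambda>x. (a x, b x)"] by (auto intro: continuous_intros)

lemma cont_g [continuous_intros]: "continuous_on S a \<Longrightarrow> continuous_on S (\<lambda>x. g (a x))"
  by (rule continuous_on_compose2[OF g_cont]) auto

lemma cont_\<xi> [continuous_intros]: "continuous_on S a \<Longrightarrow> continuous_on S (\<lambda>x. \<xi> (a x))"
  by (rule continuous_on_compose2[OF \<xi>_cont]) auto

lemma cont_powr_r [continuous_intros]: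
  fixes a :: "'a::topological_space \<Rightarrow> real"
  shows "continuous_on S a \<Longrightarrow> (\<And>x. x \<in> S \<Longrightarrow> a x \<ge> 0) \<Longrightarrow> r > 0 \<Longrightarrow> continuous_on S (\<lambda>x. a x powr r)"
  by (rule continuous_on_powr') (auto intro: continuous_intros)

lemma cont_q [continuous_intros]:
  "continuous_on S a \<Longrightarrow> continuous_on S b \<Longrightarrow> continuous_on S (\<lambda>x. q (a x) (b x))"
  unfolding q_def by (intro continuous_intros)

lemma q_nonneg: "q t s \<ge> 0"
  using q_pos by (simp add: q_def)

lemma memq_nonneg: "memq t \<ge> 0"
  unfolding memq_def by (intro integral_nonneg integrable_continuous_real continuous_intros)
     (auto intro!: mult_nonneg_nonneg g_pos q_nonneg)


lemma int_reflect: "integral {0..t} (\<lambda>s. f (t - s)) = integral {0..t} (f :: real \<Rightarrow> real)" for t :: real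
  using Henstock_Kurzweil_Integration.integral_reflect_real[of t 0 "\<lambda>s. f (t - s)"] integral_shift_real_ivl[of 0 t t f]
  by (simp add: add.commute)

lemma int_UNIV: "continuous_on UNIV f \<Longrightarrow> f integrable_on {a..b}" for f :: "real \<Rightarrow> real"
  by (rule integrable_continuous_real) (auto intro: continuous_on_subset)

definition J :: "real \<Rightarrow> (real \<Rightarrow> real) \<Rightarrow> real" where
  "J t f = integral {0..t} (\<lambda>s. g (t - s) * f s)"

lemma J_int: "continuous_on UNIV f \<Longrightarrow> (\<lambda>s. g (t - s) * f s) integrable_on {a..b}"
  by (intro int_UNIV continuous_intros)

lemma J_add: "continuous_on UNIV f \<Longrightarrow> continuous_on UNIV f' \<Longrightarrow> J t (\<lambda>s. f s + f' s) = J t f + J t f'"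
  unfolding J_def by (simp add: distrib_left Henstock_Kurzweil_Integration.integral_add J_int)

lemma J_diff: "continuous_on UNIV f \<Longrightarrow> continuous_on UNIV f' \<Longrightarrow> J t (\<lambda>s. f s - f' s) = J t f - J t f'"
  unfolding J_def by (simp add: right_diff_distrib Henstock_Kurzweil_Integration.integral_diff J_int)

lemma J_cmult: "J t (\<lambda>s. c * f s) = c * J t f"
  unfolding J_def by (simp add: mult.left_commute)

lemma J_divide: "J t (\<lambda>s. f s / c) = J t f / c"
  using J_cmult[of t "inverse c" f] by (simp add: field_simps)

lemma J_const: "J t (\<lambda>s. c) = c * integral {0..t} g"
  unfolding J_def using int_reflect[of t g] by (simp add: mult.commute)

lemmas J_simps = J_add J_diff J_cmult J_divide J_const

text \<open>Expanding the square in \<open>q\<close> produces \<open>K t t\<close> times the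
  integral of \<open>g\<close>, which cancels against the same term in the second half of the
  energy. What remains is linear in \<open>K\<close>.\<close>

lemma en_eq: "en t = K t t / 2 - J t (K t) + J t (\<lambda>s. K s s) / 2"
proof -
  have "memq t = J t (\<lambda>s. K t t - 2 * K t s + K s s)"
    by (simp add: memq_def q_def J_def)
  also have "\<dots> = K t t * integral {0..t} g - 2 * J t (K t) + J t (\<lambda>s. K s s)"
    by (simp add: J_simps continuous_intros)
  finally show ?thesis by (simp add: en_def field_simps)
qed

text \<open>The average of \<open>W t\<close> and \<open>W (t + h)\<close> makes the quadratic increments of \<open>K\<close> cancel, so
  that no time derivative of the gradient is needed.\<close>

lemma en_increment:
  "en (t + h) - en t = 1/2 * (W t (t + h) - W t t) + 1/2 * (W (t + h) (t + h) - W (t + h) t)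
     + (J (t + h) (\<lambda>s. K s s / 2 - K t s / 2 - K (t + h) s / 2)
        - J t (\<lambda>s. K s s / 2 - K t s / 2 - K (t + h) s / 2))"
proof -
  have W: "W a b = K a b - J a (K b)" for a b by (simp add: W_def J_def K_sym[of b])
  have *: "J a (\<lambda>s. K s s / 2 - K t s / 2 - K (t + h) s / 2)
      = J a (\<lambda>s. K s s) / 2 - J a (K t) / 2 - J a (K (t + h)) / 2" for a
    by (simp add: J_simps continuous_intros)
  show ?thesis unfolding en_eq W * K_sym[of "t+h" t] by (simp add: field_simps)
qed

text \<open>Splitting at \<open>t\<close> isolates the new time slab. On \<open>{0..t}\<close> only
  the weight changes; its decrease is controlled by \<open>g_decr\<close> wherever it multiplies
  something nonnegative, and computed exactly where it multiplies a constant.\<close>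

lemma J_increment_bound:
  assumes "t \<ge> 0" "h > 0"
  shows "(J (t + h) (\<lambda>s. K s s / 2 - K t s / 2 - K (t + h) s / 2)
        - J t (\<lambda>s. K s s / 2 - K t s / 2 - K (t + h) s / 2)) / h
    \<le> integral {t..t+h} (\<lambda>s. g (t + h - s) * (K s s / 2 - K t s / 2 - K (t + h) s / 2)) / h
      - integral {0..t} (\<lambda>s. \<xi> (t + h - s) * g (t + h - s) powr p * (q t s + q (t + h) s)) / 4
      - (K t t + K (t + h) (t + h)) / 4 * (integral {t..t+h} g / h - integral {0..0+h} g / h)"
proof -
  let ?j = "\<lambda>s. K s s / 2 - K t s / 2 - K (t + h) s / 2"
  let ?q = "\<lambda>s. (q t s + q (t + h) s) / 4"
  let ?k = "(K t t + K (t + h) (t + h)) / 4"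
  \<comment> \<open>Completing the square: \<open>?q\<close> is a nonnegative average of two squared
    distances, so the one-sided bound \<open>g_decr\<close> may be applied to it, while
    \<open>?k\<close> does not depend on \<open>s\<close>.\<close>
  have j: "?j s = ?q s - ?k" for s
    by (simp add: q_def field_simps)
  have cj: "continuous_on UNIV ?j" by (intro continuous_intros) auto
  have split: "J (t + h) ?j = integral {0..t} (\<lambda>s. g (t + h - s) * ?j s) + integral {t..t+h} (\<lambda>s. g (t + h - s) * ?j s)"
    unfolding J_def
    by (rule Henstock_Kurzweil_Integration.integral_combine[symmetric]) (use assms in \<open>auto intro!: J_int[OF cj]\<close>)
  have d: "integral {0..t} (\<lambda>s. g (t + h - s) * ?j s) - J t ?j
      = integral {0..t} (\<lambda>s. (g (t + h - s) - g (t - s)) * ?j s)"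
    unfolding J_def left_diff_distrib
    by (rule Henstock_Kurzweil_Integration.integral_diff[symmetric]) (intro J_int[OF cj])+
  have e: "integral {0..t} (\<lambda>s. (g (t + h - s) - g (t - s)) * ?j s)
     = integral {0..t} (\<lambda>s. (g (t + h - s) - g (t - s)) * ?q s) - integral {0..t} (\<lambda>s. (g (t + h - s) - g (t - s)) * ?k)"
    unfolding j right_diff_distrib
    by (rule Henstock_Kurzweil_Integration.integral_diff; intro int_UNIV continuous_intros; auto)
  \<comment> \<open>Changing \<open>t - s\<close> to \<open>t + h - s\<close> merely shifts the
    window over which \<open>g\<close> is integrated, so only the two end pieces of length
    \<open>h\<close> remain.\<close>
  have g1: "integral {0..t} (\<lambda>s. g (t + h - s) - g (t - s)) = integral {t..t+h} g - integral {0..0+h} g"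
  proof -
    have "integral {0..t} (\<lambda>s. g (t + h - s)) = integral {0..t} (\<lambda>s. g (s + h))"
      using int_reflect[of t "\<lambda>s. g (s + h)"] by (simp add: algebra_simps)
    also have "\<dots> = integral {h..t+h} g"
      using integral_shift_real_ivl[of h h "t + h" g] by simp
    finally have 1: "integral {0..t} (\<lambda>s. g (t + h - s)) = integral {h..t+h} g" .
    have "integral {0..h} g + integral {h..t+h} g = integral {0..t+h} g"
      "integral {0..t} g + integral {t..t+h} g = integral {0..t+h} g"
      using assms by (auto intro!: Henstock_Kurzweil_Integration.integral_combine int_UNIV g_cont)
    moreover have "integral {0..t} (\<lambda>s. g (t + h - s) - g (t - s)) = integral {h..t+h} g - integral {0..t} g"
      using 1 int_reflect[of t g]
      by (subst Henstock_Kurzweil_Integration.integral_diff) (auto intro!: int_UNIV continuous_intros)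
    ultimately show ?thesis by simp
  qed
  have g2: "integral {0..t} (\<lambda>s. (g (t + h - s) - g (t - s)) * ?k) = ?k * (integral {t..t+h} g - integral {0..0+h} g)"
    using g1 by simp
  have "integral {0..t} (\<lambda>s. (g (t + h - s) - g (t - s)) * ?q s)
     \<le> integral {0..t} (\<lambda>s. (- h) * (\<xi> (t + h - s) * g (t + h - s) powr p * (q t s + q (t + h) s) / 4))"
  proof (rule integral_le)
    fix s assume s: "s \<in> {0..t}"
    have "h * (\<xi> (t + h - s) * g (t + h - s) powr p) \<le> g (t - s) - g (t + h - s)"
      using g_decr[of "t - s" h] s assms by (simp add: algebra_simps)
    then have "(g (t + h - s) - g (t - s)) * ?q s \<le> - (h * (\<xi> (t + h - s) * g (t + h - s) powr p)) * ?q s"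
      using q_nonneg[of t s] q_nonneg[of "t + h" s] by (intro mult_right_mono) auto
    also have "\<dots> = - h * (\<xi> (t + h - s) * g (t + h - s) powr p * (q t s + q (t + h) s) / 4)"
      by simp
    finally show "(g (t + h - s) - g (t - s)) * ?q s \<le> \<dots>" .
  qed (intro int_UNIV continuous_intros; use p_ge g_pos in auto)+
  also have "\<dots> = - h * integral {0..t} (\<lambda>s. \<xi> (t + h - s) * g (t + h - s) powr p * (q t s + q (t + h) s)) / 4"
    by simp
  finally have f: "integral {0..t} (\<lambda>s. (g (t + h - s) - g (t - s)) * ?q s) \<le> \<dots>" .
  have rhs: "h * (I / h - V / 4 - k * (a / h - b / h)) = I - h * V / 4 - k * (a - b)" for I V k a b
    using assms by (simp add: field_simps)
  have "J (t + h) ?j - J t ?j \<le> h * (integral {t..t+h} (\<lambda>s. g (t + h - s) * ?j s) / h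
      - integral {0..t} (\<lambda>s. \<xi> (t + h - s) * g (t + h - s) powr p * (q t s + q (t + h) s)) / 4
      - (K t t + K (t + h) (t + h)) / 4 * (integral {t..t+h} g / h - integral {0..0+h} g / h))"
    unfolding rhs using split d e f g2 by linarith
  then show ?thesis using assms by (simp add: pos_divide_le_eq mult.commute)
qed

lemma en_dini:
  assumes t: "t > 0" and e: "e > 0"
    and lim1: "((\<lambda>h. (W t (t + h) - W t t) / h) \<longlongrightarrow> - P t) (at_right 0)"
    and lim2: "((\<lambda>h. (W (t + h) (t + h) - W (t + h) t) / h) \<longlongrightarrow> - P t) (at_right 0)"
  shows "eventually (\<lambda>h. en (t + h) \<le> en t - h * dissip t + e * h) (at_right 0)"
proof -
  let ?V = "\<lambda>h. integral {0..t} (\<lambda>s. \<xi> (t + h - s) * g (t + h - s) powr p * (q t s + q (t + h) s))"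
  have l1: "((\<lambda>h. integral {t..t+h} (\<lambda>s. g (t + h - s) * (K s s / 2 - K t s / 2 - K (t + h) s / 2)) / h)
     \<longlongrightarrow> g (t + 0 - t) * (K t t / 2 - K t t / 2 - K (t + 0) t / 2)) (at_right 0)"
    by (rule short_integral_tendsto[where H = "\<lambda>h s. g (t + h - s) * (K s s / 2 - K t s / 2 - K (t + h) s / 2)"])
       (intro continuous_intros, auto)
  have l2: "((\<lambda>h. integral {t..t+h} g / h) \<longlongrightarrow> g t) (at_right 0)"
     "((\<lambda>h. integral {0..0+h} g / h) \<longlongrightarrow> g 0) (at_right 0)"
    by (rule short_integral_tendsto[where H = "\<lambda>h. g"], intro continuous_intros)+
  have "continuous_on UNIV (\<lambda>h. integral (cbox 0 t) (\<lambda>s. \<xi> (t + h - s) * g (t + h - s) powr p * (q t s + q (t + h) s)))"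
    by (rule integral_continuous_on_param) (unfold split_def, intro continuous_intros, use p_ge g_pos in auto)
  then have "continuous_on UNIV ?V" by simp
  then have l3: "(?V \<longlongrightarrow> ?V 0) (at_right 0)"
    by (rule continuous_tendsto_right)
  have "continuous_on UNIV (\<lambda>h. K (t + h) (t + h))" by (intro continuous_intros)
  then have l4: "((\<lambda>h. K (t + h) (t + h)) \<longlongrightarrow> K (t + 0) (t + 0)) (at_right 0)"
    by (rule continuous_tendsto_right)
  let ?B = "\<lambda>h. 1/2 * ((W t (t + h) - W t t) / h) + 1/2 * ((W (t + h) (t + h) - W (t + h) t) / h) +
      (integral {t..t+h} (\<lambda>s. g (t + h - s) * (K s s / 2 - K t s / 2 - K (t + h) s / 2)) / h
      - ?V h / 4
      - (K t t + K (t + h) (t + h)) / 4 * (integral {t..t+h} g / h - integral {0..0+h} g / h))"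
  let ?L = "1/2 * (- P t) + 1/2 * (- P t) + (g (t + 0 - t) * (K t t / 2 - K t t / 2 - K (t + 0) t / 2) - ?V 0 / 4
    - (K t t + K (t + 0) (t + 0)) / 4 * (g t - g 0))"
  have "(?B \<longlongrightarrow> ?L) (at_right 0)"
    by (intro tendsto_intros l1 l2 l3 l4 lim1 lim2) auto
  moreover have V0: "?V 0 = 2 * integral {0..t} (\<lambda>s. \<xi> (t - s) * g (t - s) powr p * q t s)"
  proof -
    have "?V 0 = integral {0..t} (\<lambda>s. 2 * (\<xi> (t - s) * g (t - s) powr p * q t s))"
      by (rule Henstock_Kurzweil_Integration.integral_cong) simp
    then show ?thesis by simp
  qed
  \<comment> \<open>The two terms containing \<open>g 0\<close> cancel. Besides
    \<open>- dissip t\<close> there remains \<open>- g t * K t t / 2\<close>, which is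
    dropped.\<close>
  have "?L \<le> - dissip t"
    using mult_nonneg_nonneg[OF g_pos K_pos, of t t] unfolding V0 by (simp add: dissip_def field_simps)
  then have "?L < - dissip t + e" using e by simp
  ultimately have "eventually (\<lambda>h. ?B h < - dissip t + e) (at_right 0)" by (rule order_tendstoD)
  with eventually_at_right_less[of 0] show ?thesis
  proof eventually_elim
    case (elim h)
    have "(en (t + h) - en t) / h \<le> ?B h"
      unfolding en_increment add_divide_distrib[of _ _ h]
      using J_increment_bound[of t h] t elim by simp
    with elim have "(en (t + h) - en t) / h < - dissip t + e" by linarith
    then show ?case using elim by (simp add: field_simps)
  qed
qed


lemma dissip_nonneg: "t > 0 \<Longrightarrow> dissip t \<ge> 0"
  unfolding dissip_def
  by (intro add_nonneg_nonneg P_pos mult_nonneg_nonneg integral_nonneg int_UNIV continuous_intros)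
     (use p_ge g_pos \<xi>_pos q_nonneg in auto)

lemma en_cont: "continuous_on {0..} en"
  unfolding en_def memq_def
  by (intro continuous_intros continuous_on_integral_upto) auto

lemma int_g_nonneg: "integral {0..t} g \<ge> 0"
  by (intro integral_nonneg int_UNIV g_cont) (auto intro: g_pos)

lemma en_ge_K: "t \<ge> 0 \<Longrightarrow> l / 2 * K t t \<le> en t"
  using mult_right_mono[OF g_int K_pos, of t t] memq_nonneg[of t] by (simp add: en_def)

lemma en_nonneg: "t \<ge> 0 \<Longrightarrow> en t \<ge> 0"
  using en_ge_K[of t] mult_nonneg_nonneg[OF less_imp_le[OF l_pos] K_pos, of t] by linarith

end

section \<open>Integration of differential inequalities for Dini derivatives\<close>

lemma decay_exp:
  fixes E \<xi> :: "real \<Rightarrow> real"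
  assumes cont: "continuous_on {0..} E" and pos: "\<And>t. t \<ge> 0 \<Longrightarrow> E t \<ge> 0"
    and mono: "\<And>s t. 0 \<le> s \<Longrightarrow> s \<le> t \<Longrightarrow> E t \<le> E s"
    and \<xi>: "continuous_on UNIV \<xi>" and c: "c > 0"
    and dini: "\<And>t e. t > 0 \<Longrightarrow> e > 0 \<Longrightarrow>
       eventually (\<lambda>h. E (t + h) \<le> E t - h * (c * (\<xi> t * E t)) + e * h) (at_right 0)"
    and t: "t \<ge> 0"
  shows "E t \<le> E 0 * exp (- c * integral {0..t} \<xi>)"
proof (cases "E t = 0")
  case True
  then show ?thesis using pos[of 0] by simp
next
  case False
  with pos t have Et: "E t > 0" by (simp add: less_le)
  have Epos: "E x > 0" if "0 \<le> x" "x \<le> t" for x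
    using mono[OF that] Et by simp
  \<comment> \<open>Monotonicity of \<open>E\<close> and \<open>E t > 0\<close> make
    \<open>E\<close> positive on all of \<open>{0..t}\<close>, so the logarithm is legitimate there;
    the decay claim is exactly that \<open>f\<close> does not increase.\<close>
  define f where "f x = ln (E x) + c * integral {0..x} \<xi>" for x
  have "f t \<le> f 0"
  proof (rule dini_nonincreasing[OF t])
    have "continuous_on {0..} (\<lambda>x. integral {0..x} \<xi>)"
      by (rule continuous_on_integral_upto) (intro continuous_on_compose2[OF \<xi>] continuous_intros, auto)
    then have "continuous_on {0..t} (\<lambda>x. integral {0..x} \<xi>)"
      by (rule continuous_on_subset) auto
    then show "continuous_on {0..t} f" unfolding f_def
      by (intro continuous_intros continuous_on_subset[OF cont]) (use Epos in force)+
  next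
    fix x e :: real assume x: "0 < x" "x < t" and e: "e > 0"
    define y where "y = E x"
    have y: "y > 0" using Epos x by (simp add: y_def)
    have "((\<lambda>h. integral {x..x+h} \<xi> / h) \<longlongrightarrow> \<xi> x) (at_right 0)"
      by (rule short_integral_tendsto[where H = "\<lambda>h. \<xi>"])
         (intro continuous_on_compose2[OF \<xi>] continuous_intros, auto)
    moreover have "\<xi> x < \<xi> x + e / (2 * c)" using e c by simp
    ultimately have 1: "eventually (\<lambda>h. integral {x..x+h} \<xi> / h < \<xi> x + e / (2 * c)) (at_right 0)"
      by (rule order_tendstoD)
    \<comment> \<open>The slack \<open>e * y / 2\<close> becomes \<open>e / 2\<close> after division
      by \<open>y\<close>; the other half of \<open>e\<close> pays for replacing the short average
      of \<open>\<xi>\<close> by its value at \<open>x\<close>.\<close>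
    have 2: "eventually (\<lambda>h. E (x + h) \<le> y - h * (c * (\<xi> x * y)) + e * y / 2 * h) (at_right 0)"
      unfolding y_def by (rule dini) (use x e y y_def in auto)
    have 3: "eventually (\<lambda>h. 0 < h \<and> x + h < t) (at_right 0)"
      using x by (auto simp: eventually_at_right_field intro!: exI[of _ "t - x"])
    from 1 2 3 show "eventually (\<lambda>h. f (x + h) \<le> f x + e * h) (at_right 0)"
    proof eventually_elim
      case (elim h)
      have Eh: "E (x + h) > 0" using elim x by (intro Epos) auto
      have "ln (E (x + h)) - ln y = ln (E (x + h) / y)" using Eh y by (simp add: ln_div)
      also have "\<dots> \<le> E (x + h) / y - 1" using Eh y by (intro ln_le_minus_one) simp
      also have "\<dots> \<le> (y - h * (c * (\<xi> x * y)) + e * y / 2 * h) / y - 1"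
        using elim y by (intro diff_mono divide_right_mono) auto
      also have "\<dots> = - h * c * \<xi> x + e / 2 * h" using y by (simp add: field_simps)
      finally have A: "ln (E (x + h)) - ln y \<le> - h * c * \<xi> x + e / 2 * h" .
      have "integral {0..x+h} \<xi> = integral {0..x} \<xi> + integral {x..x+h} \<xi>"
        by (rule Henstock_Kurzweil_Integration.integral_combine[symmetric])
           (use elim x in \<open>auto intro!: integrable_continuous_real continuous_on_subset[OF \<xi>]\<close>)
      moreover have "integral {x..x+h} \<xi> \<le> h * (\<xi> x + e / (2 * c))" using elim by (simp add: field_simps)
      then have "c * integral {x..x+h} \<xi> \<le> c * (h * (\<xi> x + e / (2 * c)))" using c by simp
      moreover have "c * (h * (\<xi> x + e / (2 * c))) = h * c * \<xi> x + e / 2 * h" using c by (simp add: field_simps)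
      ultimately show ?case using A by (simp add: f_def y_def algebra_simps)
    qed
  qed
  then have "ln (E t) \<le> ln (E 0) - c * integral {0..t} \<xi>" by (simp add: f_def)
  then have "exp (ln (E t)) \<le> exp (ln (E 0) - c * integral {0..t} \<xi>)" by simp
  then show ?thesis using Et Epos[of 0] t by (simp add: exp_diff exp_minus divide_inverse)
qed

text \<open>By convexity the tangent of \<open>z powr (-a)\<close> at \<open>y\<close> lies below
  the graph. This turns an upper bound for an increment of the energy into a lower bound for the
  increment of its negative power.\<close>

lemma powr_neg_tangent:
  fixes a y z :: real
  assumes "y > 0" "z > 0" "a > 0"
  shows "y powr (-a) * (1 - a * (z / y - 1)) \<le> z powr (-a)"
proof -
  have "1 - a * (z / y - 1) \<le> 1 - a * ln (z / y)"
    using ln_le_minus_one[of "z / y"] assms by simp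
  also have "\<dots> \<le> exp (- a * ln (z / y))" using exp_ge_add_one_self[of "- a * ln (z / y)"] by simp
  also have "\<dots> = (z / y) powr (-a)" using assms by (simp add: powr_def)
  finally have "y powr (-a) * (1 - a * (z / y - 1)) \<le> y powr (-a) * (z / y) powr (-a)"
    by (intro mult_left_mono) auto
  also have "\<dots> = z powr (-a)" using assms by (simp add: powr_divide)
  finally show ?thesis .
qed

lemma decay_power:
  fixes E \<xi> :: "real \<Rightarrow> real"
  assumes cont: "continuous_on {0..} E" and pos: "\<And>t. t \<ge> 0 \<Longrightarrow> E t \<ge> 0"
    and mono: "\<And>s t. 0 \<le> s \<Longrightarrow> s \<le> t \<Longrightarrow> E t \<le> E s"
    and \<xi>: "continuous_on UNIV \<xi>" and \<xi>0: "\<And>t. \<xi> t \<ge> 0" and c: "c > 0" and r: "r > 1"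
    and dini: "\<And>t e. t > 0 \<Longrightarrow> e > 0 \<Longrightarrow>
       eventually (\<lambda>h. E (t + h) \<le> E t - h * (c * (\<xi> t * E t) powr r) + e * h) (at_right 0)"
  shows "\<exists>L>0. \<forall>t\<ge>0. E t \<le> L * (1 + integral {0..t} (\<lambda>s. \<xi> s powr r)) powr (-1 / (r - 1))"
proof (cases "E 0 = 0")
  case True
  have "E t \<le> 0" if "t \<ge> 0" for t using mono[of 0 t] that True by simp
  moreover have "0 \<le> 1 * (1 + integral {0..t} (\<lambda>s. \<xi> s powr r)) powr (-1 / (r - 1))" for t by simp
  ultimately show ?thesis by (intro exI[of _ 1]) (blast intro: order_trans zero_less_one)
next
  case False
  with pos[of 0] have E0: "E 0 > 0" by simp
  let ?I = "\<lambda>t. integral {0..t} (\<lambda>s. \<xi> s powr r)"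
  have \<xi>r: "continuous_on UNIV (\<lambda>s. \<xi> s powr r)"
    by (rule continuous_on_powr') (use \<xi> \<xi>0 r in \<open>auto intro: continuous_intros\<close>)
  have I0: "?I t \<ge> 0" for t
    by (intro integral_nonneg integrable_continuous_real continuous_on_subset[OF \<xi>r]) auto
  \<comment> \<open>A common lower bound for the two coefficients in
    \<open>E 0 powr (1 - r) + c * (r - 1) * ?I t\<close>, so that this sum is at least
    \<open>k * (1 + ?I t)\<close>.\<close>
  define k where "k = min (E 0 powr (1 - r)) (c * (r - 1))"
  have k: "k > 0" using E0 c r by (auto simp: k_def)
  show ?thesis
  proof (intro exI[of _ "k powr (-1 / (r - 1))"] conjI allI impI)
    show "k powr (-1 / (r - 1)) > 0" using k by simp
  next
    fix t :: real assume t: "t \<ge> 0"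
    show "E t \<le> k powr (-1 / (r - 1)) * (1 + ?I t) powr (-1 / (r - 1))"
    proof (cases "E t = 0")
      case False
      with pos t have Et: "E t > 0" by (simp add: less_le)
      have Epos: "E x > 0" if "0 \<le> x" "x \<le> t" for x
        using mono[OF that] Et by simp
      \<comment> \<open>Formally \<open>E powr (1 - r)\<close> grows at least at the rate
        \<open>c * (r - 1) * \<xi> powr r\<close>; that \<open>f\<close> does not increase is the
        integrated form.\<close>
      define f where "f x = c * (r - 1) * ?I x - E x powr (1 - r)" for x
      have "f t \<le> f 0"
      proof (rule dini_nonincreasing[OF t])
        have "continuous_on {0..} ?I"
          by (rule continuous_on_integral_upto) (intro continuous_on_compose2[OF \<xi>r] continuous_intros, auto)
        then have "continuous_on {0..t} ?I"
          by (rule continuous_on_subset) auto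
        moreover have "continuous_on {0..t} (\<lambda>x. E x powr (1 - r))"
          by (intro continuous_on_powr continuous_on_subset[OF cont] continuous_intros) (use Epos in force)+
        ultimately show "continuous_on {0..t} f" unfolding f_def
          by (intro continuous_on_diff continuous_on_mult continuous_on_const)
      next
        fix x e :: real assume x: "0 < x" "x < t" and e: "e > 0"
        define y where "y = E x"
        have y: "y > 0" using Epos x by (simp add: y_def)
        \<comment> \<open>Chosen so that \<open>(r - 1) * d * y powr (- r) = e / 2\<close>: the
          tangent of the negative power multiplies the slack by
          \<open>(r - 1) * y powr (- r)\<close>.\<close>
        define d where "d = e / 2 * y powr r / (r - 1)"
        have d: "d > 0" using e y r by (simp add: d_def)
        have "((\<lambda>h. integral {x..x+h} (\<lambda>s. \<xi> s powr r) / h) \<longlongrightarrow> \<xi> x powr r) (at_right 0)"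
          by (rule short_integral_tendsto[where H = "\<lambda>h s. \<xi> s powr r"])
             (intro continuous_on_compose2[OF \<xi>r] continuous_intros, auto)
        moreover have "\<xi> x powr r < \<xi> x powr r + e / (2 * (c * (r - 1)))" using e c r by simp
        ultimately have 1: "eventually (\<lambda>h. integral {x..x+h} (\<lambda>s. \<xi> s powr r) / h < \<xi> x powr r + e / (2 * (c * (r - 1)))) (at_right 0)"
          by (rule order_tendstoD)
        have 2: "eventually (\<lambda>h. E (x + h) \<le> y - h * (c * (\<xi> x * y) powr r) + d * h) (at_right 0)"
          unfolding y_def by (rule dini) (use x d in auto)
        have 3: "eventually (\<lambda>h. 0 < h \<and> x + h < t) (at_right 0)"
          using x by (auto simp: eventually_at_right_field intro!: exI[of _ "t - x"])
        from 1 2 3 show "eventually (\<lambda>h. f (x + h) \<le> f x + e * h) (at_right 0)"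
        proof eventually_elim
          case (elim h)
          have Eh: "E (x + h) > 0" using elim x by (intro Epos) auto
          have "(E (x + h) / y - 1) \<le> (y - h * (c * (\<xi> x * y) powr r) + d * h) / y - 1"
            using elim y by (intro diff_mono divide_right_mono) auto
          also have "\<dots> = - h * (c * (\<xi> x powr r * y powr r)) / y + d * h / y"
            using y \<xi>0[of x] by (simp add: field_simps powr_mult)
          finally have "(r - 1) * (E (x + h) / y - 1) \<le> (r - 1) * (- h * (c * (\<xi> x powr r * y powr r)) / y + d * h / y)"
            using r by (intro mult_left_mono) auto
          then have "y powr (1 - r) * (1 - (r - 1) * (- h * (c * (\<xi> x powr r * y powr r)) / y + d * h / y))
             \<le> y powr (1 - r) * (1 - (r - 1) * (E (x + h) / y - 1))"
            by (intro mult_left_mono) auto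
          also have "\<dots> \<le> E (x + h) powr (1 - r)"
            using powr_neg_tangent[OF y Eh, of "r - 1"] r by simp
          also have "y powr (1 - r) * (1 - (r - 1) * (- h * (c * (\<xi> x powr r * y powr r)) / y + d * h / y))
            = y powr (1 - r) + (y powr (1 - r) * y powr r / y) * (h * c * (r - 1) * \<xi> x powr r)
               - (y powr (1 - r) * y powr r / y) * (e / 2 * h)"
          proof -
            have rd: "(r - 1) * d = e / 2 * y powr r" 
            proof -
              have "(r - 1) * (z / (r - 1)) = z" for z using r by simp
              then show ?thesis by (simp only: d_def)
            qed
            have id: "w * (1 - (r - 1) * (- h * (c * (X * Y)) / y + d * h / y))
              = w + (w * Y / y) * (h * c * (r - 1) * X) - w * ((r - 1) * d) * h / y" for w X Y
              using y by (simp add: field_simps)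
            show ?thesis by (subst id, subst rd) (simp add: mult_ac)
          qed
          also have "y powr (1 - r) * y powr r / y = 1" using y by (simp flip: powr_add)
          finally have A: "y powr (1 - r) + h * c * (r - 1) * \<xi> x powr r - e / 2 * h \<le> E (x + h) powr (1 - r)"
            by simp
          have gen: "a2 - E' \<le> e * h - y'" if "a2 \<le> Z + e / 2 * h" "y' + Z - e / 2 * h \<le> E'" for a2 Z E' y' :: real
            using that by simp
          have I: "?I (x + h) = ?I x + integral {x..x+h} (\<lambda>s. \<xi> s powr r)"
            by (rule Henstock_Kurzweil_Integration.integral_combine[symmetric])
               (use elim x in \<open>auto intro!: integrable_continuous_real continuous_on_subset[OF \<xi>r]\<close>)
          have "integral {x..x+h} (\<lambda>s. \<xi> s powr r) \<le> h * (\<xi> x powr r + e / (2 * (c * (r - 1))))"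
            using elim by (simp add: field_simps)
          then have "(c * (r - 1)) * integral {x..x+h} (\<lambda>s. \<xi> s powr r) \<le> (c * (r - 1)) * (h * (\<xi> x powr r + e / (2 * (c * (r - 1)))))"
            using c r by (intro mult_left_mono) auto
          also have "\<dots> = h * c * (r - 1) * \<xi> x powr r + e / 2 * h"
            using c r by (simp add: distrib_left)
          finally have "c * (r - 1) * integral {x..x+h} (\<lambda>s. \<xi> s powr r) - E (x + h) powr (1 - r) \<le> e * h - y powr (1 - r)"
            using A by (rule gen)
          then have "c * (r - 1) * ?I (x + h) - E (x + h) powr (1 - r) \<le> c * (r - 1) * ?I x - y powr (1 - r) + e * h"
            unfolding I by (simp add: distrib_left)
          then show ?case by (simp add: f_def y_def)
        qed
      qed
      then have "E 0 powr (1 - r) + c * (r - 1) * ?I t \<le> E t powr (1 - r)" by (simp add: f_def)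
      moreover have "k * (1 + ?I t) \<le> E 0 powr (1 - r) + c * (r - 1) * ?I t"
      proof -
        have "k * ?I t \<le> c * (r - 1) * ?I t" using I0 by (intro mult_right_mono) (auto simp: k_def)
        then show ?thesis by (simp add: algebra_simps k_def)
      qed
      ultimately have "k * (1 + ?I t) \<le> E t powr (1 - r)" by linarith
      moreover have "0 < k * (1 + ?I t)" using k I0[of t] by simp
      ultimately have "(E t powr (1 - r)) powr (-1 / (r - 1)) \<le> (k * (1 + ?I t)) powr (-1 / (r - 1))"
        using r by (intro powr_mono2') (auto simp: divide_nonpos_pos)
      moreover have "(E t powr (1 - r)) powr (-1 / (r - 1)) = E t"
      proof -
        have "(1 - r) * (-1 / (r - 1)) = 1" using r by (simp add: divide_simps)
        then show ?thesis unfolding powr_powr using Et by simp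
      qed
      ultimately show ?thesis using k I0[of t] by (simp add: powr_mult)
    qed (use k I0 in auto)
  qed
qed

lemma powr_concave_tangent:
  fixes a y z :: real
  assumes "y > 0" "z \<ge> 0" "0 < a" "a \<le> 1"
  shows "z powr a \<le> y powr a * (1 + a * (z / y - 1))"
proof (cases "z = 0")
  case False
  with assms have z: "z > 0" by simp
  define w where "w = z / y"
  define s where "s = 1 + a * (w - 1)"
  have w: "w > 0" using z assms by (simp add: w_def)
  have s: "s > 0" using w assms by (simp add: s_def algebra_simps) (smt (verit) mult_pos_pos)
  have "a * (ln w - ln s) \<le> a * (w / s - 1)"
    using ln_le_minus_one[of "w / s"] w s assms by (intro mult_left_mono) (auto simp: ln_div)
  moreover have "(1 - a) * (- ln s) \<le> (1 - a) * (1 / s - 1)"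
    using ln_le_minus_one[of "1 / s"] s assms by (intro mult_left_mono) (auto simp: ln_div)
  ultimately have "a * ln w - ln s \<le> a * (w / s - 1) + (1 - a) * (1 / s - 1)"
    by (simp add: algebra_simps)
  also have "\<dots> = 0" using s by (simp add: field_simps) (simp add: s_def algebra_simps)
  finally have "exp (a * ln w) \<le> s" using s by (metis diff_le_0_iff_le exp_le_cancel_iff exp_ln)
  then have "w powr a \<le> s" using w by (simp add: powr_def)
  then have "y powr a * w powr a \<le> y powr a * s" by (intro mult_left_mono) auto
  then show ?thesis using assms z by (simp add: w_def s_def powr_divide)
qed (use assms in \<open>auto intro!: mult_nonneg_nonneg\<close>)

text \<open>The choice \<open>c = X\<close> balances the two terms. If \<open>X = 0\<close>, letting
  \<open>c\<close> tend to \<open>0\<close> removes the second term because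
  \<open>\<theta> > 0\<close>. The factor 2 matches the factor 1/2 in front of the integral in
  \<open>dissip\<close>.\<close>

lemma le_const_powr_of_young:
  fixes V X C \<theta> :: real
  assumes "X \<ge> 0" "C \<ge> 0" "\<theta> > 0"
    and *: "\<And>c. c > 0 \<Longrightarrow> V \<le> c powr (\<theta> - 1) * (2 * X) + c powr \<theta> * C"
  shows "V \<le> (2 + C) * X powr \<theta>"
proof (cases "X = 0")
  case False
  with assms have X: "X > 0" by simp
  have "X powr (\<theta> - 1) * X = X powr \<theta>" using X by (simp add: powr_diff)
  then show ?thesis using *[OF X] by (simp add: algebra_simps)
next
  case True
  have "V \<le> 0 + e" if e: "e > 0" for e
  proof -
    have "V \<le> ((e / (C + 1)) powr (1 / \<theta>)) powr \<theta> * C"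
      using *[of "(e / (C + 1)) powr (1 / \<theta>)"] True e assms by simp
    also have "\<dots> = e / (C + 1) * C" using e assms by (simp add: powr_powr)
    also have "\<dots> \<le> e" using e assms by (simp add: field_simps)
    finally show ?thesis by simp
  qed
  then have "V \<le> 0" by (rule field_le_epsilon)
  then show ?thesis using True by simp
qed

section \<open>Lower bounds for the dissipation and decay of the abstract energy\<close>

text \<open>\<open>damping\<close> combines Young's inequality with free weight \<open>\<mu>\<close>
  and the Sobolev bound: \<open>P t\<close> controls the velocity, \<open>K t t powr (m / 2)\<close>
  the solution. \<open>lim1\<close> and \<open>lim2\<close> are right derivatives of
  \<open>W\<close> in its second argument, with the first argument fixed at \<open>t\<close> or
  moving along with \<open>h\<close>; these are the two quotients in the energy increment.\<close>

locale memory_energy_damped = memory_energy +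
  fixes B m :: real
  assumes m_ge: "m \<ge> 2" and B_pos: "B \<ge> 0"
    and damping: "t > 0 \<Longrightarrow> \<mu> > 0 \<Longrightarrow> \<bar>W t t\<bar> \<le> B * (P t / \<mu> + \<mu> powr (m - 1) * K t t powr (m / 2))"
    and lim1: "t > 0 \<Longrightarrow> ((\<lambda>h. (W t (t + h) - W t t) / h) \<longlongrightarrow> - P t) (at_right 0)"
    and lim2: "t > 0 \<Longrightarrow> ((\<lambda>h. (W (t + h) (t + h) - W (t + h) t) / h) \<longlongrightarrow> - P t) (at_right 0)"
    and q_le: "K s s - 2 * K s t + K t t \<le> 2 * (K s s + K t t)"
begin

lemma en_antimono:
  assumes "0 \<le> s" "s \<le> t"
  shows "en t \<le> en s"
proof (rule dini_nonincreasing[OF assms(2)])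
  show "continuous_on {s..t} en" by (rule continuous_on_subset[OF en_cont]) (use assms in auto)
next
  fix x e :: real assume x: "s < x" "x < t" and e: "e > 0"
  then have "x > 0" using assms by simp
  from en_dini[OF this e lim1 lim2, OF this this] eventually_at_right_less[of 0]
  show "eventually (\<lambda>h. en (x + h) \<le> en x + e * h) (at_right 0)"
  proof eventually_elim
    case (elim h)
    moreover have "h * dissip x \<ge> 0" using elim dissip_nonneg[OF \<open>x > 0\<close>] by simp
    ultimately show ?case by linarith
  qed
qed

lemma K_le: "t \<ge> 0 \<Longrightarrow> K t t \<le> 2 / l * en t"
  using en_ge_K[of t] l_pos by (simp add: field_simps)

lemma K_le0: "t \<ge> 0 \<Longrightarrow> K t t \<le> 2 / l * en 0"
  using K_le[of t] en_antimono[of 0 t] l_pos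
  by (meson divide_nonneg_pos dual_order.refl mult_left_mono order_trans zero_le_numeral)

text \<open>\<open>(1 - integral {0..t} g) * K t t\<close> equals \<open>W t t\<close> plus the
  memory integral of \<open>K t s - K t t\<close>. Damping bounds the first, Cauchy-Schwarz the
  second; each leaves \<open>l / 4 * K t t\<close>, and both are absorbed by the left side, which is
  at least \<open>l * K t t\<close>.\<close>

lemma en_le_P_memq: "\<exists>C>0. \<forall>t>0. en t \<le> C * (P t + memq t)"
proof -
  \<comment> \<open>A uniform bound for \<open>K t t powr ((m - 2) / 2)\<close>, available because
    the energy never exceeds its initial value. The maximum with 1 keeps \<open>k\<close> positive
    even when \<open>en 0 = 0\<close>.\<close>
  define k where "k = max 1 (2 / l * en 0) powr ((m - 2) / 2)"
  have k: "k > 0" by (simp add: k_def)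
  \<comment> \<open>Small enough for the term coming from damping to cost only \<open>l / 4\<close>.
    The bound by 1 gives \<open>\<mu> powr (m - 1) \<le> \<mu>\<close> since
    \<open>m - 1 \<ge> 1\<close>, and the \<open>+ 1\<close> avoids division by zero when
    \<open>B = 0\<close>.\<close>
  define \<mu> where "\<mu> = min 1 (l / (4 * (B * k + 1)))"
  have Bk: "B * k \<ge> 0" using B_pos k by simp
  have \<mu>: "\<mu> > 0" "\<mu> \<le> 1" using l_pos Bk by (auto simp: \<mu>_def)
  have "B * \<mu> powr (m - 1) * k \<le> B * \<mu> powr 1 * k"
    using \<mu> m_ge B_pos k by (intro mult_right_mono mult_left_mono powr_mono') auto
  also have "\<dots> = (B * k) * \<mu>" using \<mu> by simp
  also have "\<dots> \<le> (B * k + 1) * (l / (4 * (B * k + 1)))"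
    using Bk \<mu> by (intro mult_mono) (auto simp: \<mu>_def)
  also have "\<dots> = l / 4" using Bk by (simp add: field_simps)
  finally have \<mu>k: "B * \<mu> powr (m - 1) * k \<le> l / 4" .
  define C where "C = max (B / (\<mu> * l)) (1 / 2 + 1 / l\<^sup>2)"
  have "C \<ge> 1 / 2 + 1 / l\<^sup>2" "C \<ge> B / (\<mu> * l)" by (auto simp: C_def)
  moreover have "1 / l\<^sup>2 \<ge> 0" by simp
  ultimately have C: "C > 0" by linarith
  have "en t \<le> C * (P t + memq t)" if t: "t > 0" for t
  proof -
    have Kk: "K t t powr (m / 2) \<le> K t t * k"
    proof (cases "K t t = 0")
      case False
      then have K: "K t t > 0" using K_pos[of t] by simp
      have "K t t powr (m / 2) = K t t * K t t powr ((m - 2) / 2)"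
        using K by (simp add: diff_divide_distrib powr_diff)
      also have "K t t powr ((m - 2) / 2) \<le> k"
        unfolding k_def using K m_ge K_le0[of t] t by (intro powr_mono2) auto
      finally show ?thesis using K by simp
    qed auto
    have "B * \<mu> powr (m - 1) * K t t powr (m / 2) \<le> B * \<mu> powr (m - 1) * (K t t * k)"
      using Kk B_pos by (intro mult_left_mono) auto
    also have "\<dots> = (B * \<mu> powr (m - 1) * k) * K t t" by simp
    also have "\<dots> \<le> l / 4 * K t t" using \<mu>k K_pos by (intro mult_right_mono) auto
    finally have W: "W t t \<le> B * P t / \<mu> + l / 4 * K t t"
      using damping[OF t \<mu>(1)] by (simp add: algebra_simps)
    have "J t (\<lambda>s. K t s - K t t) \<le> J t (\<lambda>s. l / 4 * K t t + 1 / l * q t s)"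
      unfolding J_def
    proof (rule integral_le)
      fix s assume "s \<in> {0..t}"
      have "(K t s - K t t)\<^sup>2 \<le> q t s * K t t"
        using K_CS[of s t] by (simp add: q_def K_sym[of s t] algebra_simps)
      \<comment> \<open>Arithmetic-geometric mean: the square of the sum exceeds the square of the
        difference by four times the product, and \<open>4 * (l / 4) * (1 / l) = 1\<close>.\<close>
      also have "\<dots> \<le> (l / 4 * K t t + 1 / l * q t s)\<^sup>2"
      proof -
        have "0 \<le> (l / 4 * K t t - 1 / l * q t s)\<^sup>2" by simp
        then show ?thesis using l_pos by (simp add: power2_eq_square algebra_simps)
      qed
      finally have "\<bar>K t s - K t t\<bar> \<le> l / 4 * K t t + 1 / l * q t s"
        using l_pos K_pos[of t] q_nonneg[of t s] by (subst (asm) power2_le_iff_abs_le) auto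
      then show "g (t - s) * (K t s - K t t) \<le> g (t - s) * (l / 4 * K t t + 1 / l * q t s)"
        by (intro mult_left_mono g_pos) auto
    qed (intro J_int continuous_intros)+
    also have "J t (\<lambda>s. l / 4 * K t t + 1 / l * q t s) = l / 4 * K t t * integral {0..t} g + 1 / l * memq t"
    proof -
      have "J t (\<lambda>s. l / 4 * K t t + 1 / l * q t s) = J t (\<lambda>s. l / 4 * K t t) + J t (\<lambda>s. 1 / l * q t s)"
        by (intro J_add continuous_intros)
      also have "J t (\<lambda>s. 1 / l * q t s) = 1 / l * J t (q t)" by (rule J_cmult)
      finally show ?thesis unfolding J_const by (simp only: J_def memq_def)
    qed
    also have "l / 4 * K t t * integral {0..t} g \<le> l / 4 * K t t * 1"
      using g_int[of t] l_pos t K_pos[of t] by (intro mult_left_mono) auto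
    finally have J: "J t (\<lambda>s. K t s - K t t) \<le> l / 4 * K t t + 1 / l * memq t" by simp
    have "J t (\<lambda>s. K t s - K t t) = J t (K t) - K t t * integral {0..t} g"
      by (simp add: J_simps continuous_intros)
    moreover have "integral {0..t} (\<lambda>s. g (t - s) * K s t) = J t (K t)"
      unfolding J_def by (rule Henstock_Kurzweil_Integration.integral_cong) (subst K_sym, rule refl)
    then have "W t t = K t t - J t (K t)" by (simp only: W_def)
    ultimately have "(1 - integral {0..t} g) * K t t = W t t + J t (\<lambda>s. K t s - K t t)"
      by (simp add: algebra_simps)
    moreover have "l * K t t \<le> (1 - integral {0..t} g) * K t t"
      using g_int[of t] t K_pos by (intro mult_right_mono) auto
    ultimately have "l / 2 * K t t \<le> B * P t / \<mu> + 1 / l * memq t" using W J by linarith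
    then have "1 / l * (l / 2 * K t t) \<le> 1 / l * (B * P t / \<mu> + 1 / l * memq t)"
      using l_pos by (intro mult_left_mono) auto
    moreover have "1 / l * (l / 2 * K t t) = K t t / 2" using l_pos by simp
    moreover have "1 / l * (B * P t / \<mu> + 1 / l * memq t) = B / (\<mu> * l) * P t + 1 / l\<^sup>2 * memq t"
      by (simp add: power2_eq_square distrib_left)
    ultimately have "K t t / 2 \<le> B / (\<mu> * l) * P t + 1 / l\<^sup>2 * memq t" by linarith
    moreover have "en t \<le> 1/2 * memq t + K t t / 2"
      using mult_nonneg_nonneg[OF int_g_nonneg[of t] K_pos[of t]] by (simp add: en_def algebra_simps)
    ultimately have "en t \<le> B / (\<mu> * l) * P t + (1/2 + 1 / l\<^sup>2) * memq t"
      unfolding distrib_right by linarith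
    also have "\<dots> \<le> C * P t + C * memq t"
      using P_pos[OF t] memq_nonneg[of t] by (intro add_mono mult_right_mono) (auto simp: C_def)
    finally show ?thesis by (simp add: algebra_simps)
  qed
  then show ?thesis using C by blast
qed

text \<open>With \<open>X = dissip t\<close>, the product \<open>\<xi> t * en t\<close> is at most a
  multiple of \<open>X\<close> plus a multiple of \<open>X powr (1 / r)\<close>. If the linear term
  rules, the a priori bound \<open>M\<close> for the product upgrades it to its power
  \<open>r\<close>; if the other rules, raising to the power \<open>r\<close> is enough.\<close>

lemma dissip_ge:
  assumes r: "r \<ge> 1" and A: "A \<ge> 0"
    and memq: "\<And>t. t > 0 \<Longrightarrow> \<xi> t * memq t \<le> A * dissip t powr (1 / r)"
  shows "\<exists>c>0. \<forall>t>0. c * (\<xi> t * en t) powr r \<le> dissip t"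
proof -
  obtain C where C: "C > 0" "\<And>t. t > 0 \<Longrightarrow> en t \<le> C * (P t + memq t)" using en_le_P_memq by blast
  define M where "M = \<xi> 0 * en 0 + 1"
  \<comment> \<open>Each coefficient is doubled so that both alternatives failing would contradict
    the bound by the sum; the \<open>+ 1\<close> makes \<open>N\<close> positive.\<close>
  define N where "N = 2 * C * \<xi> 0 + 2 * C * A + 1"
  have N: "N > 0" using C A \<xi>_pos[of 0] by (simp add: N_def add_nonneg_pos)
  have M: "M > 0" using \<xi>_pos[of 0] en_nonneg[of 0] by (simp add: M_def add_nonneg_pos)
  define c where "c = min (1 / (N * M powr (r - 1))) (1 / N powr r)"
  have "c * (\<xi> t * en t) powr r \<le> dissip t" if t: "t > 0" for t
  proof (cases "\<xi> t * en t = 0")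
    case True then show ?thesis using dissip_nonneg[OF t] by auto
  next
    case False
    define z where "z = \<xi> t * en t"
    define X where "X = dissip t"
    have X: "X \<ge> 0" using dissip_nonneg[OF t] by (simp add: X_def)
    have "z \<ge> 0" using \<xi>_pos en_nonneg t by (simp add: z_def)
    with False have z: "z > 0" unfolding z_def by (metis less_eq_real_def)
    have PX: "P t \<le> X" unfolding X_def dissip_def
      using integral_nonneg[OF int_UNIV, of "\<lambda>s. \<xi> (t - s) * g (t - s) powr p * q t s" 0 t]
        \<xi>_pos q_nonneg g_pos p_ge by (force intro!: continuous_intros mult_nonneg_nonneg)
    have zM: "z \<le> M" unfolding z_def M_def
      using mult_mono[OF \<xi>_antimono[of 0 t] en_antimono[of 0 t]] \<xi>_pos[of 0] en_nonneg t by auto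
    have "z \<le> \<xi> t * (C * (P t + memq t))" unfolding z_def
      using C(2)[OF t] \<xi>_pos by (intro mult_left_mono) auto
    also have "\<dots> = C * (\<xi> t * P t) + C * (\<xi> t * memq t)" by (simp add: algebra_simps)
    also have "\<dots> \<le> C * (\<xi> 0 * X) + C * (A * X powr (1 / r))"
    proof (intro add_mono mult_left_mono)
      show "\<xi> t * P t \<le> \<xi> 0 * X"
        using PX P_pos[OF t] \<xi>_antimono[of 0 t] \<xi>_pos[of 0] t by (intro mult_mono) auto
      show "\<xi> t * memq t \<le> A * X powr (1 / r)" using memq[OF t] by (simp add: X_def)
    qed (use C in auto)
    finally have zX: "z \<le> C * \<xi> 0 * X + C * A * X powr (1 / r)" by (simp add: algebra_simps)
    have "z \<le> N * X \<or> z \<le> N * X powr (1 / r)"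
    proof (rule ccontr)
      assume "\<not> ?thesis"
      then have "N * X < z" "N * X powr (1 / r) < z" by auto
      moreover have "2 * C * \<xi> 0 * X \<le> N * X" "2 * C * A * X powr (1 / r) \<le> N * X powr (1 / r)"
        using X C A \<xi>_pos[of 0] by (auto simp: N_def intro!: mult_right_mono)
      ultimately show False using zX by linarith
    qed
    then show ?thesis
    proof
      assume *: "z \<le> N * X"
      have "z powr r = z * z powr (r - 1)" using z by (simp add: powr_diff)
      also have "\<dots> \<le> (N * X) * M powr (r - 1)"
        using * z zM r N X by (intro mult_mono powr_mono2) auto
      finally have "1 / (N * M powr (r - 1)) * z powr r \<le> X" using N M by (simp add: field_simps)
      moreover have "c * z powr r \<le> 1 / (N * M powr (r - 1)) * z powr r"
        by (intro mult_right_mono) (auto simp: c_def)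
      ultimately show ?thesis by (simp add: z_def X_def)
    next
      assume "z \<le> N * X powr (1 / r)"
      then have "z powr r \<le> (N * X powr (1 / r)) powr r" using z r by (intro powr_mono2) auto
      also have "\<dots> = N powr r * X" using N X r by (simp add: powr_mult powr_powr)
      finally have "1 / N powr r * z powr r \<le> X" using N by (simp add: field_simps)
      moreover have "c * z powr r \<le> 1 / N powr r * z powr r"
        by (intro mult_right_mono) (auto simp: c_def)
      ultimately show ?thesis by (simp add: z_def X_def)
    qed
  qed
  moreover have "c > 0" using N M by (simp add: c_def)
  ultimately show ?thesis by blast
qed

text \<open>The 8 arises from the factor 2 in \<open>q_le\<close>, two summands, and the factor
  \<open>2 / l\<close> in \<open>K_le\<close>. The energy at the earlier time controls both summands
  because the energy decreases.\<close>

lemma q_bound: "0 \<le> s \<Longrightarrow> s \<le> t \<Longrightarrow> q t s \<le> 8 / l * en s"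
proof -
  assume s: "0 \<le> s" "s \<le> t"
  have "q t s \<le> 2 * (K t t + K s s)" using q_le by (simp add: q_def)
  also have "\<dots> \<le> 2 * (2 / l * en s + 2 / l * en s)"
    using K_le[of t] K_le[of s] en_antimono[OF s] s l_pos
      mult_left_mono[OF en_antimono[OF s], of "2 / l"] by (intro mult_left_mono add_mono) auto
  finally show ?thesis by (simp add: field_simps)
qed

lemma int_gp_le: "t > 0 \<Longrightarrow> integral {0..t} (\<lambda>s. \<xi> (t - s) * g (t - s) powr p * q t s) \<le> 2 * dissip t"
  using P_pos[of t] by (simp add: dissip_def)

text \<open>For \<open>p = 1\<close> no interpolation occurs:
  \<open>\<xi> t \<le> \<xi> (t - s)\<close> moves \<open>\<xi>\<close> inside the integral and
  produces the dissipation. The exponent \<open>1 / 1\<close> fits \<open>dissip_ge\<close> with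
  \<open>r = 1\<close>.\<close>

lemma memq_exp: "p = 1 \<Longrightarrow> t > 0 \<Longrightarrow> \<xi> t * memq t \<le> 2 * dissip t powr (1 / 1)"
proof -
  assume p: "p = 1" and t: "t > 0"
  have "\<xi> t * memq t = integral {0..t} (\<lambda>s. \<xi> t * (g (t - s) * q t s))" by (simp add: memq_def)
  also have "\<dots> \<le> integral {0..t} (\<lambda>s. \<xi> (t - s) * g (t - s) powr p * q t s)"
  proof (rule integral_le)
    fix s assume "s \<in> {0..t}"
    then have "\<xi> t * (g (t - s) * q t s) \<le> \<xi> (t - s) * (g (t - s) * q t s)"
      using \<xi>_antimono[of "t - s" t] g_pos q_nonneg by (intro mult_right_mono) auto
    then show "\<xi> t * (g (t - s) * q t s) \<le> \<xi> (t - s) * g (t - s) powr p * q t s"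
      using g_pos p by simp
  qed (intro int_UNIV continuous_intros; use p_ge g_pos in auto)+
  also have "\<dots> \<le> 2 * dissip t" by (rule int_gp_le[OF t])
  finally show ?thesis using dissip_nonneg[OF t] by simp
qed

text \<open>With \<open>a = 3/2 - p\<close>, formally \<open>g powr a\<close> decreases at least at
  the rate \<open>a * \<xi> * g powr (a - 1 + p)\<close>, and \<open>a - 1 + p = 1/2\<close>, so the
  integral telescopes. The concave tangent bound carries this out on finite increments.\<close>

lemma int_sqrt_g: "t \<ge> 0 \<Longrightarrow> (3/2 - p) * integral {0..t} (\<lambda>s. \<xi> s * g s powr (1/2)) \<le> g 0 powr (3/2 - p)"
proof -
  assume t: "t \<ge> 0"
  define a where "a = 3/2 - p"
  have a: "0 < a" "a \<le> 1" using p_less p_ge by (auto simp: a_def)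
  let ?F = "\<lambda>s. \<xi> s * g s powr (1/2)"
  have cF: "continuous_on UNIV ?F" by (intro continuous_intros) (auto intro: g_pos)
  define f where "f x = a * integral {0..x} ?F + g x powr a" for x
  have "f t \<le> f 0"
  proof (rule dini_nonincreasing[OF t])
    have "continuous_on {0..} (\<lambda>x. integral {0..x} ?F)"
      by (rule continuous_on_integral_upto) (intro continuous_on_compose2[OF cF] continuous_intros, auto)
    then have "continuous_on {0..t} (\<lambda>x. integral {0..x} ?F)" by (rule continuous_on_subset) auto
    then show "continuous_on {0..t} f" unfolding f_def using a g_pos by (intro continuous_intros) auto
  next
    fix x e :: real assume x: "0 < x" "x < t" and e: "e > 0"
    have lim: "((\<lambda>h. integral {x..x+h} ?F / h) \<longlongrightarrow> ?F x) (at_right 0)"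
      by (rule short_integral_tendsto[where H = "\<lambda>h. ?F"])
         (intro continuous_on_compose2[OF cF] continuous_intros, auto)
    have split: "integral {0..x+h} ?F = integral {0..x} ?F + integral {x..x+h} ?F" if "h > 0" for h
      by (rule Henstock_Kurzweil_Integration.integral_combine[symmetric])
         (use that x in \<open>auto intro!: integrable_continuous_real continuous_on_subset[OF cF]\<close>)
    show "eventually (\<lambda>h. f (x + h) \<le> f x + e * h) (at_right 0)"
    proof (cases "g x = 0")
      case True
      \<comment> \<open>A zero of \<open>g\<close> persists, so \<open>f\<close> is constant from
        there on; the tangent bound would divide by \<open>g x\<close>.\<close>
      have 0: "g y = 0" if "y \<ge> x" for y using g_antimono[of x y] g_pos[of y] that x True by simp
      have I0: "integral {x..x+h} ?F = 0" for h
        by (subst Henstock_Kurzweil_Integration.integral_cong[where g = "\<lambda>_. 0"]) (use 0 in auto)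
      show ?thesis using eventually_at_right_less[of 0]
        by eventually_elim (use split I0 0 e in \<open>auto simp: f_def True\<close>)
    next
      case False
      then have y: "g x > 0" using g_pos[of x] by simp
      let ?Y = "\<lambda>h. \<xi> (x + h) * g (x + h) powr p"
      have "continuous_on UNIV (\<lambda>h. \<xi> h * g h powr p)"
        by (intro continuous_intros) (use p_ge g_pos in auto)
      then have "continuous_on UNIV ?Y"
        by (rule continuous_on_compose2[where f = "\<lambda>h. x + h"]) (auto intro: continuous_intros)
      then have limY: "(?Y \<longlongrightarrow> ?Y 0) (at_right 0)" by (rule continuous_tendsto_right)
      have "((\<lambda>h. a * (integral {x..x+h} ?F / h) - a * g x powr (a - 1) * ?Y h)
          \<longlongrightarrow> a * ?F x - a * g x powr (a - 1) * ?Y 0) (at_right 0)"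
        by (rule tendsto_diff[OF tendsto_mult[OF tendsto_const lim] tendsto_mult[OF tendsto_const limY]])
      moreover have "g x powr (a - 1) * g x powr p = g x powr (1/2)"
        by (simp flip: powr_add) (simp add: a_def)
      then have "a * ?F x - a * g x powr (a - 1) * ?Y 0 < e" using e by (simp add: algebra_simps)
      ultimately have "eventually (\<lambda>h. a * (integral {x..x+h} ?F / h) - a * g x powr (a - 1) * ?Y h < e) (at_right 0)"
        by (rule order_tendstoD)
      with eventually_at_right_less[of 0] show ?thesis
      proof eventually_elim
        case (elim h)
        have "g (x + h) powr a \<le> g x powr a * (1 + a * (g (x + h) / g x - 1))"
          by (rule powr_concave_tangent) (use y a g_pos in auto)
        also have "\<dots> = g x powr a + a * g x powr (a - 1) * (g (x + h) - g x)"
          using y by (simp add: powr_diff field_simps)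
        also have "\<dots> \<le> g x powr a + a * g x powr (a - 1) * (- (h * ?Y h))"
          using g_decr[of x h] x elim a by (intro add_left_mono mult_left_mono) auto
        finally have 1: "g (x + h) powr a \<le> g x powr a - h * (a * g x powr (a - 1) * ?Y h)"
          by (simp add: algebra_simps)
        have "a * integral {x..x+h} ?F - h * (a * g x powr (a - 1) * ?Y h) \<le> e * h"
          using elim by (simp add: field_simps)
        with 1 show ?case using split[of h] elim by (simp add: f_def algebra_simps)
      qed
    qed
  qed
  then have "a * integral {0..t} ?F + g t powr a \<le> g 0 powr a" by (simp add: f_def)
  moreover have "g t powr a \<ge> 0" by simp
  ultimately have "a * integral {0..t} ?F \<le> g 0 powr a" by linarith
  then show ?thesis by (simp add: a_def)
qed

lemma memq_poly:
  assumes p: "p > 1"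
  shows "\<exists>A\<ge>0. \<forall>t>0. \<xi> t * memq t \<le> A * dissip t powr (1 / (2 * p - 1))"
proof -
  define \<theta> where "\<theta> = 1 / (2 * p - 1)"
  have \<theta>: "0 < \<theta>" "\<theta> \<le> 1" using p by (auto simp: \<theta>_def)
  \<comment> \<open>The exponent count behind the interpolation of \<open>g\<close> between
    \<open>g powr p\<close>, which occurs in the dissipation, and \<open>g powr (1/2)\<close>, whose
    integral against \<open>\<xi>\<close> is finite.\<close>
  have pt: "p * \<theta> + 1/2 * (1 - \<theta>) = 1"
  proof -
    define k where "k = 2 * p - 1"
    have "k > 0" "p = (k + 1) / 2" "\<theta> = 1 / k" using p by (auto simp: k_def \<theta>_def)
    then show ?thesis by (simp add: field_simps)
  qed
  \<comment> \<open>Bounds the integral of \<open>\<xi> * g powr (1/2) * q\<close>: the first factor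
    comes from \<open>q_bound\<close> with the energy at its initial value, the second from
    \<open>int_sqrt_g\<close>.\<close>
  define C where "C = 8 / l * en 0 * (g 0 powr (3/2 - p) / (3/2 - p))"
  have C: "C \<ge> 0" using l_pos en_nonneg[of 0] p_less by (simp add: C_def)
  have "\<xi> t * memq t \<le> (2 + C) * dissip t powr \<theta>" if t: "t > 0" for t
  proof (rule le_const_powr_of_young[OF dissip_nonneg[OF t] C \<theta>(1)])
    fix c :: real assume c: "c > 0"
    let ?x = "\<lambda>s. \<xi> (t - s) * g (t - s) powr p * q t s"
    let ?y = "\<lambda>s. \<xi> (t - s) * g (t - s) powr (1/2) * q t s"
    let ?y' = "\<lambda>s. 8 / l * en 0 * (\<xi> (t - s) * g (t - s) powr (1/2))"
    have int: "?x integrable_on {0..t}" "?y' integrable_on {0..t}" 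
      by (intro int_UNIV continuous_intros; use p_ge g_pos in auto)+
    have "\<xi> t * memq t = integral {0..t} (\<lambda>s. \<xi> t * (g (t - s) * q t s))" by (simp add: memq_def)
    also have "\<dots> \<le> integral {0..t} (\<lambda>s. c powr (\<theta> - 1) * ?x s + c powr \<theta> * ?y' s)"
    proof (rule integral_le)
      fix s assume s: "s \<in> {0..t}"
      have "\<xi> t * (g (t - s) * q t s) \<le> \<xi> (t - s) * (g (t - s) * q t s)"
        using \<xi>_antimono[of "t - s" t] s g_pos q_nonneg by (intro mult_right_mono) auto
      also have "\<dots> = ?x s powr \<theta> * ?y s powr (1 - \<theta>)"
      proof -
        have e: "z powr \<theta> * z powr (1 - \<theta>) = z" if "z \<ge> 0" for z :: real using that by (simp flip: powr_add)
        have eg: "(g (t - s) powr p) powr \<theta> * (g (t - s) powr (1/2)) powr (1 - \<theta>) = g (t - s)"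
          using pt g_pos[of "t - s"] by (simp add: powr_powr flip: powr_add)
        have "?x s powr \<theta> * ?y s powr (1 - \<theta>) = (\<xi> (t - s) powr \<theta> * \<xi> (t - s) powr (1 - \<theta>))
           * ((g (t - s) powr p) powr \<theta> * (g (t - s) powr (1/2)) powr (1 - \<theta>)) * (q t s powr \<theta> * q t s powr (1 - \<theta>))"
          using \<xi>_pos[of "t - s"] g_pos[of "t - s"] q_nonneg[of t s] by (simp add: powr_mult)
        also have "\<dots> = \<xi> (t - s) * g (t - s) * q t s"
          unfolding eg using e[OF \<xi>_pos] e[OF q_nonneg] by simp
        finally show ?thesis by simp
      qed
      also have "\<dots> \<le> c powr (\<theta> - 1) * ?x s + c powr \<theta> * ?y s"
        using \<theta> c \<xi>_pos[of "t - s"] g_pos[of "t - s"] q_nonneg[of t s] by (intro weighted_young) auto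
      also have "\<dots> \<le> c powr (\<theta> - 1) * ?x s + c powr \<theta> * ?y' s"
      proof -
        have "q t s \<le> 8 / l * en 0"
          using q_bound[of s t] en_antimono[of 0 s] s l_pos
          by (smt (verit) atLeastAtMost_iff divide_nonneg_pos mult_left_mono)
        then have "?y s \<le> \<xi> (t - s) * g (t - s) powr (1/2) * (8 / l * en 0)"
          using \<xi>_pos[of "t - s"] by (intro mult_left_mono) auto
        then have "?y s \<le> ?y' s" by (simp add: mult.commute)
        then have "c powr \<theta> * ?y s \<le> c powr \<theta> * ?y' s" by (rule mult_left_mono) simp
        then show ?thesis by linarith
      qed
      finally show "\<xi> t * (g (t - s) * q t s) \<le> \<dots>" .
    next
      show "(\<lambda>s. \<xi> t * (g (t - s) * q t s)) integrable_on {0..t}" by (intro int_UNIV continuous_intros)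
      show "(\<lambda>s. c powr (\<theta> - 1) * ?x s + c powr \<theta> * ?y' s) integrable_on {0..t}"
        by (rule integral_linear_combination(2)[OF int])
    qed
    also have "\<dots> = c powr (\<theta> - 1) * integral {0..t} ?x + c powr \<theta> * integral {0..t} ?y'"
      by (rule integral_linear_combination(1)[OF int])
    also have "\<dots> \<le> c powr (\<theta> - 1) * (2 * dissip t) + c powr \<theta> * C"
    proof (intro add_mono mult_left_mono int_gp_le[OF t])
      have "integral {0..t} ?y' = 8 / l * en 0 * integral {0..t} (\<lambda>s. \<xi> s * g s powr (1/2))"
        using int_reflect[of t "\<lambda>s. \<xi> s * g s powr (1/2)"] by simp
      also have "\<dots> \<le> C" unfolding C_def
        using int_sqrt_g[of t] t p_less l_pos en_nonneg[of 0] by (intro mult_left_mono) (auto simp: field_simps)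
      finally show "integral {0..t} ?y' \<le> C" .
    qed auto
    finally show "\<xi> t * memq t \<le> c powr (\<theta> - 1) * (2 * dissip t) + c powr \<theta> * C" .
  qed
  then show ?thesis using C by (intro exI[of _ "2 + C"]) (auto simp: \<theta>_def)
qed

text \<open>Interpolation between \<open>g powr p\<close> and the constant weight. The second factor
  is integrable because \<open>q t s\<close> is dominated by the energy at time \<open>s\<close>,
  whose integral is at most \<open>D\<close>.\<close>

lemma memq_poly_opt:
  assumes p: "p > 1" and D: "\<And>t. t \<ge> 0 \<Longrightarrow> integral {0..t} en \<le> D"
  shows "\<exists>A\<ge>0. \<forall>t>0. \<xi> t * memq t \<le> A * dissip t powr (1 / p)"
proof -
  define \<theta> where "\<theta> = 1 / p"
  have \<theta>: "0 < \<theta>" "\<theta> \<le> 1" using p by (auto simp: \<theta>_def)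
  have pt: "p * \<theta> = 1" using p by (simp add: \<theta>_def)
  define C where "C = \<xi> 0 * (8 / l * D)"
  have "D \<ge> 0" using D[of 0] by simp
  then have C: "C \<ge> 0" using l_pos \<xi>_pos by (simp add: C_def)
  have "\<xi> t * memq t \<le> (2 + C) * dissip t powr \<theta>" if t: "t > 0" for t
  proof (rule le_const_powr_of_young[OF dissip_nonneg[OF t] C \<theta>(1)])
    fix c :: real assume c: "c > 0"
    let ?x = "\<lambda>s. \<xi> (t - s) * g (t - s) powr p * q t s"
    \<comment> \<open>Both factors first carry the same \<open>\<xi> t\<close>, so that its powers
      recombine; afterwards it is enlarged to \<open>\<xi> (t - s)\<close> in one factor and to
      \<open>\<xi> 0\<close> in the other.\<close>
    let ?x' = "\<lambda>s. \<xi> t * g (t - s) powr p * q t s"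
    let ?y = "\<lambda>s. \<xi> t * q t s"
    let ?y' = "\<lambda>s. \<xi> 0 * (8 / l * en s)"
    have cen: "continuous_on {0..t} en" by (rule continuous_on_subset[OF en_cont]) auto
    have int: "?x integrable_on {0..t}" "?y' integrable_on {0..t}" 
      by (intro int_UNIV continuous_intros; use p_ge g_pos in auto)
         (intro integrable_continuous_real continuous_intros cen)
    have "\<xi> t * memq t = integral {0..t} (\<lambda>s. \<xi> t * (g (t - s) * q t s))" by (simp add: memq_def)
    also have "\<dots> \<le> integral {0..t} (\<lambda>s. c powr (\<theta> - 1) * ?x s + c powr \<theta> * ?y' s)"
    proof (rule integral_le)
      fix s assume s: "s \<in> {0..t}"
      have "\<xi> t * (g (t - s) * q t s) = ?x' s powr \<theta> * ?y s powr (1 - \<theta>)"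
      proof -
        have e: "z powr \<theta> * z powr (1 - \<theta>) = z" if "z \<ge> 0" for z :: real using that by (simp flip: powr_add)
        have eg: "(g (t - s) powr p) powr \<theta> = g (t - s)"
          using pt g_pos[of "t - s"] by (simp add: powr_powr)
        have "?x' s powr \<theta> * ?y s powr (1 - \<theta>) = (\<xi> t powr \<theta> * \<xi> t powr (1 - \<theta>))
           * (g (t - s) powr p) powr \<theta> * (q t s powr \<theta> * q t s powr (1 - \<theta>))"
          using \<xi>_pos[of t] g_pos[of "t - s"] q_nonneg[of t s] by (simp add: powr_mult)
        also have "\<dots> = \<xi> t * g (t - s) * q t s"
          unfolding eg using e[OF \<xi>_pos] e[OF q_nonneg] by simp
        finally show ?thesis by simp
      qed
      also have "\<dots> \<le> c powr (\<theta> - 1) * ?x' s + c powr \<theta> * ?y s"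
        using \<theta> c \<xi>_pos[of t] g_pos[of "t - s"] q_nonneg[of t s] by (intro weighted_young) auto
      also have "\<dots> \<le> c powr (\<theta> - 1) * ?x s + c powr \<theta> * ?y' s"
        using \<xi>_antimono[of "t - s" t] \<xi>_antimono[of 0 t] s t q_bound[of s t] q_nonneg[of t s] \<xi>_pos[of 0] \<xi>_pos[of t]
        by (intro add_mono mult_left_mono mult_right_mono mult_mono) auto
      finally show "\<xi> t * (g (t - s) * q t s) \<le> \<dots>" .
    next
      show "(\<lambda>s. \<xi> t * (g (t - s) * q t s)) integrable_on {0..t}" by (intro int_UNIV continuous_intros)
      show "(\<lambda>s. c powr (\<theta> - 1) * ?x s + c powr \<theta> * ?y' s) integrable_on {0..t}"
        by (rule integral_linear_combination(2)[OF int])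
    qed
    also have "\<dots> = c powr (\<theta> - 1) * integral {0..t} ?x + c powr \<theta> * integral {0..t} ?y'"
      by (rule integral_linear_combination(1)[OF int])
    also have "\<dots> \<le> c powr (\<theta> - 1) * (2 * dissip t) + c powr \<theta> * C"
    proof (intro add_mono mult_left_mono int_gp_le[OF t])
      have "integral {0..t} ?y' = \<xi> 0 * (8 / l * integral {0..t} en)" by simp
      also have "\<dots> \<le> C" unfolding C_def
        using D[of t] t l_pos \<xi>_pos by (intro mult_left_mono) auto
      finally show "integral {0..t} ?y' \<le> C" .
    qed auto
    finally show "\<xi> t * memq t \<le> c powr (\<theta> - 1) * (2 * dissip t) + c powr \<theta> * C" .
  qed
  then show ?thesis using C by (intro exI[of _ "2 + C"]) (auto simp: \<theta>_def)
qed

lemma dini_rate: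
  assumes c: "\<And>t. t > 0 \<Longrightarrow> c * (\<xi> t * en t) powr r \<le> dissip t" and t: "t > 0" and e: "e > 0"
  shows "eventually (\<lambda>h. en (t + h) \<le> en t - h * (c * (\<xi> t * en t) powr r) + e * h) (at_right 0)"
  using en_dini[OF t e lim1[OF t] lim2[OF t]] eventually_at_right_less[of 0]
proof eventually_elim
  case (elim h)
  then have "h * (c * (\<xi> t * en t) powr r) \<le> h * dissip t" using c[OF t] by (intro mult_left_mono) auto
  then show ?case using elim by linarith
qed

lemma poly_decay:
  assumes r: "r > 1" and "\<exists>A\<ge>0. \<forall>t>0. \<xi> t * memq t \<le> A * dissip t powr (1 / r)"
  shows "\<exists>L>0. \<forall>t\<ge>0. en t \<le> L * (1 + integral {0..t} (\<lambda>s. \<xi> s powr r)) powr (-1 / (r - 1))"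
proof -
  obtain c where "c > 0" "\<And>t. t > 0 \<Longrightarrow> c * (\<xi> t * en t) powr r \<le> dissip t"
  proof -
    obtain A where "A \<ge> 0" "\<forall>t>0. \<xi> t * memq t \<le> A * dissip t powr (1 / r)" using assms by blast
    with dissip_ge[of r A] r have "\<exists>c>0. \<forall>t>0. c * (\<xi> t * en t) powr r \<le> dissip t" by auto
    then show thesis using that by blast
  qed
  then show ?thesis
    by (intro decay_power[OF en_cont en_nonneg en_antimono \<xi>_cont \<xi>_pos _ r dini_rate[of c r]]) auto
qed

theorem en_decay:
  "p = 1 \<Longrightarrow> \<exists>L>0. \<exists>c>0. \<forall>t\<ge>0. en t \<le> L * exp (- c * integral {0..t} \<xi>)"
  "p > 1 \<Longrightarrow> \<exists>L>0. \<forall>t\<ge>0. en t \<le> L * (1 + integral {0..t} (\<lambda>s. \<xi> s powr (2 * p - 1))) powr (-1 / (2 * p - 2))"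
  "p > 1 \<Longrightarrow> (\<And>t. t \<ge> 0 \<Longrightarrow> integral {0..t} en \<le> D) \<Longrightarrow>
     \<exists>L>0. \<forall>t\<ge>0. en t \<le> L * (1 + integral {0..t} (\<lambda>s. \<xi> s powr p)) powr (-1 / (p - 1))"
proof -
  assume p: "p = 1"
  obtain c where c: "c > 0" "\<And>t. t > 0 \<Longrightarrow> c * (\<xi> t * en t) powr 1 \<le> dissip t"
    using dissip_ge[of 1 2] memq_exp[OF p] by auto
  have "en t \<le> en 0 * exp (- c * integral {0..t} \<xi>)" if "t \<ge> 0" for t
  proof (rule decay_exp[OF en_cont en_nonneg en_antimono \<xi>_cont c(1) _ that])
    fix t e :: real assume t: "t > 0" and e: "e > 0"
    show "eventually (\<lambda>h. en (t + h) \<le> en t - h * (c * (\<xi> t * en t)) + e * h) (at_right 0)"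
      using dini_rate[of c 1, OF c(2) t e] \<xi>_pos[of t] en_nonneg[of t] t by simp
  qed auto
  then have "en t \<le> (en 0 + 1) * exp (- c * integral {0..t} \<xi>)" if "t \<ge> 0" for t
    using that by (simp add: distrib_right) (smt (verit) exp_ge_zero)
  then show "\<exists>L>0. \<exists>c>0. \<forall>t\<ge>0. en t \<le> L * exp (- c * integral {0..t} \<xi>)"
    using c en_nonneg[of 0] by (intro exI[of _ "en 0 + 1"] conjI exI[of _ c]) auto
next
  assume "p > 1"
  then show "\<exists>L>0. \<forall>t\<ge>0. en t \<le> L * (1 + integral {0..t} (\<lambda>s. \<xi> s powr (2 * p - 1))) powr (-1 / (2 * p - 2))"
    using poly_decay[of "2 * p - 1", OF _ memq_poly] by simp
next
  assume p: "p > 1" and D: "\<And>t. t \<ge> 0 \<Longrightarrow> integral {0..t} en \<le> D"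
  show "\<exists>L>0. \<forall>t\<ge>0. en t \<le> L * (1 + integral {0..t} (\<lambda>s. \<xi> s powr p)) powr (-1 / (p - 1))"
    using poly_decay[OF p memq_poly_opt[OF p D]] by simp
qed

end

section \<open>The Gagliardo--Nirenberg--Sobolev inequality on a cube\<close>

text \<open>The segment integral remains a function on the whole space, constant in direction
  \<open>b\<close>. Iterating over directions therefore stays in one type instead of passing to
  lower-dimensional slices.\<close>

definition marg :: "real \<Rightarrow> 'a::euclidean_space \<Rightarrow> ('a \<Rightarrow> real) \<Rightarrow> 'a \<Rightarrow> real" where
  "marg R b f x = integral {-R..R} (\<lambda>s. f (x + (s - x \<bullet> b) *\<^sub>R b))"

primrec margs :: "real \<Rightarrow> 'a::euclidean_space list \<Rightarrow> ('a \<Rightarrow> real) \<Rightarrow> 'a \<Rightarrow> real" where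
  "margs R [] f = f"
| "margs R (b # bs) f = margs R bs (marg R b f)"

lemma cont_line:
  assumes "continuous_on UNIV (f :: 'a::euclidean_space \<Rightarrow> real)"
  shows "continuous_on S (\<lambda>s. f (x + (s - x \<bullet> b) *\<^sub>R b))"
  by (rule continuous_on_compose2[OF assms]) (auto intro!: continuous_intros)

lemma line_integrable:
  assumes "continuous_on UNIV (f :: 'a::euclidean_space \<Rightarrow> real)"
  shows "(\<lambda>s. f (x + (s - x \<bullet> b) *\<^sub>R b)) integrable_on {c..d}"
  by (rule integrable_continuous_real) (rule cont_line[OF assms])

lemma marg_cont:
  assumes "continuous_on UNIV f"
  shows "continuous_on UNIV (marg R b f)"
proof -
  have "continuous_on UNIV (\<lambda>x. integral (cbox (-R) R) (\<lambda>s. f (x + (s - x \<bullet> b) *\<^sub>R b)))"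
    by (rule integral_continuous_on_param)
       (unfold split_def, rule continuous_on_compose2[OF assms], auto intro!: continuous_intros)
  then show ?thesis by (simp add: marg_def[abs_def])
qed

lemma marg_mono:
  assumes "continuous_on UNIV f" "continuous_on UNIV f'" "\<And>y. f y \<le> f' y"
  shows "marg R b f x \<le> marg R b f' x"
  unfolding marg_def by (rule integral_le) (use assms in \<open>auto intro: line_integrable\<close>)

lemma marg_pos:
  assumes "continuous_on UNIV f" "\<And>y. f y > 0" "R > 0"
  shows "marg R b f x > 0"
proof -
  have "continuous_on {-R..R} (\<lambda>s. f (x + (s - x \<bullet> b) *\<^sub>R b))" by (rule cont_line[OF assms(1)])
  then obtain s0 where s0: "\<And>s. s \<in> {-R..R} \<Longrightarrow> f (x + (s0 - x \<bullet> b) *\<^sub>R b) \<le> f (x + (s - x \<bullet> b) *\<^sub>R b)"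
    using continuous_attains_inf[of "{-R..R}"] assms(3) by fastforce
  have "0 < f (x + (s0 - x \<bullet> b) *\<^sub>R b) * (2 * R)" using assms by simp
  also have "\<dots> = integral {-R..R} (\<lambda>s. f (x + (s0 - x \<bullet> b) *\<^sub>R b))" using assms by simp
  also have "\<dots> \<le> marg R b f x" unfolding marg_def
    by (rule integral_le) (use s0 in \<open>auto intro: line_integrable[OF assms(1)]\<close>)
  finally show ?thesis .
qed

lemma marg_indep:
  assumes "b \<in> Basis"
  shows "marg R b f (x + s *\<^sub>R b) = marg R b f x"
proof -
  have "x + s *\<^sub>R b + (r - (x + s *\<^sub>R b) \<bullet> b) *\<^sub>R b = x + (r - x \<bullet> b) *\<^sub>R b" for r
    using assms by (simp add: algebra_simps inner_same_Basis)
  then show ?thesis by (simp only: marg_def)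
qed

lemma marg_swap:
  assumes f: "continuous_on UNIV f" and b: "b \<in> Basis" "b' \<in> Basis" "b \<noteq> b'"
  shows "marg R b (marg R b' f) x = marg R b' (marg R b f) x"
proof -
  have ort: "b \<bullet> b' = 0" "b' \<bullet> b = 0" using b by (auto simp: inner_not_same_Basis)
  have 1: "marg R b (marg R b' f) x = integral (cbox (-R) R) (\<lambda>s. integral (cbox (-R) R) (\<lambda>r. f (x + (s - x \<bullet> b) *\<^sub>R b + (r - x \<bullet> b') *\<^sub>R b')))"
    by (simp add: marg_def inner_add_left ort)
  have 2: "marg R b' (marg R b f) x = integral (cbox (-R) R) (\<lambda>r. integral (cbox (-R) R) (\<lambda>s. f (x + (s - x \<bullet> b) *\<^sub>R b + (r - x \<bullet> b') *\<^sub>R b')))"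
    by (simp add: marg_def inner_add_left ort algebra_simps)
  show ?thesis unfolding 1 2
    by (rule integral_swap_continuous) (unfold split_def, rule continuous_on_compose2[OF f], auto intro!: continuous_intros)
qed

lemma margs_mono:
  "continuous_on UNIV f \<Longrightarrow> continuous_on UNIV f' \<Longrightarrow> (\<And>y. f y \<le> f' y) \<Longrightarrow> margs R bs f x \<le> margs R bs f' x"
proof (induction bs arbitrary: f f')
  case (Cons b bs)
  then show ?case by (simp add: Cons.IH[OF marg_cont marg_cont] marg_mono)
qed auto

text \<open>Weighted arithmetic-geometric mean inequality: \<open>ln\<close> lies below its tangent
  at the weighted mean \<open>s\<close>, and the tangent contributions sum to zero.\<close>

lemma prod_powr_le_weighted_sum:
  fixes w y :: "'i \<Rightarrow> real"
  assumes "finite I" "\<And>i. i \<in> I \<Longrightarrow> w i \<ge> 0" "sum w I = 1" "\<And>i. i \<in> I \<Longrightarrow> y i > 0"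
  shows "(\<Prod>i\<in>I. y i powr w i) \<le> (\<Sum>i\<in>I. w i * y i)"
proof -
  define s where "s = (\<Sum>i\<in>I. w i * y i)"
  obtain i where i: "i \<in> I" "w i > 0"
  proof (rule ccontr)
    assume "\<not> thesis"
    then have "\<And>i. i \<in> I \<Longrightarrow> w i = 0" using that assms(2) by force
    then have "sum w I = 0" by (rule sum.neutral[OF ballI])
    then show False using assms(3) by simp
  qed
  then have s: "s > 0" unfolding s_def
    using assms i by (intro sum_pos2[of I i]) (auto intro!: mult_nonneg_nonneg mult_pos_pos less_imp_le[of 0 "y _"])
  have "(\<Sum>i\<in>I. w i * (ln (y i) - ln s)) \<le> (\<Sum>i\<in>I. w i * (y i / s - 1))"
  proof (intro sum_mono mult_left_mono)
    fix i assume "i \<in> I"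
    then show "ln (y i) - ln s \<le> y i / s - 1"
      using ln_le_minus_one[of "y i / s"] assms(4)[of i] s by (simp add: ln_div)
  qed (use assms in auto)
  also have "\<dots> = s / s - 1"
    using assms(3) by (simp add: right_diff_distrib sum_subtractf s_def flip: sum_divide_distrib)
  also have "\<dots> = 0" using s by simp
  finally have "(\<Sum>i\<in>I. w i * ln (y i)) \<le> ln s"
    using assms(3) by (simp add: right_diff_distrib sum_subtractf flip: sum_distrib_right)
  then have "exp (\<Sum>i\<in>I. w i * ln (y i)) \<le> s" using s by (metis exp_le_cancel_iff exp_ln)
  moreover have "exp (\<Sum>i\<in>I. w i * ln (y i)) = (\<Prod>i\<in>I. y i powr w i)"
    unfolding exp_sum[OF assms(1)] by (rule prod.cong[OF refl]) (use assms(4) in \<open>force simp: powr_def\<close>)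
  ultimately show ?thesis by (simp add: s_def)
qed

text \<open>Dividing each \<open>F i\<close> by its integral reduces the claim to the weighted
  arithmetic-geometric mean under the integral, whose right side then integrates to the sum of the
  weights. Strict positivity keeps the real powers continuous.\<close>

lemma holder_prod:
  fixes F :: "'i \<Rightarrow> real \<Rightarrow> real"
  assumes I: "finite I" and w: "\<And>i. i \<in> I \<Longrightarrow> w i \<ge> 0" "sum w I = 1"
    and F: "\<And>i. i \<in> I \<Longrightarrow> continuous_on {a..b} (F i)" "\<And>i s. i \<in> I \<Longrightarrow> s \<in> {a..b} \<Longrightarrow> F i s > 0"
    and pos: "\<And>i. i \<in> I \<Longrightarrow> integral {a..b} (F i) > 0"
  shows "integral {a..b} (\<lambda>s. \<Prod>i\<in>I. F i s powr w i) \<le> (\<Prod>i\<in>I. integral {a..b} (F i) powr w i)"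
proof -
  let ?c = "\<lambda>i. integral {a..b} (F i)"
  let ?C = "\<Prod>i\<in>I. ?c i powr w i"
  have "integral {a..b} (\<lambda>s. \<Prod>i\<in>I. F i s powr w i) \<le> integral {a..b} (\<lambda>s. ?C * (\<Sum>i\<in>I. w i * (F i s / ?c i)))"
  proof (rule integral_le)
    show "(\<lambda>s. \<Prod>i\<in>I. F i s powr w i) integrable_on {a..b}"
      by (intro integrable_continuous_real continuous_on_prod continuous_on_powr continuous_intros F) (use F(2) in force)+
    show "(\<lambda>s. ?C * (\<Sum>i\<in>I. w i * (F i s / ?c i))) integrable_on {a..b}"
      by (intro integrable_continuous_real continuous_intros F) (use pos in force)+
    fix s assume s: "s \<in> {a..b}"
    have "(\<Prod>i\<in>I. F i s powr w i) = ?C * (\<Prod>i\<in>I. (F i s / ?c i) powr w i)"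
      unfolding prod.distrib[symmetric]
    proof (intro prod.cong refl)
      fix i assume i: "i \<in> I"
      have "?c i > 0" "F i s > 0" using pos F(2) i s by auto
      then show "F i s powr w i = ?c i powr w i * (F i s / ?c i) powr w i" by (simp add: powr_divide)
    qed
    also have "\<dots> \<le> ?C * (\<Sum>i\<in>I. w i * (F i s / ?c i))"
      using pos F(2) s by (intro mult_left_mono prod_powr_le_weighted_sum I w prod_nonneg) auto
    finally show "(\<Prod>i\<in>I. F i s powr w i) \<le> \<dots>" .
  qed
  also have "\<dots> = ?C * (\<Sum>i\<in>I. w i * (?c i / ?c i))"
  proof -
    have "integral {a..b} (\<lambda>s. \<Sum>i\<in>I. w i * (F i s / ?c i)) = (\<Sum>i\<in>I. integral {a..b} (\<lambda>s. w i * (F i s / ?c i)))"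
      by (rule Henstock_Kurzweil_Integration.integral_sum[OF I], rule integrable_continuous_real)
         (intro continuous_intros F, auto dest: pos)
    then show ?thesis
      by (simp only: Henstock_Kurzweil_Integration.integral_mult_right Henstock_Kurzweil_Integration.integral_divide)
  qed
  also have "(\<Sum>i\<in>I. w i * (?c i / ?c i)) = (\<Sum>i\<in>I. w i)"
    using pos by (intro sum.cong) force+
  finally show ?thesis using w by simp
qed

lemma grid_cont:
  assumes f: "continuous_on UNIV f" "\<And>x. f x > 0" and R: "R > 0"
  shows "continuous_on UNIV (\<lambda>x. f x powr a * (\<Prod>b\<in>B. marg R b f x powr \<theta>))"
proof -
  have "f x \<noteq> 0" "marg R b f x \<noteq> 0" for x b
    using f(2)[of x] marg_pos[OF f R, of b x] by simp_all
  then show ?thesis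
    by (intro continuous_on_mult continuous_on_prod continuous_on_powr continuous_on_const f marg_cont) simp_all
qed

text \<open>In the induction step the factor \<open>marg R b f\<close> does not depend on the coordinate \<open>b\<close>, and
  Hoelder's inequality on the lines in direction \<open>b\<close>, with exponents \<open>1 - n\<theta>, \<theta>, \<dots>, \<theta>\<close>, turns the
  integrand belonging to \<open>f\<close> into the one belonging to \<open>marg R b f\<close>.\<close>

lemma grid_lines:
  assumes "distinct bs" "set bs \<subseteq> Basis" "\<theta> \<ge> 0" "(real (length bs) - 1) * \<theta> \<le> 1"
    and "continuous_on UNIV f" "\<And>x. f x > 0" "R > 0"
  shows "margs R bs (\<lambda>x. f x powr (1 - (real (length bs) - 1) * \<theta>) * (\<Prod>b\<in>set bs. marg R b f x powr \<theta>)) x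
     \<le> margs R bs f x powr (1 + \<theta>)"
  using assms
proof (induction bs arbitrary: f)
  \<comment> \<open>With no directions the exponent of \<open>f\<close> is
    \<open>1 + \<theta>\<close>, and both sides agree.\<close>
  case Nil
  then show ?case by simp
next
  case (Cons b bs)
  let ?n = "real (length bs)"
  let ?F = "marg R b f"
  note f = Cons.prems(5,6)
  have b: "b \<in> Basis" "b \<notin> set bs" "set bs \<subseteq> Basis" "distinct bs" using Cons.prems by auto
  have F: "continuous_on UNIV ?F" "\<And>x. ?F x > 0"
    using marg_cont marg_pos f Cons.prems(7) by blast+
  let ?G = "\<lambda>f x. f x powr (1 - (real (length (b # bs)) - 1) * \<theta>) * (\<Prod>b\<in>set (b # bs). marg R b f x powr \<theta>)"
  let ?H = "\<lambda>f x. f x powr (1 - (?n - 1) * \<theta>) * (\<Prod>b\<in>set bs. marg R b f x powr \<theta>)"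
  have n: "?n * \<theta> \<le> 1" "(?n - 1) * \<theta> \<le> 1" using Cons.prems(3,4) by (auto simp: algebra_simps)
  have cG: "continuous_on UNIV (?G f)"
    by (rule grid_cont[OF f Cons.prems(7)])
  have cH: "continuous_on UNIV (?H ?F)"
    by (rule grid_cont[OF F Cons.prems(7)])
  have step: "marg R b (?G f) x \<le> ?H ?F x" for x
  proof -
    let ?l = "\<lambda>s. x + (s - x \<bullet> b) *\<^sub>R b"
    let ?I = "insert b (set bs)"
    \<comment> \<open>The remaining directions take weight \<open>\<theta>\<close> each, which
      leaves \<open>1 - ?n * \<theta>\<close> for \<open>f\<close> itself; the length hypothesis
      makes this nonnegative.\<close>
    let ?w = "\<lambda>c. if c = b then 1 - ?n * \<theta> else \<theta>"
    let ?Fi = "\<lambda>c s. if c = b then f (?l s) else marg R c f (?l s)"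
    have Fl: "?F (?l s) = ?F x" for s by (rule marg_indep[OF b(1)])
    have "?G f (?l s) = ?F x powr \<theta> * (\<Prod>c\<in>?I. ?Fi c s powr ?w c)" for s
    proof -
      have "(\<Prod>c\<in>?I. ?Fi c s powr ?w c) = f (?l s) powr (1 - ?n * \<theta>) * (\<Prod>c\<in>set bs. marg R c f (?l s) powr \<theta>)"
        using b by (simp, intro disjI2 prod.cong) auto
      moreover have "?G f (?l s) = f (?l s) powr (1 - ?n * \<theta>) * (?F (?l s) powr \<theta> * (\<Prod>c\<in>set bs. marg R c f (?l s) powr \<theta>))"
        using b by simp
      ultimately show ?thesis unfolding Fl by simp
    qed
    then have "marg R b (?G f) x = integral {-R..R} (\<lambda>s. ?F x powr \<theta> * (\<Prod>c\<in>?I. ?Fi c s powr ?w c))"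
      unfolding marg_def[of R b "?G f"] by (simp only:)
    also have "\<dots> = ?F x powr \<theta> * integral {-R..R} (\<lambda>s. \<Prod>c\<in>?I. ?Fi c s powr ?w c)" by simp
    also have "\<dots> \<le> ?F x powr \<theta> * (\<Prod>c\<in>?I. integral {-R..R} (?Fi c) powr ?w c)"
    proof (intro mult_left_mono holder_prod)
      show "sum ?w ?I = 1" using b
      proof -
        have "sum ?w (set bs) = (\<Sum>c\<in>set bs. \<theta>)" using b by (intro sum.cong) auto
        then show ?thesis using b by (simp add: distinct_card)
      qed
    next
      fix c assume "c \<in> ?I"
      show "continuous_on {-R..R} (?Fi c)"
        by (cases "c = b") (use f in \<open>auto intro!: cont_line marg_cont\<close>)
      show "integral {-R..R} (?Fi c) > 0"
      proof -
        have "integral {-R..R} (?Fi c) = (if c = b then ?F x else marg R b (marg R c f) x)"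
          by (simp add: marg_def[of R b])
        then show ?thesis
          using F(2) marg_pos[OF marg_cont[OF f(1)] marg_pos[OF f Cons.prems(7)] Cons.prems(7)] by simp
      qed
      fix s show "?Fi c s > 0" using f marg_pos[OF f Cons.prems(7)] by simp
    qed (use n Cons.prems(3) in auto)
    also have "(\<Prod>c\<in>?I. integral {-R..R} (?Fi c) powr ?w c)
        = ?F x powr (1 - ?n * \<theta>) * (\<Prod>c\<in>set bs. marg R c ?F x powr \<theta>)"
    proof -
      have "integral {-R..R} (?Fi c) powr ?w c = marg R c ?F x powr \<theta>" if "c \<in> set bs" for c
      proof -
        have "c \<noteq> b" "c \<in> Basis" using that b by auto
        then have "integral {-R..R} (?Fi c) = marg R b (marg R c f) x" by (simp add: marg_def[of R b])
        also have "\<dots> = marg R c ?F x" using f(1) b(1) \<open>c \<in> Basis\<close> \<open>c \<noteq> b\<close> by (intro marg_swap) auto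
        finally show ?thesis using \<open>c \<noteq> b\<close> by simp
      qed
      moreover have "integral {-R..R} (?Fi b) powr ?w b = ?F x powr (1 - ?n * \<theta>)"
        by (simp add: marg_def)
      ultimately show ?thesis using b by (simp del: if_image_distrib)
    qed
    also have "?F x powr \<theta> * (?F x powr (1 - ?n * \<theta>) * (\<Prod>c\<in>set bs. marg R c ?F x powr \<theta>)) = ?H ?F x"
    proof -
      have "?F x powr \<theta> * ?F x powr (1 - ?n * \<theta>) = ?F x powr (1 - (?n - 1) * \<theta>)"
        by (simp flip: powr_add) (simp add: algebra_simps)
      then show ?thesis by (simp flip: mult.assoc)
    qed
    finally show ?thesis .
  qed
  have "margs R (b # bs) (?G f) x = margs R bs (marg R b (?G f)) x" by (simp only: margs.simps)
  also have "\<dots> \<le> margs R bs (?H ?F) x" by (rule margs_mono[OF marg_cont[OF cG] cH step])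
  also have "\<dots> \<le> margs R bs ?F x powr (1 + \<theta>)"
    by (rule Cons.IH[OF b(4) b(3) Cons.prems(3) n(2) F Cons.prems(7)])
  finally show ?case by (simp only: margs.simps)
qed

lemma marg_nonneg: "continuous_on UNIV f \<Longrightarrow> (\<And>y. f y \<ge> 0) \<Longrightarrow> marg R b f x \<ge> 0"
  unfolding marg_def by (rule integral_nonneg) (auto intro: line_integrable)

lemma ennreal_marg:
  assumes "continuous_on UNIV f" "\<And>y. f y \<ge> 0"
  shows "ennreal (marg R b f x)
    = (\<integral>\<^sup>+ s. ennreal (f (x + (s - x \<bullet> b) *\<^sub>R b)) * indicator {-R..R} s \<partial>lborel)"
  unfolding marg_def
  by (rule nn_integral_has_integral_lebesgue'[symmetric])
     (use assms in \<open>auto intro: integrable_integral line_integrable\<close>)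

text \<open>Fubini on a product of lines, one per direction in \<open>bs\<close>. The base point
  \<open>x\<close> supplies only the coordinates that are not integrated.\<close>

lemma ennreal_margs:
  assumes "distinct bs" "set bs \<subseteq> Basis" "continuous_on UNIV f" "\<And>y. f y \<ge> 0"
  shows "ennreal (margs R bs f x) = (\<integral>\<^sup>+ z. ennreal (f (x + (\<Sum>b\<in>set bs. (z b - x \<bullet> b) *\<^sub>R b)))
       * (\<Prod>b\<in>set bs. indicator {-R..R} (z b)) \<partial>(\<Pi>\<^sub>M b\<in>set bs. lborel))"
proof -
  interpret product_sigma_finite "\<lambda>_::'a. lborel :: real measure" by standard
  show ?thesis using assms
  proof (induction bs arbitrary: f)
    case Nil
    then show ?case by (simp add: PiM_empty)
  next
    case (Cons b bs)
    have b: "b \<in> Basis" "b \<notin> set bs" "set bs \<subseteq> Basis" "distinct bs" using Cons.prems by auto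
    note f = Cons.prems(3,4)
    have [measurable]: "f \<in> borel_measurable borel" using f(1) by (rule borel_measurable_continuous_onI)
    let ?S = "\<lambda>z. x + (\<Sum>b\<in>set bs. (z b - x \<bullet> b) *\<^sub>R b)"
    let ?P = "\<lambda>z. \<Prod>b\<in>set bs. indicator {-R..R} (z b) :: ennreal"
    have "ennreal (margs R (b # bs) f x) = (\<integral>\<^sup>+ z. ennreal (marg R b f (?S z)) * ?P z \<partial>(\<Pi>\<^sub>M b\<in>set bs. lborel))"
      using Cons.IH[of "marg R b f"] b f by (simp add: marg_cont marg_nonneg)
    also have "\<dots> = (\<integral>\<^sup>+ z. (\<integral>\<^sup>+ s. ennreal (f (x + (\<Sum>c\<in>insert b (set bs). ((z(b := s)) c - x \<bullet> c) *\<^sub>R c)))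
       * (\<Prod>c\<in>insert b (set bs). indicator {-R..R} ((z(b := s)) c)) \<partial>lborel) \<partial>(\<Pi>\<^sub>M b\<in>set bs. lborel))"
    proof (rule nn_integral_cong)
      fix z :: "'a \<Rightarrow> real"
      have orth: "(\<Sum>c\<in>set bs. (z c - x \<bullet> c) *\<^sub>R c) \<bullet> b = 0"
      proof -
        have "c \<bullet> b = 0" if "c \<in> set bs" for c
          using that b inner_not_same_Basis by (metis subsetD)
        then show ?thesis by (simp add: inner_sum_left)
      qed
      have 1: "?S z + (s - ?S z \<bullet> b) *\<^sub>R b = x + (\<Sum>c\<in>insert b (set bs). ((z(b := s)) c - x \<bullet> c) *\<^sub>R c)" for s
      proof -
        have "(\<Sum>c\<in>set bs. ((z(b := s)) c - x \<bullet> c) *\<^sub>R c) = (\<Sum>c\<in>set bs. (z c - x \<bullet> c) *\<^sub>R c)"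
          using b by (intro sum.cong) auto
        then show ?thesis using b orth by (simp add: inner_add_left)
      qed
      have 2: "(\<Prod>c\<in>insert b (set bs). indicator {-R..R} ((z(b := s)) c)) = indicator {-R..R} s * ?P z" for s
      proof -
        have "(\<Prod>c\<in>set bs. indicator {-R..R} ((z(b := s)) c)) = ?P z"
          using b by (intro prod.cong) auto
        then show ?thesis using b by simp
      qed
      show "ennreal (marg R b f (?S z)) * ?P z = (\<integral>\<^sup>+ s. ennreal (f (x + (\<Sum>c\<in>insert b (set bs). ((z(b := s)) c - x \<bullet> c) *\<^sub>R c)))
         * (\<Prod>c\<in>insert b (set bs). indicator {-R..R} ((z(b := s)) c)) \<partial>lborel)"
        unfolding ennreal_marg[OF f]
        by (subst nn_integral_multc[symmetric]) (simp, simp only: 1 2 mult.assoc)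
    qed
    also have "\<dots> = (\<integral>\<^sup>+ z. ennreal (f (x + (\<Sum>c\<in>insert b (set bs). (z c - x \<bullet> c) *\<^sub>R c)))
       * (\<Prod>c\<in>insert b (set bs). indicator {-R..R} (z c)) \<partial>(\<Pi>\<^sub>M b\<in>insert b (set bs). lborel))"
      using b by (intro product_nn_integral_insert[symmetric]) (auto intro!: borel_measurable_prod measurable_compose[of _ _ borel f] borel_measurable_indicator)
    finally show ?case by simp
  qed
qed

text \<open>Once every coordinate is integrated the base point disappears. Nonnegativity allows the
  passage through the nonnegative integral, where the order of integration is free.\<close>

lemma margs_Basis:
  assumes bs: "distinct bs" "set bs = Basis" and f: "continuous_on UNIV f" "\<And>y. f y \<ge> 0"
  shows "margs R bs f x = integral (cbox (- R *\<^sub>R One) (R *\<^sub>R One)) f"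
proof -
  have [measurable]: "f \<in> borel_measurable borel" using f(1) by (rule borel_measurable_continuous_onI)
  let ?Q = "cbox (- R *\<^sub>R One) (R *\<^sub>R One) :: 'a set"
  have S: "x + (\<Sum>b\<in>Basis. (z b - x \<bullet> b) *\<^sub>R b) = (\<Sum>b\<in>Basis. z b *\<^sub>R b)" for z
    by (simp add: scaleR_left_diff_distrib sum_subtractf euclidean_representation)
  have ind: "(\<Prod>b\<in>Basis. indicator {-R..R} (z b)) = (indicator ?Q (\<Sum>b\<in>Basis. z b *\<^sub>R b) :: ennreal)" for z :: "'a \<Rightarrow> real"
    by (auto simp: indicator_def mem_box inner_sum_left_Basis prod_eq_1_iff intro!: prod.neutral)
  have "ennreal (margs R bs f x) = (\<integral>\<^sup>+ z. ennreal (f (\<Sum>b\<in>Basis. z b *\<^sub>R b)) * indicator ?Q (\<Sum>b\<in>Basis. z b *\<^sub>R b) \<partial>(\<Pi>\<^sub>M b\<in>Basis. lborel))"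
    using ennreal_margs[of bs f R x] assms by (simp add: S ind)
  also have "\<dots> = (\<integral>\<^sup>+ y. ennreal (f y) * indicator ?Q y \<partial>lborel)"
    by (subst lborel_eq, subst nn_integral_distr) auto
  also have "\<dots> = ennreal (integral ?Q f)"
    using f by (intro nn_integral_has_integral_lebesgue' integrable_integral integrable_continuous)
       (auto intro: continuous_on_subset)
  moreover have "margs R bs f x \<ge> 0"
  proof -
    have "0 \<le> margs R bs f x" if "continuous_on UNIV f" "\<And>y. f y \<ge> 0" for f :: "'a \<Rightarrow> real" and bs
      using that by (induction bs arbitrary: f) (auto intro: marg_cont marg_nonneg)
    then show ?thesis using f by blast
  qed
  moreover have "integral ?Q f \<ge> 0"
    using f by (intro integral_nonneg integrable_continuous) (auto intro: continuous_on_subset)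
  ultimately show ?thesis by simp
qed

section \<open>Gagliardo's inequality and Sobolev bounds in dimensions one, two and higher\<close>

lemma abs_powr_derivative:
  fixes y \<gamma> :: real
  assumes \<gamma>: "\<gamma> > 1"
  shows "((\<lambda>y. \<bar>y\<bar> powr \<gamma>) has_real_derivative \<gamma> * \<bar>y\<bar> powr (\<gamma> - 1) * sgn y) (at y)"
proof -
  consider "y > 0" | "y < 0" | "y = 0" by linarith
  then show ?thesis
  proof cases
    case 1
    then have "((\<lambda>y. y powr \<gamma>) has_real_derivative \<gamma> * y powr (\<gamma> - 1)) (at y)"
      by (rule has_real_derivative_powr)
    then have "((\<lambda>y. \<bar>y\<bar> powr \<gamma>) has_real_derivative \<gamma> * y powr (\<gamma> - 1)) (at y)"
      by (rule has_field_derivative_transform_within_open[of _ _ _ "{0<..}"]) (use 1 in auto)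
    then show ?thesis using 1 by simp
  next
    case 2
    then have "((\<lambda>y. (- y) powr \<gamma>) has_real_derivative - (\<gamma> * (- y) powr (\<gamma> - 1))) (at y)"
      by (auto intro!: derivative_eq_intros simp: powr_diff)
    then have "((\<lambda>y. \<bar>y\<bar> powr \<gamma>) has_real_derivative - (\<gamma> * (- y) powr (\<gamma> - 1))) (at y)"
      by (rule has_field_derivative_transform_within_open[of _ _ _ "{..<0}"]) (use 2 in auto)
    then show ?thesis using 2 by simp
  next
    case 3
    have "((\<lambda>h::real. \<bar>h\<bar> powr (\<gamma> - 1)) \<longlongrightarrow> \<bar>0\<bar> powr (\<gamma> - 1)) (at 0)"
      by (intro tendsto_powr' tendsto_intros) (use \<gamma> in auto)
    then have "((\<lambda>h::real. \<bar>h\<bar> powr (\<gamma> - 1)) \<longlongrightarrow> 0) (at 0)" using \<gamma> by simp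
    moreover have "norm (\<bar>h\<bar> powr \<gamma> / h) = \<bar>h\<bar> powr (\<gamma> - 1)" for h :: real
      by (cases "h = 0") (use \<gamma> in \<open>auto simp: powr_diff abs_mult\<close>)
    ultimately have "((\<lambda>h::real. \<bar>h\<bar> powr \<gamma> / h) \<longlongrightarrow> 0) (at 0)"
      by (subst tendsto_norm_zero_iff[symmetric]) simp
    then show ?thesis using \<gamma> 3 by (simp add: DERIV_def)
  qed
qed

text \<open>Fundamental theorem of calculus along the line through \<open>x\<close>, started on the
  face of the cube, where \<open>\<phi>\<close> vanishes. The outer function \<open>P\<close> is
  general so as to serve both the powers of \<open>\<phi>\<close> and, in dimension one,
  \<open>\<phi>\<close> itself.\<close>

lemma line_bound:
  fixes \<phi> :: "'a::euclidean_space \<Rightarrow> real" and P P' :: "real \<Rightarrow> real"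
  assumes b: "b \<in> Basis" and d: "\<And>x. (\<phi> has_derivative \<phi>' x) (at x)"
    and P: "\<And>y. (P has_real_derivative P' y) (at y)" "P 0 = 0"
    and supp: "\<And>x. \<phi> x \<noteq> 0 \<Longrightarrow> \<bar>x \<bullet> b\<bar> < R"
    and f: "continuous_on UNIV f" "\<And>y. \<bar>P' (\<phi> y)\<bar> * \<bar>\<phi>' y b\<bar> \<le> f y"
  shows "\<bar>P (\<phi> x)\<bar> \<le> marg R b f x"
proof -
  have f0: "f y \<ge> 0" for y by (rule order_trans[OF _ f(2)]) simp
  show ?thesis
  proof (cases "\<phi> x = 0")
    case True
    then show ?thesis using marg_nonneg[OF f(1) f0] P by simp
  next
    case False
    define l where "l s = x + (s - x \<bullet> b) *\<^sub>R b" for s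
    have xR: "-R \<le> x \<bullet> b" "x \<bullet> b \<le> R" using supp[OF False] by auto
    have "((\<lambda>s. P (\<phi> (l s))) has_vector_derivative P' (\<phi> (l s)) * \<phi>' (l s) b) (at s)" for s
    proof -
      have "(l has_derivative (\<lambda>h. h *\<^sub>R b)) (at s)" unfolding l_def
        by (auto intro!: derivative_eq_intros)
      from has_derivative_compose[OF this d]
      have "((\<lambda>s. \<phi> (l s)) has_derivative (\<lambda>h. \<phi>' (l s) (h *\<^sub>R b))) (at s)" .
      moreover have "\<phi>' (l s) (h *\<^sub>R b) = \<phi>' (l s) b * h" for h
        using linear_scale[OF has_derivative_linear[OF d]] by simp
      ultimately have "((\<lambda>s. \<phi> (l s)) has_real_derivative \<phi>' (l s) b) (at s)"
        by (simp add: has_field_derivative_def)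
      from DERIV_chain'[OF this P(1)] show ?thesis
        by (simp add: has_real_derivative_iff_has_vector_derivative mult.commute)
    qed
    then have "((\<lambda>s. P' (\<phi> (l s)) * \<phi>' (l s) b) has_integral P (\<phi> (l (x \<bullet> b))) - P (\<phi> (l (-R)))) {-R..x \<bullet> b}"
      by (intro fundamental_theorem_of_calculus xR) (auto intro: has_vector_derivative_at_within)
    moreover have "\<phi> (l (-R)) = 0"
    proof (rule ccontr)
      assume "\<phi> (l (-R)) \<noteq> 0"
      from supp[OF this] show False using b by (simp add: l_def inner_add_left inner_same_Basis)
    qed
    ultimately have I: "((\<lambda>s. P' (\<phi> (l s)) * \<phi>' (l s) b) has_integral P (\<phi> x)) {-R..x \<bullet> b}"
      using P by (simp add: l_def)
    have "norm (integral {-R..x \<bullet> b} (\<lambda>s. P' (\<phi> (l s)) * \<phi>' (l s) b)) \<le> integral {-R..x \<bullet> b} (\<lambda>s. f (l s))"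
      by (rule integral_norm_bound_integral)
         (use I f in \<open>auto simp: l_def abs_mult intro: line_integrable has_integral_integrable\<close>)
    also have "\<dots> \<le> integral {-R..R} (\<lambda>s. f (l s))"
      by (rule integral_subset_le) (use xR f f0 in \<open>auto simp: l_def intro: line_integrable\<close>)
    finally show ?thesis using I by (simp add: integral_unique marg_def l_def)
  qed
qed

text \<open>The optimal parameter is \<open>t = sqrt (B / A)\<close>; degenerate cases are reached
  by letting \<open>t\<close> become large or small. This turns Young's inequality into
  Cauchy-Schwarz for any integral.\<close>

lemma le_sqrt_mult_of_young:
  fixes A B c :: real
  assumes "A \<ge> 0" "B \<ge> 0" and *: "\<And>t. t > 0 \<Longrightarrow> 2 * c \<le> t * A + B / t"
  shows "c \<le> sqrt (A * B)"
proof (cases "A > 0 \<and> B > 0")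
  case True
  have "2 * c \<le> sqrt (B / A) * A + B / sqrt (B / A)" using True by (intro *) auto
  also have "\<dots> = 2 * sqrt (A * B)"
    using True by (simp add: real_sqrt_divide real_sqrt_mult field_simps)
  finally show ?thesis by simp
next
  case False
  have "c \<le> 0 + e" if e: "e > 0" for e
  proof (cases "A = 0")
    case True
    have "2 * c \<le> ((B + 1) / e) * A + B / ((B + 1) / e)" using e assms by (intro *) auto
    also have "\<dots> \<le> 2 * e" using True e assms by (simp add: field_simps add_increasing)
    finally show ?thesis by simp
  next
    case A: False
    then have "B = 0" using False assms by auto
    then show ?thesis using *[of "e / A"] A e assms by (simp add: less_le)
  qed
  then have "c \<le> 0" by (rule field_le_epsilon)
  then show ?thesis using assms by (simp add: order_trans)
qed

lemma Cauchy_Schwarz_box: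
  fixes f h :: "'a::euclidean_space \<Rightarrow> real"
  assumes "continuous_on (cbox a b) f" "continuous_on (cbox a b) h"
  shows "integral (cbox a b) (\<lambda>x. f x * h x)
    \<le> sqrt (integral (cbox a b) (\<lambda>x. (f x)\<^sup>2) * integral (cbox a b) (\<lambda>x. (h x)\<^sup>2))"
proof (rule le_sqrt_mult_of_young)
  fix t :: real assume t: "t > 0"
  have "integral (cbox a b) (\<lambda>x. 2 * (f x * h x)) \<le> integral (cbox a b) (\<lambda>x. t * (f x)\<^sup>2 + (h x)\<^sup>2 / t)"
  proof (rule integral_le)
    fix x
    have "0 \<le> (sqrt t * f x - h x / sqrt t)\<^sup>2" by simp
    also have "\<dots> = t * (f x)\<^sup>2 + (h x)\<^sup>2 / t - 2 * (f x * h x)"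
      using t by (simp add: power2_eq_square algebra_simps)
    finally show "2 * (f x * h x) \<le> t * (f x)\<^sup>2 + (h x)\<^sup>2 / t" by simp
  qed (intro integrable_continuous continuous_intros assms; use t in auto)+
  also have "\<dots> = integral (cbox a b) (\<lambda>x. t * (f x)\<^sup>2) + integral (cbox a b) (\<lambda>x. (h x)\<^sup>2 / t)"
    by (rule Henstock_Kurzweil_Integration.integral_add; intro integrable_continuous continuous_intros assms; use t in auto)
  finally show "2 * integral (cbox a b) (\<lambda>x. f x * h x) \<le> t * integral (cbox a b) (\<lambda>x. (f x)\<^sup>2) + integral (cbox a b) (\<lambda>x. (h x)\<^sup>2) / t"
    by simp
qed (intro integral_nonneg integrable_continuous continuous_intros assms; simp)+

abbreviation "cube R \<equiv> cbox (- R *\<^sub>R One) (R *\<^sub>R One)"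

text \<open>\<open>N\<close> is a majorant of the partial derivatives rather than the gradient norm
  of \<open>\<phi>\<close>: later \<open>\<phi>\<close> is one component of a vector field and
  \<open>N\<close> is the norm of the whole gradient matrix.\<close>

locale cube_function =
  fixes \<phi> :: "'a::euclidean_space \<Rightarrow> real" and \<phi>' :: "'a \<Rightarrow> 'a \<Rightarrow> real" and N :: "'a \<Rightarrow> real" and R :: real
  assumes deriv: "\<And>x. (\<phi> has_derivative \<phi>' x) (at x)"
    and supp: "\<And>x b. b \<in> Basis \<Longrightarrow> \<phi> x \<noteq> 0 \<Longrightarrow> \<bar>x \<bullet> b\<bar> < R"
    and N: "continuous_on UNIV N" "\<And>x b. b \<in> Basis \<Longrightarrow> \<bar>\<phi>' x b\<bar> \<le> N x"
    and R: "R > 0"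
begin

lemma cont: "continuous_on S \<phi>"
  by (rule has_derivative_continuous_on) (rule has_derivative_at_withinI[OF deriv])

lemma N_nonneg: "N x \<ge> 0"
  using N(2)[OF SOME_Basis, of x] by linarith

lemma cont_powr: "r > 0 \<Longrightarrow> continuous_on S (\<lambda>x. \<bar>\<phi> x\<bar> powr r)"
  by (rule continuous_on_powr') (auto intro!: continuous_intros cont)

text \<open>Every direction bounds \<open>\<bar>\<phi>\<bar> powr \<gamma>\<close> by the same line
  integral up to rotation of the axis; multiplying the bounds over all directions puts the integrand
  into the form handled by \<open>grid_lines\<close>.\<close>

lemma gagliardo:
  fixes \<gamma> :: real
  assumes \<gamma>: "\<gamma> > 1" and n: "DIM('a) \<ge> 2"
  shows "integral (cube R) (\<lambda>x. \<bar>\<phi> x\<bar> powr (\<gamma> * real DIM('a) / (real DIM('a) - 1)))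
    \<le> (\<gamma> * integral (cube R) (\<lambda>x. \<bar>\<phi> x\<bar> powr (\<gamma> - 1) * N x)) powr (real DIM('a) / (real DIM('a) - 1))"
proof -
  let ?n = "real DIM('a)"
  \<comment> \<open>With this value the factor \<open>f\<close> itself gets exponent
    \<open>0\<close> in \<open>grid_lines\<close>, so only the product of line integrals is
    left.\<close>
  define \<theta> where "\<theta> = 1 / (?n - 1)"
  have \<theta>: "\<theta> > 0" "(?n - 1) * \<theta> = 1" "1 + \<theta> = ?n / (?n - 1)" using n by (auto simp: \<theta>_def field_simps)
  obtain bs :: "'a list" where bs: "set bs = Basis" "distinct bs" using finite_distinct_list[OF finite_Basis] by blast
  have lbs: "length bs = DIM('a)" using bs distinct_card by metis
  let ?u = "\<lambda>x. \<gamma> * (\<bar>\<phi> x\<bar> powr (\<gamma> - 1) * N x)"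
  have u: "continuous_on UNIV ?u" "\<And>x. ?u x \<ge> 0"
    using \<gamma> N_nonneg by (auto intro!: continuous_intros cont_powr N)
  let ?v = "\<lambda>x. \<bar>\<phi> x\<bar> powr (\<gamma> * ?n / (?n - 1))"
  have v: "continuous_on UNIV ?v" using \<gamma> n by (intro cont_powr) auto
  \<comment> \<open>The integrand is shifted by \<open>e\<close> because \<open>grid_lines\<close>
    needs strict positivity; \<open>e\<close> tends to \<open>0\<close> at the end.\<close>
  have eps: "integral (cube R) ?v \<le> integral (cube R) (\<lambda>x. ?u x + e) powr (1 + \<theta>)" if e: "e > 0" for e
  proof -
    let ?f = "\<lambda>x. ?u x + e"
    have f: "continuous_on UNIV ?f" "\<And>x. ?f x > 0"
      using u e by (auto intro!: continuous_intros add_nonneg_pos)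
    have le: "\<bar>\<phi> x\<bar> powr \<gamma> \<le> marg R b ?f x" if b: "b \<in> Basis" for b x
    proof -
      have "\<bar>\<bar>\<phi> x\<bar> powr \<gamma>\<bar> \<le> marg R b ?f x"
      proof (rule line_bound[OF b deriv abs_powr_derivative[OF \<gamma>]])
        fix y
        have "\<bar>\<gamma> * \<bar>\<phi> y\<bar> powr (\<gamma> - 1) * sgn (\<phi> y)\<bar> * \<bar>\<phi>' y b\<bar> \<le> (\<gamma> * \<bar>\<phi> y\<bar> powr (\<gamma> - 1) * 1) * N y"
          using \<gamma> N(2)[OF b] by (intro mult_mono) (auto simp: abs_mult abs_sgn_eq)
        then show "\<bar>\<gamma> * \<bar>\<phi> y\<bar> powr (\<gamma> - 1) * sgn (\<phi> y)\<bar> * \<bar>\<phi>' y b\<bar> \<le> ?f y" using e by simp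
      qed (use f supp[OF b] in auto)
      then show ?thesis by simp
    qed
    have pw: "?v y \<le> (\<Prod>b\<in>set bs. marg R b ?f y powr \<theta>)" for y
    proof -
      have "?v y = (\<Prod>b\<in>set bs. (\<bar>\<phi> y\<bar> powr \<gamma>) powr \<theta>)"
      proof (cases "\<phi> y = 0")
        case True
        then show ?thesis using n by (simp add: bs card_gt_0_iff)
      next
        case False
        have "(\<Prod>b\<in>set bs. (\<bar>\<phi> y\<bar> powr \<gamma>) powr \<theta>) = (\<bar>\<phi> y\<bar> powr (\<gamma> * \<theta>)) ^ DIM('a)"
          by (simp add: bs powr_powr)
        also have "\<dots> = (\<bar>\<phi> y\<bar> powr (\<gamma> * \<theta>)) powr ?n" using False by (subst powr_realpow) auto
        also have "\<dots> = ?v y" by (simp add: powr_powr \<theta>_def)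
        finally show ?thesis by simp
      qed
      also have "\<dots> \<le> (\<Prod>b\<in>set bs. marg R b ?f y powr \<theta>)"
        using \<theta> le bs by (intro prod_mono conjI powr_mono2) auto
      finally show ?thesis .
    qed
    have "integral (cube R) ?v = margs R bs ?v 0"
      by (rule margs_Basis[symmetric, OF bs(2) bs(1) v]) simp
    also have "\<dots> \<le> margs R bs (\<lambda>y. ?f y powr (1 - (real (length bs) - 1) * \<theta>) * (\<Prod>b\<in>set bs. marg R b ?f y powr \<theta>)) 0"
    proof (rule margs_mono[OF v])
      show "continuous_on UNIV (\<lambda>y. ?f y powr (1 - (real (length bs) - 1) * \<theta>) * (\<Prod>b\<in>set bs. marg R b ?f y powr \<theta>))"
        by (rule grid_cont[OF f R])
      show "?v y \<le> ?f y powr (1 - (real (length bs) - 1) * \<theta>) * (\<Prod>b\<in>set bs. marg R b ?f y powr \<theta>)" for y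
        using pw[of y] f(2)[of y] lbs \<theta> by simp
    qed
    also have "\<dots> \<le> margs R bs ?f 0 powr (1 + \<theta>)"
      using \<theta> lbs by (intro grid_lines[OF bs(2) _ _ _ f R]) (simp_all add: bs(1))
    also have "margs R bs ?f 0 = integral (cube R) ?f"
      by (rule margs_Basis[OF bs(2) bs(1) f(1) less_imp_le[OF f(2)]])
    finally show ?thesis .
  qed
  have split: "integral (cube R) (\<lambda>x. ?u x + e) = integral (cube R) ?u + e * measure lborel (cube R :: 'a set)" for e
  proof -
    have "integral (cube R) (\<lambda>x. ?u x + e) = integral (cube R) ?u + integral (cube R) (\<lambda>x::'a. e)"
      by (subst Henstock_Kurzweil_Integration.integral_add) (auto intro!: integrable_continuous continuous_on_subset[OF u(1)])
    then show ?thesis by (simp only: integral_const real_scaleR_def mult.commute)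
  qed
  have "((\<lambda>e. integral (cube R) (\<lambda>x. ?u x + e) powr (1 + \<theta>)) \<longlongrightarrow> (integral (cube R) ?u + 0 * measure lborel (cube R :: 'a set)) powr (1 + \<theta>)) (at_right 0)"
  proof -
    have nn: "integral (cube R) ?u \<ge> 0" using u by (intro integral_nonneg integrable_continuous continuous_on_subset[OF u(1)]) auto
    have "eventually (\<lambda>e. 0 \<le> integral (cube R) ?u + e * measure lborel (cube R :: 'a set)) (at_right 0)"
      using eventually_at_right_less[of 0] by eventually_elim (use nn in auto)
    then show ?thesis unfolding split
      using \<theta> by (intro tendsto_powr' tendsto_intros) auto
  qed
  moreover have "eventually (\<lambda>e. integral (cube R) ?v \<le> integral (cube R) (\<lambda>x. ?u x + e) powr (1 + \<theta>)) (at_right 0)"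
    using eventually_at_right_less[of 0] by eventually_elim (rule eps)
  ultimately have "integral (cube R) ?v \<le> (integral (cube R) ?u + 0 * measure lborel (cube R :: 'a set)) powr (1 + \<theta>)"
    by (rule tendsto_lowerbound) simp
  then show ?thesis using \<theta> n by (simp add: of_nat_diff)
qed

lemma cont_N: "continuous_on S N" by (rule continuous_on_subset[OF N(1)]) auto

lemma CS_gradient:
  fixes \<gamma> :: real
  assumes \<gamma>: "\<gamma> > 1"
  shows "integral (cube R) (\<lambda>x. \<bar>\<phi> x\<bar> powr (\<gamma> - 1) * N x)
    \<le> sqrt (integral (cube R) (\<lambda>x. \<bar>\<phi> x\<bar> powr (2 * \<gamma> - 2)) * integral (cube R) (\<lambda>x. (N x)\<^sup>2))"
proof -
  have "(\<bar>\<phi> x\<bar> powr (\<gamma> - 1))\<^sup>2 = \<bar>\<phi> x\<bar> powr (2 * \<gamma> - 2)" for x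
    by (simp add: power2_eq_square flip: powr_add)
  then show ?thesis
    using Cauchy_Schwarz_box[of "- R *\<^sub>R One" "R *\<^sub>R One" "\<lambda>x. \<bar>\<phi> x\<bar> powr (\<gamma> - 1)" N] \<gamma>
    by (simp add: cont_powr cont_N)
qed

lemma int_powr_nonneg: "r > 0 \<Longrightarrow> integral (cube R) (\<lambda>x. \<bar>\<phi> x\<bar> powr r) \<ge> 0"
  by (intro integral_nonneg integrable_continuous cont_powr) auto

text \<open>\<open>\<gamma>\<close> solves \<open>\<gamma> n / (n - 1) = 2 \<gamma> - 2\<close>,
  with \<open>n\<close> the dimension. After Cauchy-Schwarz the same integral \<open>Y\<close>
  stands on both sides with a smaller power on the right; dividing leaves the power
  \<open>d\<close>, and \<open>e / d = q\<close> restores the homogeneity.\<close>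

lemma sobolev_critical:
  assumes n: "DIM('a) \<ge> 3" and K: "integral (cube R) (\<lambda>x. (N x)\<^sup>2) \<le> K" "K > 0"
    and q: "q = 2 * real DIM('a) / (real DIM('a) - 2)"
  defines "\<gamma> \<equiv> 2 * (real DIM('a) - 1) / (real DIM('a) - 2)"
  shows "integral (cube R) (\<lambda>x. \<bar>\<phi> x\<bar> powr q) \<le> \<gamma> powr q * K powr (q / 2)"
proof -
  let ?n = "real DIM('a)"
  define k where "k = ?n - 2"
  have k: "k > 0" "?n = k + 2" using n by (auto simp: k_def)
  have \<gamma>: "\<gamma> > 1" using k by (simp add: \<gamma>_def field_simps)
  have e1: "\<gamma> * ?n / (?n - 1) = q"
  proof -
    have s: "k + 2 - 1 = k + 1" "k + 2 - 2 = k" "k + 1 \<noteq> 0" using k by auto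
    show ?thesis unfolding \<gamma>_def q k(2) s(1,2) nonzero_divide_eq_eq[OF s(3)]
      by (simp add: algebra_simps)
  qed
  have e2: "2 * \<gamma> - 2 = q" using k unfolding q \<gamma>_def by (simp add: field_simps)
  have q0: "q > 0" using k unfolding q by simp
  define Y where "Y = integral (cube R) (\<lambda>x. \<bar>\<phi> x\<bar> powr q)"
  define e where "e = ?n / (?n - 1)"
  have e: "e > 0" using k by (simp add: e_def)
  define d where "d = 1 - e / 2"
  have d': "d = k / (2 * (k + 1))" unfolding d_def e_def k(2) using k(1) by (simp add: field_simps)
  have d: "d > 0" using k(1) by (simp add: d')
  have "e = q * d" unfolding d' e_def q k(2) using k(1) by (simp add: divide_simps) (simp add: algebra_simps)
  then have ed: "e / d = q" using d by simp
  have Y0: "Y \<ge> 0" unfolding Y_def by (rule int_powr_nonneg[OF q0])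
  show ?thesis
  proof (cases "Y = 0")
    case False
    with Y0 have Y: "Y > 0" by simp
    have I0: "integral (cube R) (\<lambda>x. \<bar>\<phi> x\<bar> powr (\<gamma> - 1) * N x) \<ge> 0"
      using \<gamma> N_nonneg by (intro integral_nonneg integrable_continuous continuous_intros cont_powr cont_N) auto
    have "Y \<le> (\<gamma> * integral (cube R) (\<lambda>x. \<bar>\<phi> x\<bar> powr (\<gamma> - 1) * N x)) powr e"
      using gagliardo[OF \<gamma>] n e1 by (simp add: Y_def e_def of_nat_diff)
    also have "\<dots> \<le> (\<gamma> * sqrt (Y * K)) powr e"
    proof (intro powr_mono2 mult_left_mono)
      have "integral (cube R) (\<lambda>x. \<bar>\<phi> x\<bar> powr (\<gamma> - 1) * N x) \<le> sqrt (Y * integral (cube R) (\<lambda>x. (N x)\<^sup>2))"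
        using CS_gradient[OF \<gamma>] by (simp add: e2 Y_def)
      also have "\<dots> \<le> sqrt (Y * K)" using K Y by (intro real_sqrt_le_mono mult_left_mono) auto
      finally show "integral (cube R) (\<lambda>x. \<bar>\<phi> x\<bar> powr (\<gamma> - 1) * N x) \<le> sqrt (Y * K)" .
    qed (use I0 e \<gamma> in auto)
    also have "\<dots> = \<gamma> powr e * Y powr (e / 2) * K powr (e / 2)"
      using \<gamma> Y K by (simp add: powr_mult powr_half_sqrt[symmetric] powr_powr)
    finally have "Y powr 1 / Y powr (e / 2) \<le> \<gamma> powr e * K powr (e / 2)"
      using Y by (simp add: field_simps)
    then have "Y powr d \<le> \<gamma> powr e * K powr (e / 2)" by (simp only: d_def powr_diff)
    then have "(Y powr d) powr (1 / d) \<le> (\<gamma> powr e * K powr (e / 2)) powr (1 / d)"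
      using d by (intro powr_mono2) auto
    then show ?thesis using d Y \<gamma> K by (simp add: powr_powr powr_mult mult.commute[of d] Y_def flip: ed)
  qed (use Y_def in auto)
qed

text \<open>In the plane the gain \<open>n / (n - 1)\<close> is 2, and Cauchy-Schwarz leaves the
  lower power \<open>q - 2\<close> on the right. It is bounded by a small multiple of the power
  \<open>q\<close> plus a constant on the cube, and the former is absorbed.\<close>

lemma sobolev_planar:
  assumes n: "DIM('a) = 2" and K: "integral (cube R) (\<lambda>x. (N x)\<^sup>2) \<le> K" "K > 0"
    and q: "q > 2"
  shows "integral (cube R) (\<lambda>x. \<bar>\<phi> x\<bar> powr q) \<le> 2 * (q\<^sup>2 / 4) * (q\<^sup>2 / 2) powr ((q - 2) / 2) * measure lborel (cube R :: 'a set) * K powr (q / 2)"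
proof -
  define \<gamma> where "\<gamma> = q / 2"
  have \<gamma>: "\<gamma> > 1" using q by (simp add: \<gamma>_def)
  have e: "2 * \<gamma> - 2 = q - 2" by (simp add: \<gamma>_def)
  let ?Q = "measure lborel (cube R :: 'a set)"
  define Y where "Y = integral (cube R) (\<lambda>x. \<bar>\<phi> x\<bar> powr q)"
  define Z where "Z = integral (cube R) (\<lambda>x. \<bar>\<phi> x\<bar> powr (q - 2))"
  have Z0: "Z \<ge> 0" unfolding Z_def using q by (intro int_powr_nonneg) auto
  \<comment> \<open>Makes the coefficient of \<open>Y\<close> on the right equal to one
    half.\<close>
  define \<epsilon> where "\<epsilon> = 1 / (2 * \<gamma>\<^sup>2 * K)"
  have \<epsilon>: "\<epsilon> > 0" using \<gamma> K by (simp add: \<epsilon>_def)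
  have I0: "integral (cube R) (\<lambda>x. \<bar>\<phi> x\<bar> powr (\<gamma> - 1) * N x) \<ge> 0"
    using \<gamma> N_nonneg by (intro integral_nonneg integrable_continuous continuous_intros cont_powr cont_N) auto
  have "Y \<le> (\<gamma> * integral (cube R) (\<lambda>x. \<bar>\<phi> x\<bar> powr (\<gamma> - 1) * N x)) powr 2"
    using gagliardo[OF \<gamma>] n by (simp add: Y_def \<gamma>_def)
  also have "\<dots> \<le> (\<gamma> * sqrt (Z * K)) powr 2"
  proof (intro powr_mono2 mult_left_mono)
    have "integral (cube R) (\<lambda>x. \<bar>\<phi> x\<bar> powr (\<gamma> - 1) * N x) \<le> sqrt (Z * integral (cube R) (\<lambda>x. (N x)\<^sup>2))"
      using CS_gradient[OF \<gamma>] by (simp add: e Z_def)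
    also have "\<dots> \<le> sqrt (Z * K)" using K Z0 by (intro real_sqrt_le_mono mult_left_mono) auto
    finally show "integral (cube R) (\<lambda>x. \<bar>\<phi> x\<bar> powr (\<gamma> - 1) * N x) \<le> sqrt (Z * K)" .
  qed (use I0 \<gamma> in auto)
  also have "\<dots> = \<gamma>\<^sup>2 * K * Z"
    using \<gamma> Z0 K by (simp add: powr_numeral power_mult_distrib)
  also have "\<dots> \<le> \<gamma>\<^sup>2 * K * (\<epsilon> * Y + \<epsilon> powr (- ((q - 2) / 2)) * ?Q)"
  proof (rule mult_left_mono)
    have "Z \<le> integral (cube R) (\<lambda>x. \<epsilon> * \<bar>\<phi> x\<bar> powr q + \<epsilon> powr (- ((q - 2) / 2)))"
      unfolding Z_def
    proof (rule integral_le)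
      fix x
      show "\<bar>\<phi> x\<bar> powr (q - 2) \<le> \<epsilon> * \<bar>\<phi> x\<bar> powr q + \<epsilon> powr (- ((q - 2) / 2))"
      proof (cases "\<epsilon> * \<bar>\<phi> x\<bar> powr 2 \<ge> 1")
        case True
        then have "\<bar>\<phi> x\<bar> powr (q - 2) * 1 \<le> \<bar>\<phi> x\<bar> powr (q - 2) * (\<epsilon> * \<bar>\<phi> x\<bar> powr 2)"
          by (intro mult_left_mono) auto
        also have "\<dots> = \<epsilon> * (\<bar>\<phi> x\<bar> powr (q - 2) * \<bar>\<phi> x\<bar> powr 2)" by simp
        also have "\<dots> = \<epsilon> * \<bar>\<phi> x\<bar> powr q" by (simp only: powr_add[symmetric]) simp
        also have "\<dots> \<le> \<epsilon> * \<bar>\<phi> x\<bar> powr q + \<epsilon> powr (- ((q - 2) / 2))" by simp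
        finally show ?thesis by simp
      next
        case False
        show ?thesis
        proof (cases "\<phi> x = 0")
          case nz: False
          have e2: "2 * ((q - 2) / 2) = q - 2" "-1 * ((q - 2) / 2) = - ((q - 2) / 2)"
            by (simp, rule mult_minus1)
          have "\<bar>\<phi> x\<bar> powr 2 \<le> \<epsilon> powr (-1)" using False \<epsilon> by (simp add: powr_minus_divide field_simps)
          then have "(\<bar>\<phi> x\<bar> powr 2) powr ((q - 2) / 2) \<le> (\<epsilon> powr (-1)) powr ((q - 2) / 2)"
            using q by (intro powr_mono2) auto
          then have "\<bar>\<phi> x\<bar> powr (q - 2) \<le> \<epsilon> powr (- ((q - 2) / 2))"
            by (simp only: powr_powr e2)
          then show ?thesis using \<epsilon> by (simp add: add_increasing)
        qed (use \<epsilon> in auto)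
      qed
    qed (use q in \<open>auto intro!: integrable_continuous continuous_intros cont_powr\<close>)
    also have "\<dots> = \<epsilon> * Y + \<epsilon> powr (- ((q - 2) / 2)) * ?Q"
      using q by (subst Henstock_Kurzweil_Integration.integral_add)
        (auto intro!: integrable_continuous continuous_intros cont_powr simp: Y_def mult.commute)
    finally show "Z \<le> \<epsilon> * Y + \<epsilon> powr (- ((q - 2) / 2)) * ?Q" .
  qed (use \<gamma> K in auto)
  also have "\<gamma>\<^sup>2 * K * (\<epsilon> * Y + \<epsilon> powr (- ((q - 2) / 2)) * ?Q) = Y / 2 + \<gamma>\<^sup>2 * K * \<epsilon> powr (- ((q - 2) / 2)) * ?Q"
  proof -
    have "\<gamma>\<^sup>2 * K * \<epsilon> = 1 / 2" using \<gamma> K by (simp add: \<epsilon>_def)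
    moreover have "\<gamma>\<^sup>2 * K * (\<epsilon> * Y + \<epsilon> powr (- ((q - 2) / 2)) * ?Q) = (\<gamma>\<^sup>2 * K * \<epsilon>) * Y + \<gamma>\<^sup>2 * K * \<epsilon> powr (- ((q - 2) / 2)) * ?Q"
      by (simp add: distrib_left mult.assoc)
    ultimately show ?thesis by simp
  qed
  finally have Y: "Y \<le> 2 * (\<gamma>\<^sup>2 * K * \<epsilon> powr (- ((q - 2) / 2)) * ?Q)" by simp
  have "\<epsilon> powr (- ((q - 2) / 2)) = (2 * \<gamma>\<^sup>2 * K) powr ((q - 2) / 2)"
    by (simp add: \<epsilon>_def powr_minus_divide powr_divide)
  also have "\<dots> = (2 * \<gamma>\<^sup>2) powr ((q - 2) / 2) * K powr ((q - 2) / 2)" using K by (simp add: powr_mult)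
  finally have "K * \<epsilon> powr (- ((q - 2) / 2)) = (2 * \<gamma>\<^sup>2) powr ((q - 2) / 2) * (K powr 1 * K powr ((q - 2) / 2))"
    using K by simp
  also have "K powr 1 * K powr ((q - 2) / 2) = K powr (q / 2)"
    by (simp only: powr_add[symmetric]) (simp add: field_simps)
  finally have KE: "K * \<epsilon> powr (- ((q - 2) / 2)) = (2 * \<gamma>\<^sup>2) powr ((q - 2) / 2) * K powr (q / 2)" .
  have "2 * (\<gamma>\<^sup>2 * K * \<epsilon> powr (- ((q - 2) / 2)) * ?Q) = 2 * \<gamma>\<^sup>2 * (K * \<epsilon> powr (- ((q - 2) / 2))) * ?Q" by simp
  also have "\<dots> = 2 * (q\<^sup>2 / 4) * (q\<^sup>2 / 2) powr ((q - 2) / 2) * ?Q * K powr (q / 2)"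
    unfolding KE by (simp add: \<gamma>_def power_divide)
  finally show ?thesis using Y by (simp only: Y_def)
qed

text \<open>In dimension one the function is bounded pointwise by the integral of \<open>N\<close>,
  and Cauchy-Schwarz brings in the length \<open>2 * R\<close>; the integral then costs only the
  measure of the cube.\<close>

lemma sobolev_line:
  assumes n: "DIM('a) = 1" and K: "integral (cube R) (\<lambda>x. (N x)\<^sup>2) \<le> K" "K > 0" and m: "m \<ge> 2"
  shows "integral (cube R) (\<lambda>x. \<bar>\<phi> x\<bar> powr m) \<le> measure lborel (cube R :: 'a set) * (2 * R) powr (m / 2) * K powr (m / 2)"
proof -
  obtain b :: 'a where b: "Basis = {b}" using n by (auto simp: card_1_singleton_iff)
  have "\<bar>\<phi> x\<bar> powr m \<le> (2 * R * K) powr (m / 2)" for x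
  proof -
    have "\<bar>\<phi> x\<bar> \<le> marg R b N x"
      by (rule line_bound[where P = "\<lambda>y. y" and P' = "\<lambda>_. 1", OF _ deriv])
         (use b N supp[of b] in \<open>auto intro: cont_N\<close>)
    also have "\<dots> = integral (cbox (-R) R) (\<lambda>s. 1 * N (x + (s - x \<bullet> b) *\<^sub>R b))" by (simp add: marg_def)
    also have "\<dots> \<le> sqrt (integral (cbox (-R) R) (\<lambda>s. 1\<^sup>2) * integral (cbox (-R) R) (\<lambda>s. (N (x + (s - x \<bullet> b) *\<^sub>R b))\<^sup>2))"
      by (rule Cauchy_Schwarz_box) (auto intro: cont_line N)
    also have "integral (cbox (-R) R) (\<lambda>s. (N (x + (s - x \<bullet> b) *\<^sub>R b))\<^sup>2) = margs R [b] (\<lambda>x. (N x)\<^sup>2) x"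
      by (simp add: marg_def)
    also have "\<dots> = integral (cube R) (\<lambda>x. (N x)\<^sup>2)"
      by (rule margs_Basis) (auto simp: b intro!: continuous_intros N)
    also have "integral (cbox (-R) R) (\<lambda>s. 1\<^sup>2) = 2 * R" using R by simp
    also have "sqrt (2 * R * integral (cube R) (\<lambda>x. (N x)\<^sup>2)) \<le> sqrt (2 * R * K)"
      using K R by (intro real_sqrt_le_mono mult_left_mono) auto
    finally have "\<bar>\<phi> x\<bar> powr m \<le> sqrt (2 * R * K) powr m" using m by (intro powr_mono2) auto
    also have "\<dots> = (2 * R * K) powr (m / 2)" using R K by (simp add: powr_half_sqrt[symmetric] powr_powr)
    finally show ?thesis .
  qed
  then have "integral (cube R) (\<lambda>x. \<bar>\<phi> x\<bar> powr m) \<le> integral (cube R) (\<lambda>x::'a. (2 * R * K) powr (m / 2))"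
    using m by (intro integral_le integrable_continuous cont_powr) auto
  also have "\<dots> = measure lborel (cube R :: 'a set) * (2 * R) powr (m / 2) * K powr (m / 2)"
    using R K by (simp add: powr_mult)
  finally show ?thesis .
qed

text \<open>The values of \<open>\<phi>\<close> are compared with the threshold
  \<open>a = sqrt K\<close>: below it the power \<open>m\<close> is at most \<open>a powr m\<close>,
  above it the power \<open>q\<close> takes over. This threshold gives both parts the homogeneity
  \<open>K powr (m / 2)\<close>.\<close>

lemma lower_exponent:
  assumes m: "0 < m" "m \<le> q" and K: "K > 0"
    and S: "integral (cube R) (\<lambda>x. \<bar>\<phi> x\<bar> powr q) \<le> S * K powr (q / 2)"
  shows "integral (cube R) (\<lambda>x. \<bar>\<phi> x\<bar> powr m) \<le> (measure lborel (cube R :: 'a set) + S) * K powr (m / 2)"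
proof -
  define a where "a = sqrt K"
  have a: "a > 0" using K by (simp add: a_def)
  have am: "a powr r = K powr (r / 2)" for r using K by (simp add: a_def powr_half_sqrt[symmetric] powr_powr)
  have "integral (cube R) (\<lambda>x. \<bar>\<phi> x\<bar> powr m) \<le> integral (cube R) (\<lambda>x. a powr m + a powr (m - q) * \<bar>\<phi> x\<bar> powr q)"
  proof (rule integral_le)
    fix x
    show "\<bar>\<phi> x\<bar> powr m \<le> a powr m + a powr (m - q) * \<bar>\<phi> x\<bar> powr q"
    proof (cases "\<bar>\<phi> x\<bar> \<le> a")
      case True
      then have "\<bar>\<phi> x\<bar> powr m \<le> a powr m" using m by (intro powr_mono2) auto
      then show ?thesis by (simp add: add_increasing2)
    next
      case False
      then have "\<bar>\<phi> x\<bar> powr (m - q) \<le> a powr (m - q)" using m a by (intro powr_mono2') auto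
      then have "\<bar>\<phi> x\<bar> powr (m - q) * \<bar>\<phi> x\<bar> powr q \<le> a powr (m - q) * \<bar>\<phi> x\<bar> powr q" by (intro mult_right_mono) auto
      then show ?thesis by (simp add: add_increasing flip: powr_add)
    qed
  qed (use m in \<open>auto intro!: integrable_continuous continuous_intros cont_powr\<close>)
  also have "\<dots> = a powr m * measure lborel (cube R :: 'a set) + a powr (m - q) * integral (cube R) (\<lambda>x. \<bar>\<phi> x\<bar> powr q)"
    using m by (subst Henstock_Kurzweil_Integration.integral_add)
      (auto intro!: integrable_continuous continuous_intros cont_powr simp: mult.commute)
  also have "\<dots> \<le> a powr m * measure lborel (cube R :: 'a set) + a powr (m - q) * (S * a powr q)"
    using S by (intro add_left_mono mult_left_mono) (auto simp: am)
  also have "a powr (m - q) * (S * a powr q) = S * a powr m" using a by (simp add: powr_diff)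
  finally show ?thesis by (simp add: am algebra_simps)
qed

end

theorem sobolev_cube:
  fixes R m :: real
  assumes R: "R > 0" and m: "m \<ge> 2" and n: "DIM('a) \<ge> 3 \<Longrightarrow> m \<le> 2 * real DIM('a) / (real DIM('a) - 2)"
  shows "\<exists>S\<ge>0. \<forall>(\<phi> :: 'a::euclidean_space \<Rightarrow> real) \<phi>' N K. cube_function \<phi> \<phi>' N R \<longrightarrow> K > 0 \<longrightarrow>
    integral (cube R) (\<lambda>x. (N x)\<^sup>2) \<le> K \<longrightarrow> integral (cube R) (\<lambda>x. \<bar>\<phi> x\<bar> powr m) \<le> S * K powr (m / 2)"
proof -
  have "DIM('a) > 0" by simp
  then consider "DIM('a) = 1" | "DIM('a) = 2" | "DIM('a) \<ge> 3" by linarith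
  then show ?thesis
  proof cases
    case 1
    show ?thesis
      by (rule exI[of _ "measure lborel (cube R :: 'a set) * (2 * R) powr (m / 2)"])
         (use cube_function.sobolev_line[OF _ 1 _ _ m] in auto)
  next
    case 2
    \<comment> \<open>The planar bound demands an exponent above 2, while \<open>m\<close> may equal
      2; it is therefore used at \<open>m + 1\<close> and lowered afterwards.\<close>
    let ?S = "2 * ((m + 1)\<^sup>2 / 4) * ((m + 1)\<^sup>2 / 2) powr ((m + 1 - 2) / 2) * measure lborel (cube R :: 'a set)"
    have q: "m + 1 > 2" "0 < m" "m \<le> m + 1" using m by auto
    have "?S \<ge> 0" by simp
    moreover have "integral (cube R) (\<lambda>x. \<bar>\<phi> x\<bar> powr m) \<le> (measure lborel (cube R :: 'a set) + ?S) * K powr (m / 2)"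
      if "cube_function \<phi> \<phi>' N R" "K > 0" "integral (cube R) (\<lambda>x. (N x)\<^sup>2) \<le> K"
      for \<phi> :: "'a \<Rightarrow> real" and \<phi>' N K
      using cube_function.lower_exponent[OF that(1) q(2,3) that(2) cube_function.sobolev_planar[OF that(1) 2 that(3,2) q(1)]] .
    ultimately show ?thesis
      by (intro exI[of _ "measure lborel (cube R :: 'a set) + ?S"] conjI allI impI add_nonneg_nonneg) auto
  next
    case 3
    let ?q = "2 * real DIM('a) / (real DIM('a) - 2)"
    let ?S = "(2 * (real DIM('a) - 1) / (real DIM('a) - 2)) powr ?q"
    have q: "0 < m" "m \<le> ?q" using m n[OF 3] by auto
    have "integral (cube R) (\<lambda>x. \<bar>\<phi> x\<bar> powr m) \<le> (measure lborel (cube R :: 'a set) + ?S) * K powr (m / 2)"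
      if "cube_function \<phi> \<phi>' N R" "K > 0" "integral (cube R) (\<lambda>x. (N x)\<^sup>2) \<le> K"
      for \<phi> :: "'a \<Rightarrow> real" and \<phi>' N K
      using cube_function.lower_exponent[OF that(1) q that(2) cube_function.sobolev_critical[OF that(1) 3 that(3,2) refl]] .
    then show ?thesis
      by (intro exI[of _ "measure lborel (cube R :: 'a set) + ?S"] conjI allI impI add_nonneg_nonneg) auto
  qed
qed

section \<open>Test functions\<close>

lemma Ck_Suc_imp: "Ck (Suc k) f \<Longrightarrow> Ck k f"
proof (induction k arbitrary: f)
  case 0
  then show ?case
    by (auto intro!: continuous_at_imp_continuous_on differentiable_imp_continuous_within)
next
  case (Suc k)
  have "\<forall>v. Ck (Suc k) (\<lambda>x. frechet_derivative f (at x) v)" "\<forall>x. f differentiable (at x)"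
    using Suc.prems[unfolded Ck.simps(2)[of "Suc k" f]] by blast+
  then show ?case using Suc.IH unfolding Ck.simps(2)[of k f] by blast
qed

lemma Ck_SucI:
  assumes "\<And>x. (f has_derivative f' x) (at x)" "\<And>v. Ck k (\<lambda>x. f' x v)"
  shows "Ck (Suc k) f"
proof -
  have "frechet_derivative f (at x) = f' x" for x using assms(1) frechet_derivative_at by metis
  then show ?thesis using assms by (auto simp: differentiable_def)
qed

lemma Ck_SucD:
  assumes "Ck (Suc k) f"
  shows "(f has_derivative frechet_derivative f (at x)) (at x)" "Ck k (\<lambda>x. frechet_derivative f (at x) v)"
  using assms by (auto simp: frechet_derivative_works[symmetric])

lemma Ck_const: "Ck k (\<lambda>x. c)"
  by (induction k arbitrary: c) (auto intro!: Ck_SucI[where f' = "\<lambda>x v. 0"] simp del: Ck.simps(2))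

lemma Ck_add: "Ck k f \<Longrightarrow> Ck k h \<Longrightarrow> Ck k (\<lambda>x. f x + h x)"
proof (induction k arbitrary: f h)
  case (Suc k)
  show ?case
    by (rule Ck_SucI[OF has_derivative_add[OF Ck_SucD(1)[OF Suc.prems(1)] Ck_SucD(1)[OF Suc.prems(2)]]])
       (intro Suc.IH Ck_SucD(2) Suc.prems)
qed (auto intro: continuous_intros)

lemma Ck_mult: "Ck k f \<Longrightarrow> Ck k h \<Longrightarrow> Ck k (\<lambda>x. f x * h x :: real)"
proof (induction k arbitrary: f h)
  case (Suc k)
  show ?case
    by (rule Ck_SucI[OF has_derivative_mult[OF Ck_SucD(1)[OF Suc.prems(1)] Ck_SucD(1)[OF Suc.prems(2)]]])
       (intro Ck_add Suc.IH Ck_SucD(2) Suc.prems Ck_Suc_imp)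
qed (auto intro: continuous_intros)

lemma Ck_prod: "finite I \<Longrightarrow> (\<And>i. i \<in> I \<Longrightarrow> Ck k (f i)) \<Longrightarrow> Ck k (\<lambda>x. \<Prod>i\<in>I. f i x :: real)"
  by (induction I rule: finite_induct) (auto intro: Ck_mult Ck_const)

text \<open>The functions \<open>p(1/x) exp(-1/x)\<close> on the positive half-line, extended by zero, are closed
  under differentiation.\<close>

definition flat :: "real poly \<Rightarrow> real \<Rightarrow> real" where
  "flat p x = (if x > 0 then poly p (1 / x) * exp (- (1 / x)) else 0)"

lemma poly_exp_tendsto_0: "((\<lambda>y. poly p y * exp (- y)) \<longlongrightarrow> (0::real)) at_top"
proof -
  have "((\<lambda>y. \<Sum>i\<le>degree p. coeff p i * (y ^ i / exp y)) \<longlongrightarrow> (\<Sum>i\<le>degree p. coeff p i * (0::real))) at_top"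
    by (intro tendsto_intros tendsto_power_div_exp_0)
  then show ?thesis by (simp add: poly_altdef exp_minus sum_distrib_right divide_inverse mult.assoc)
qed

text \<open>Differentiation multiplies by \<open>y^2\<close> and replaces \<open>p\<close> by
  \<open>p - p'\<close>, where \<open>y = 1/x\<close>. At the origin the right difference quotient
  is \<open>y p(y) exp(-y)\<close> with \<open>y\<close> tending to infinity.\<close>

lemma flat_derivative: "(flat p has_real_derivative flat ([:0, 0, 1:] * (p - pderiv p)) x) (at x)"
proof -
  consider "x > 0" | "x < 0" | "x = 0" by linarith
  then show ?thesis
  proof cases
    case 1
    have "((\<lambda>x. poly p (1 / x) * exp (- (1 / x))) has_real_derivative flat ([:0, 0, 1:] * (p - pderiv p)) x) (at x)"
      using 1 by (auto intro!: derivative_eq_intros DERIV_chain'[OF _ poly_DERIV]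
          simp: flat_def field_simps power2_eq_square)
    then show ?thesis
      by (rule has_field_derivative_transform_within_open[of _ _ _ "{0<..}"]) (use 1 in \<open>auto simp: flat_def\<close>)
  next
    case 2
    have "((\<lambda>x. 0) has_real_derivative 0) (at x)" by simp
    then have "(flat p has_real_derivative 0) (at x)"
      by (rule has_field_derivative_transform_within_open[of _ _ _ "{..<0}"]) (use 2 in \<open>auto simp: flat_def\<close>)
    then show ?thesis using 2 by (simp add: flat_def)
  next
    case 3
    have "((\<lambda>h. poly ([:0, 1:] * p) (inverse h) * exp (- inverse h)) \<longlongrightarrow> 0) (at_right 0)"
      by (rule filterlim_compose[OF poly_exp_tendsto_0 filterlim_inverse_at_top_right])
    then have "((\<lambda>h. flat p h / h) \<longlongrightarrow> 0) (at_right 0)"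
      by (rule Lim_transform_eventually)
         (use eventually_at_right_less[of 0] in \<open>eventually_elim, auto simp: flat_def field_simps\<close>)
    moreover have "((\<lambda>h. flat p h / h) \<longlongrightarrow> 0) (at_left 0)"
      by (rule Lim_transform_eventually[OF tendsto_const])
         (auto simp: flat_def eventually_at_filter)
    ultimately have "((\<lambda>h. flat p h / h) \<longlongrightarrow> 0) (at 0)"
      by (simp add: filterlim_at_split)
    then show ?thesis using 3 by (simp add: DERIV_def flat_def)
  qed
qed

lemma Ck_flat:
  fixes e :: "'a::euclidean_space"
  shows "Ck k (\<lambda>x. flat p (a * (x \<bullet> e) + c))"
proof (induction k arbitrary: p)
  case 0
  have "continuous_on UNIV (flat p)"
    by (intro continuous_at_imp_continuous_on ballI) (rule DERIV_isCont[OF flat_derivative])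
  then show ?case unfolding Ck.simps
    by (rule continuous_on_compose2) (auto intro!: continuous_intros)
next
  case (Suc k)
  let ?p = "[:0, 0, 1:] * (p - pderiv p)"
  have "((\<lambda>x. flat p (a * (x \<bullet> e) + c)) has_derivative (\<lambda>v. flat ?p (a * (x \<bullet> e) + c) * (a * (v \<bullet> e)))) (at x)" for x
  proof -
    have "((\<lambda>x. a * (x \<bullet> e) + c) has_derivative (\<lambda>v. a * (v \<bullet> e))) (at x)"
      by (auto intro!: derivative_eq_intros)
    from has_derivative_compose[OF this flat_derivative[unfolded has_field_derivative_def]]
    show ?thesis .
  qed
  then show ?case by (rule Ck_SucI) (intro Ck_mult Suc.IH Ck_const)
qed

text \<open>For \<open>k > 0\<close> the parameter only steepens the profile: the function is
  nonzero exactly on the open box, and its values there tend to 1 as \<open>k\<close> grows.\<close>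

definition bump :: "'a::euclidean_space \<Rightarrow> 'a \<Rightarrow> real \<Rightarrow> 'a \<Rightarrow> real" where
  "bump a b k x = (\<Prod>i\<in>Basis. flat 1 (k * (x \<bullet> i) + - (k * (a \<bullet> i))) * flat 1 (- k * (x \<bullet> i) + k * (b \<bullet> i)))"

lemma bump_eq: "bump a b k x = (\<Prod>i\<in>Basis. flat 1 (k * (x \<bullet> i - a \<bullet> i)) * flat 1 (k * (b \<bullet> i - x \<bullet> i)))"
  unfolding bump_def by (intro prod.cong refl) (simp add: algebra_simps)

lemma flat_1_pos: "0 \<le> flat 1 t" "flat 1 t \<le> 1" "flat 1 t \<noteq> 0 \<longleftrightarrow> t > 0"
  by (auto simp: flat_def)

lemma bump_bounds: "0 \<le> bump a b k x" "bump a b k x \<le> 1"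
  unfolding bump_def by (auto intro!: prod_nonneg prod_le_1 mult_nonneg_nonneg mult_le_one flat_1_pos)

lemma bump_nonzero: "k > 0 \<Longrightarrow> bump a b k x \<noteq> 0 \<longleftrightarrow> x \<in> box a b"
  by (auto simp: bump_eq mem_box flat_1_pos zero_less_mult_iff)

lemma bump_test:
  assumes "k > 0" "box a b \<noteq> {}" "cbox a b \<subseteq> \<Omega>"
  shows "test_function \<Omega> (bump a b k)"
proof -
  have s: "{x. bump a b k x \<noteq> 0} = box a b" using bump_nonzero[OF assms(1), of a b] by blast
  have "smooth (bump a b k)" unfolding smooth_def bump_def[abs_def]
    by (intro allI Ck_prod Ck_mult Ck_flat finite_Basis)
  then show ?thesis unfolding test_function_def s
    using assms by (simp add: closure_box)
qed

lemma flat_1_tendsto: "(\<lambda>n. flat 1 (real (Suc n) * t)) \<longlonglongrightarrow> indicator {0<..} t"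
proof (cases "t > 0")
  case True
  have "(\<lambda>n. exp (- (inverse (real (Suc n)) / t))) \<longlonglongrightarrow> exp (- (0 / t))"
    using True by (intro tendsto_intros LIMSEQ_inverse_real_of_nat) auto
  then show ?thesis using True by (simp add: flat_def divide_inverse mult.commute)
next
  case False
  then have "flat 1 (real (Suc n) * t) = 0" for n by (auto simp: flat_def zero_less_mult_iff simp del: of_nat_Suc)
  then show ?thesis using False by simp
qed

lemma bump_tendsto: "(\<lambda>n. bump a b (real (Suc n)) x) \<longlonglongrightarrow> indicator (box a b) x"
proof -
  have "(\<lambda>n. \<Prod>i\<in>Basis. flat 1 (real (Suc n) * (x \<bullet> i - a \<bullet> i)) * flat 1 (real (Suc n) * (b \<bullet> i - x \<bullet> i)))
      \<longlonglongrightarrow> (\<Prod>i\<in>Basis. indicator {0<..} (x \<bullet> i - a \<bullet> i) * indicator {0<..} (b \<bullet> i - x \<bullet> i))"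
    by (intro tendsto_prod tendsto_mult flat_1_tendsto)
  also have "(\<Prod>i\<in>Basis. indicator {0<..} (x \<bullet> i - a \<bullet> i) * indicator {0<..} (b \<bullet> i - x \<bullet> i)) = (indicator (box a b) x :: real)"
    by (auto simp: indicator_def mem_box intro!: prod.neutral)
  finally show ?thesis by (simp only: bump_eq)
qed

lemma test_function_derivative:
  assumes "test_function \<Omega> \<psi>"
  shows "(\<psi> has_derivative frechet_derivative \<psi> (at x)) (at x)"
    and "continuous_on UNIV (\<lambda>x. frechet_derivative \<psi> (at x) v)"
    and "continuous_on UNIV \<psi>"
proof -
  have "Ck (Suc 0) \<psi>" "Ck 0 \<psi>" using assms by (auto simp: test_function_def smooth_def simp del: Ck.simps)
  then show "(\<psi> has_derivative frechet_derivative \<psi> (at x)) (at x)"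
    "continuous_on UNIV (\<lambda>x. frechet_derivative \<psi> (at x) v)" "continuous_on UNIV \<psi>"
    using Ck_SucD[of 0 \<psi>] by (auto simp del: Ck.simps(2))
qed

lemma test_function_support:
  assumes "test_function \<Omega> \<psi>"
  shows "\<psi> x \<noteq> 0 \<Longrightarrow> x \<in> \<Omega>" "x \<notin> \<Omega> \<Longrightarrow> frechet_derivative \<psi> (at x) = (\<lambda>v. 0)"
    "bounded {x. \<psi> x \<noteq> 0}"
proof -
  let ?S = "closure {x. \<psi> x \<noteq> 0}"
  have S: "?S \<subseteq> \<Omega>" "compact ?S" using assms by (auto simp: test_function_def)
  show "\<psi> x \<noteq> 0 \<Longrightarrow> x \<in> \<Omega>" using S closure_subset[of "{x. \<psi> x \<noteq> 0}"] by auto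
  show "bounded {x. \<psi> x \<noteq> 0}" using compact_imp_bounded[OF S(2)] closure_subset bounded_subset by metis
  assume "x \<notin> \<Omega>"
  then have x: "x \<in> - ?S" using S by auto
  have "((\<lambda>x. 0) has_derivative (\<lambda>v. 0)) (at x)" by simp
  then have "(\<psi> has_derivative (\<lambda>v. 0)) (at x)"
    by (rule has_derivative_transform_within_open[of _ _ _ _ "- ?S"])
       (use x closure_subset[of "{x. \<psi> x \<noteq> 0}"] in auto)
  then show "frechet_derivative \<psi> (at x) = (\<lambda>v. 0)" by (rule frechet_derivative_at[symmetric])
qed

lemma continuous_vanishing_bounded:
  fixes f :: "'a::euclidean_space \<Rightarrow> 'b::real_normed_vector"
  assumes "continuous_on UNIV f" "bounded \<Omega>" "\<And>x. x \<notin> \<Omega> \<Longrightarrow> f x = 0"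
  shows "\<exists>C\<ge>0. \<forall>x. norm (f x) \<le> C"
proof -
  have "compact (f ` closure \<Omega>)"
    by (intro compact_continuous_image continuous_on_subset[OF assms(1)]) (use assms(2) in \<open>auto simp: compact_closure\<close>)
  then have "bounded (f ` closure \<Omega>)" by (rule compact_imp_bounded)
  then obtain C where C: "\<And>x. x \<in> closure \<Omega> \<Longrightarrow> norm (f x) \<le> C" by (auto simp: bounded_iff)
  have "norm (f x) \<le> max C 0" for x
    using C[of x] assms(3)[of x] closure_subset[of \<Omega>] by (cases "x \<in> \<Omega>") auto
  then show ?thesis by (intro exI[of _ "max C 0"]) auto
qed

text \<open>Translates the integrals over \<open>\<Omega>\<close> in the function-space definitions
  into the integrals over a cube in which the line-integral estimates are phrased.\<close>

lemma lebesgue_on_eq_cube_integral: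
  fixes f :: "'a::euclidean_space \<Rightarrow> real"
  assumes "continuous_on UNIV f" "\<Omega> \<in> sets lebesgue"
    and "\<And>x. x \<notin> \<Omega> \<Longrightarrow> f x = 0" "\<And>x. x \<notin> cube R \<Longrightarrow> f x = 0"
  shows "integrable (lebesgue_on \<Omega>) f" "(LINT x|lebesgue_on \<Omega>. f x) = integral (cube R) f"
proof -
  have eq: "(\<lambda>x. indicator \<Omega> x *\<^sub>R f x) = f" "(\<lambda>x. indicator (cube R) x *\<^sub>R f x) = f"
    using assms by (auto simp: indicator_def fun_eq_iff)
  have a: "set_integrable lebesgue (cube R) f"
    by (rule absolutely_integrable_continuous) (rule continuous_on_subset[OF assms(1)], simp)
  then have "integrable lebesgue f" by (simp only: set_integrable_def eq)
  then show "integrable (lebesgue_on \<Omega>) f" using assms(2) by (simp add: integrable_restrict_space eq[simplified])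
  show "(LINT x|lebesgue_on \<Omega>. f x) = integral (cube R) f"
    using set_lebesgue_integral_eq_integral(2)[OF a] assms(2)
    by (simp only: set_lebesgue_integral_def eq) (simp add: integral_restrict_space eq[simplified])
qed

text \<open>Integrating first in direction \<open>b\<close> gives zero by the fundamental theorem of
  calculus, as \<open>F\<close> vanishes on both faces.\<close>

lemma integral_derivative_zero:
  fixes F :: "'a::euclidean_space \<Rightarrow> real"
  assumes d: "\<And>x. (F has_derivative F' x) (at x)" and b: "b \<in> Basis"
    and c: "continuous_on UNIV (\<lambda>x. F' x b)"
    and supp: "\<And>x. F x \<noteq> 0 \<Longrightarrow> \<bar>x \<bullet> b\<bar> < R" and R: "R > 0"
  shows "integral (cube R) (\<lambda>x. F' x b) = 0"
proof -
  obtain bs where bs: "set bs = (Basis :: 'a set) - {b}" "distinct bs"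
    using finite_distinct_list[of "Basis - {b} :: 'a set"] by auto
  let ?bs = "b # bs"
  have Bs: "distinct ?bs" "set ?bs = Basis" using bs b by auto
  \<comment> \<open>\<open>margs_Basis\<close> applies to nonnegative functions only, so it is used
    for \<open>?f + ?g\<close> and for \<open>?g\<close>; \<open>?f\<close> is recovered as their
    difference.\<close>
  let ?f = "\<lambda>x. F' x b" and ?g = "\<lambda>x. \<bar>F' x b\<bar>"
  have cg: "continuous_on UNIV ?g" "continuous_on UNIV (\<lambda>x. ?f x + ?g x)" using c by (auto intro: continuous_intros)
  have "marg R b ?f x = 0" for x
  proof -
    let ?l = "\<lambda>s. x + (s - x \<bullet> b) *\<^sub>R b"
    have "((\<lambda>s. F (?l s)) has_vector_derivative F' (?l s) b) (at s)" for s
    proof -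
      have "(?l has_derivative (\<lambda>h. h *\<^sub>R b)) (at s)" by (auto intro!: derivative_eq_intros)
      from has_derivative_compose[OF this d]
      have "((\<lambda>s. F (?l s)) has_derivative (\<lambda>h. F' (?l s) (h *\<^sub>R b))) (at s)" .
      moreover have "F' (?l s) (h *\<^sub>R b) = h *\<^sub>R F' (?l s) b" for h
        using linear_scale[OF has_derivative_linear[OF d]] by simp
      ultimately show ?thesis by (simp add: has_vector_derivative_def)
    qed
    then have "((\<lambda>s. F' (?l s) b) has_integral F (?l R) - F (?l (-R))) {-R..R}"
      using R by (intro fundamental_theorem_of_calculus) (auto intro: has_vector_derivative_at_within)
    moreover have "F (?l r) = 0" if "\<bar>r\<bar> = R" for r
    proof (rule ccontr)
      assume "F (?l r) \<noteq> 0"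
      from supp[OF this] show False using b that by (simp add: inner_add_left inner_same_Basis)
    qed
    ultimately show ?thesis using R by (simp add: marg_def integral_unique)
  qed
  moreover have "marg R b (\<lambda>x. ?f x + ?g x) x = marg R b ?f x + marg R b ?g x" for x
    unfolding marg_def by (rule Henstock_Kurzweil_Integration.integral_add)
      (rule line_integrable[OF c], rule line_integrable[OF cg(1)])
  ultimately have "marg R b (\<lambda>x. ?f x + ?g x) = marg R b ?g" by auto
  then have "margs R ?bs (\<lambda>x. ?f x + ?g x) 0 = margs R ?bs ?g 0" by simp
  then have "integral (cube R) (\<lambda>x. ?f x + ?g x) = integral (cube R) ?g"
    using margs_Basis[OF Bs cg(2), of R 0] margs_Basis[OF Bs cg(1), of R 0] by simp
  moreover have "integral (cube R) (\<lambda>x. ?f x + ?g x) = integral (cube R) ?f + integral (cube R) ?g"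
    by (rule Henstock_Kurzweil_Integration.integral_add; intro integrable_continuous continuous_on_subset[OF c] continuous_on_subset[OF cg(1)] subset_UNIV)
  ultimately show ?thesis by simp
qed

text \<open>Bumps converge boundedly to the indicator of a box, so the integral of \<open>f\<close>
  over every box inside \<open>\<Omega>\<close> vanishes. Lebesgue differentiation over small cubes
  with corner at \<open>x\<close> then gives \<open>f x = 0\<close> off a null set.\<close>

lemma AE_zero_of_test_functions:
  fixes f :: "'a::euclidean_space \<Rightarrow> real"
  assumes \<Omega>: "open \<Omega>" and f: "integrable (lebesgue_on \<Omega>) f"
    and zero: "\<And>\<psi>. test_function \<Omega> \<psi> \<Longrightarrow> (LINT x|lebesgue_on \<Omega>. f x * \<psi> x) = 0"
  shows "AE x in lebesgue_on \<Omega>. f x = 0"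
proof -
  have [measurable]: "\<Omega> \<in> sets lebesgue" using \<Omega> by auto
  have [measurable]: "f \<in> borel_measurable (lebesgue_on \<Omega>)" using f by auto
  let ?f = "\<lambda>x. indicator \<Omega> x *\<^sub>R f x"
  have fi: "integrable lebesgue ?f" using f by (simp add: integrable_restrict_space)
  have si: "set_integrable lebesgue S ?f" if "S \<in> sets lebesgue" for S
    using integrable_mult_indicator[OF that fi] by (simp add: set_integrable_def)
  have int: "?f integrable_on cbox a b" for a b
    by (rule set_lebesgue_integral_eq_integral(1)[OF si]) auto
  have box0: "integral (cbox a b) ?f = 0" if ab: "cbox a b \<subseteq> \<Omega>" "box a b \<noteq> {}" for a b
  proof -
    have "(\<lambda>n. LINT x|lebesgue_on \<Omega>. f x * bump a b (real (Suc n)) x) \<longlonglongrightarrow> (LINT x|lebesgue_on \<Omega>. f x * indicator (box a b) x)"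
    proof (rule integral_dominated_convergence[where w = "\<lambda>x. \<bar>f x\<bar>"])
      show "(\<lambda>x. f x * bump a b (real (Suc n)) x) \<in> borel_measurable (lebesgue_on \<Omega>)" for n
      proof -
        have "continuous_on \<Omega> (bump a b (real (Suc n)))"
          using test_function_derivative(3)[OF bump_test[OF _ ab(2,1)]] continuous_on_subset by (metis of_nat_0_less_iff subset_UNIV zero_less_Suc)
        then have "bump a b (real (Suc n)) \<in> borel_measurable (lebesgue_on \<Omega>)"
          by (rule continuous_imp_measurable_on_sets_lebesgue) simp
        then show ?thesis by measurable
      qed
      show "AE x in lebesgue_on \<Omega>. norm (f x * bump a b (real (Suc n)) x) \<le> \<bar>f x\<bar>" for n
        using bump_bounds[of a b "real (Suc n)"] by (auto simp: abs_mult intro!: mult_left_le)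
      show "AE x in lebesgue_on \<Omega>. (\<lambda>n. f x * bump a b (real (Suc n)) x) \<longlonglongrightarrow> f x * indicator (box a b) x"
        by (intro AE_I2 tendsto_mult tendsto_const bump_tendsto)
      have "indicator (box a b) \<in> borel_measurable (lebesgue_on \<Omega>)"
        by (rule measurable_restrict_space1, rule borel_measurable_indicator) simp
      then show "(\<lambda>x. f x * indicator (box a b) x) \<in> borel_measurable (lebesgue_on \<Omega>)" by measurable
    qed (use f in auto)
    then have "(LINT x|lebesgue_on \<Omega>. f x * indicator (box a b) x) = 0"
      using zero[OF bump_test[OF _ ab(2,1)]] by (simp add: LIMSEQ_const_iff)
    moreover have "(LINT x|lebesgue_on \<Omega>. f x * indicator (box a b) x) = (LINT x:box a b|lebesgue. ?f x)"
      by (subst integral_restrict_space) (auto simp: set_lebesgue_integral_def mult_ac)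
    ultimately have "integral (box a b) ?f = 0"
      using set_lebesgue_integral_eq_integral(2)[OF si, of "box a b"] by simp
    then show ?thesis by (simp add: integral_open_interval)
  qed
  obtain N where N: "negligible N"
    "\<And>x e. \<lbrakk>x \<notin> N; 0 < e\<rbrakk> \<Longrightarrow> \<exists>d>0. \<forall>h. 0 < h \<and> h < d \<longrightarrow>
        norm (integral (cbox x (x + h *\<^sub>R One)) ?f /\<^sub>R h ^ DIM('a) - ?f x) < e"
    by (rule integrable_ccontinuous_explicit[OF int], rule that)
  have z: "f x = 0" if x: "x \<in> \<Omega>" "x \<notin> N" for x
  proof (rule ccontr)
    assume "f x \<noteq> 0"
    then obtain d where d: "d > 0" "\<And>h. 0 < h \<Longrightarrow> h < d \<Longrightarrow>
        norm (integral (cbox x (x + h *\<^sub>R One)) ?f /\<^sub>R h ^ DIM('a) - ?f x) < \<bar>f x\<bar>"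
      using N(2)[OF x(2), of "\<bar>f x\<bar>"] by auto
    obtain e where e: "e > 0" "cball x e \<subseteq> \<Omega>" using open_contains_cball x \<Omega> by blast
    define h where "h = min (d / 2) (e / DIM('a))"
    have h: "h > 0" "h < d" "h * DIM('a) \<le> e" using d e by (auto simp: h_def min_def field_simps)
    have sub: "cbox x (x + h *\<^sub>R One) \<subseteq> cball x e"
    proof
      fix y assume y: "y \<in> cbox x (x + h *\<^sub>R One)"
      have "norm (y - x) \<le> (\<Sum>b\<in>Basis. \<bar>(y - x) \<bullet> b\<bar>)" by (rule norm_le_l1)
      also have "\<dots> \<le> (\<Sum>b\<in>(Basis::'a set). h)"
        using y by (intro sum_mono) (auto simp: mem_box inner_diff_left inner_add_left)
      finally show "y \<in> cball x e" using h by (simp add: dist_norm norm_minus_commute mult.commute)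
    qed
    have "box x (x + h *\<^sub>R One) \<noteq> {}" using h by (simp add: box_ne_empty inner_add_left)
    then have "integral (cbox x (x + h *\<^sub>R One)) ?f = 0" using sub e by (intro box0) auto
    then show False using d(2)[OF h(1,2)] x by simp
  qed
  show ?thesis
  proof (rule AE_I')
    show "N \<inter> \<Omega> \<in> null_sets (lebesgue_on \<Omega>)"
      using N(1) by (subst null_sets_restrict_space) (auto simp: negligible_iff_null_sets intro: null_set_Int1 null_set_Int2)
    show "{x \<in> space (lebesgue_on \<Omega>). f x \<noteq> 0} \<subseteq> N \<inter> \<Omega>" using z by (auto simp: space_restrict_space)
  qed
qed

section \<open>Lebesgue spaces and the damping term\<close>

text \<open>The \<open>q\<close>-th power of the norm lets pointwise inequalities be integrated
  directly. For convergence questions the quasi-triangle inequality with factor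
  \<open>2 powr q\<close> suffices.\<close>

definition modular :: "'a::euclidean_space set \<Rightarrow> real \<Rightarrow> ('a \<Rightarrow> 'b::euclidean_space) \<Rightarrow> real" where
  "modular \<Omega> q f = (LINT x|lebesgue_on \<Omega>. norm (f x) powr q)"

lemma modular_nonneg: "modular \<Omega> q f \<ge> 0"
  unfolding modular_def by (rule integral_nonneg_AE) simp

lemma Lq_norm_modular: "Lq_norm \<Omega> q f = modular \<Omega> q f powr (1 / q)"
  by (simp add: Lq_norm_def modular_def)

lemma modular_Lq_norm: "q > 0 \<Longrightarrow> modular \<Omega> q f = Lq_norm \<Omega> q f powr q"
  by (simp add: Lq_norm_modular powr_powr modular_nonneg)

lemma Lq_norm_2_square: "(Lq_norm \<Omega> 2 f)\<^sup>2 = modular \<Omega> 2 f"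
  using modular_Lq_norm[of 2 \<Omega> f] by (simp add: Lq_norm_modular)

lemma LqD:
  assumes "f \<in> Lq \<Omega> q"
  shows "f \<in> borel_measurable (lebesgue_on \<Omega>)" "integrable (lebesgue_on \<Omega>) (\<lambda>x. norm (f x) powr q)"
  using assms by (auto simp: Lq_def)

lemma modular_tendsto_0:
  assumes "q > 0" "((\<lambda>h. Lq_norm \<Omega> q (f h)) \<longlongrightarrow> 0) F"
  shows "((\<lambda>h. modular \<Omega> q (f h)) \<longlongrightarrow> 0) F"
proof -
  have "((\<lambda>h. Lq_norm \<Omega> q (f h) powr q) \<longlongrightarrow> 0 powr q) F"
    by (rule tendsto_powr'[OF assms(2) tendsto_const]) (use assms(1) in \<open>auto simp: Lq_norm_modular\<close>)
  then show ?thesis using assms(1) by (simp add: modular_Lq_norm)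
qed

lemma norm_add_powr_le:
  fixes a b :: "'b::real_normed_vector"
  assumes "q > 0"
  shows "norm (a + b) powr q \<le> 2 powr q * (norm a powr q + norm b powr q)"
proof -
  have "norm (a + b) powr q \<le> (2 * max (norm a) (norm b)) powr q"
    using assms norm_triangle_ineq[of a b] by (intro powr_mono2) auto
  also have "\<dots> = 2 powr q * max (norm a) (norm b) powr q"
    by (simp add: powr_mult max_def)
  also have "\<dots> \<le> 2 powr q * (norm a powr q + norm b powr q)"
    by (intro mult_left_mono) (auto simp: max_def)
  finally show ?thesis .
qed

lemma Lq_add:
  assumes "f \<in> Lq \<Omega> q" "h \<in> Lq \<Omega> q" "q > 0"
  shows "(\<lambda>x. f x + h x) \<in> Lq \<Omega> q"
    and "modular \<Omega> q (\<lambda>x. f x + h x) \<le> 2 powr q * (modular \<Omega> q f + modular \<Omega> q h)"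
proof -
  note [measurable] = LqD(1)[OF assms(1)] LqD(1)[OF assms(2)]
  have i: "integrable (lebesgue_on \<Omega>) (\<lambda>x. 2 powr q * (norm (f x) powr q + norm (h x) powr q))"
    using LqD(2)[OF assms(1)] LqD(2)[OF assms(2)] by simp
  have j: "integrable (lebesgue_on \<Omega>) (\<lambda>x. norm (f x + h x) powr q)"
    by (rule Bochner_Integration.integrable_bound[OF i])
       (auto intro!: order_trans[OF norm_add_powr_le[OF assms(3)]])
  then show "(\<lambda>x. f x + h x) \<in> Lq \<Omega> q" by (simp add: Lq_def)
  show "modular \<Omega> q (\<lambda>x. f x + h x) \<le> 2 powr q * (modular \<Omega> q f + modular \<Omega> q h)"
    using integral_mono[OF j i norm_add_powr_le[OF assms(3)]] LqD(2)[OF assms(1)] LqD(2)[OF assms(2)]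
    by (simp add: modular_def)
qed

lemma Lq_scale:
  assumes "f \<in> Lq \<Omega> q"
  shows "(\<lambda>x. c *\<^sub>R f x) \<in> Lq \<Omega> q" "modular \<Omega> q (\<lambda>x. c *\<^sub>R f x) = \<bar>c\<bar> powr q * modular \<Omega> q f"
proof -
  note [measurable] = LqD(1)[OF assms]
  show "(\<lambda>x. c *\<^sub>R f x) \<in> Lq \<Omega> q" "modular \<Omega> q (\<lambda>x. c *\<^sub>R f x) = \<bar>c\<bar> powr q * modular \<Omega> q f"
    using LqD(2)[OF assms] by (simp_all add: Lq_def powr_mult modular_def)
qed

lemma Lq_diff:
  assumes "f \<in> Lq \<Omega> q" "h \<in> Lq \<Omega> q" "q > 0"
  shows "(\<lambda>x. f x - h x) \<in> Lq \<Omega> q"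
  using Lq_add(1)[OF assms(1) Lq_scale(1)[OF assms(2), of "-1"] assms(3)] by simp

text \<open>The exponents \<open>1\<close>, \<open>m - 2\<close> and \<open>1\<close> add up to
  \<open>m\<close>, so the product is at most the \<open>m\<close>-th power of the largest
  factor.\<close>

lemma trilinear_pointwise:
  fixes x y z m :: real
  assumes "x \<ge> 0" "y \<ge> 0" "z \<ge> 0" "m \<ge> 2"
  shows "x * y powr (m - 2) * z \<le> x powr m + y powr m + z powr m"
proof -
  define w where "w = max x (max y z)"
  show ?thesis
  proof (cases "w = 0")
    case True
    then have "x = 0" using assms by (auto simp: w_def max_def split: if_splits)
    then show ?thesis by simp
  next
    case False
    then have w: "w > 0" "x \<le> w" "y \<le> w" "z \<le> w" using assms by (auto simp: w_def max_def split: if_splits)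
    have "x * y powr (m - 2) * z \<le> w * w powr (m - 2) * w"
      using assms w by (intro mult_mono powr_mono2) auto
    also have "\<dots> = w powr m"
    proof -
      have "w * w powr (m - 2) * w = w powr 1 * w powr (m - 2) * w powr 1" using w by simp
      also have "\<dots> = w powr m" by (simp only: powr_add[symmetric]) simp
      finally show ?thesis .
    qed
    also have "\<dots> \<le> x powr m + y powr m + z powr m" by (auto simp: w_def max_def)
    finally show ?thesis .
  qed
qed

lemma trilinear:
  fixes a :: "'a::euclidean_space \<Rightarrow> 'b::euclidean_space" and b :: "'a \<Rightarrow> 'c::euclidean_space"
    and c :: "'a \<Rightarrow> 'd::euclidean_space"
  assumes "a \<in> Lq \<Omega> m" "b \<in> Lq \<Omega> m" "c \<in> Lq \<Omega> m" and m: "m \<ge> 2"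
  shows "integrable (lebesgue_on \<Omega>) (\<lambda>x. norm (a x) * norm (b x) powr (m - 2) * norm (c x))"
    and "(LINT x|lebesgue_on \<Omega>. norm (a x) * norm (b x) powr (m - 2) * norm (c x))
      \<le> modular \<Omega> m a + modular \<Omega> m b + modular \<Omega> m c"
proof -
  note [measurable] = LqD(1)[OF assms(1)] LqD(1)[OF assms(2)] LqD(1)[OF assms(3)]
  note i = LqD(2)[OF assms(1)] LqD(2)[OF assms(2)] LqD(2)[OF assms(3)]
  have s: "integrable (lebesgue_on \<Omega>) (\<lambda>x. norm (a x) powr m + norm (b x) powr m + norm (c x) powr m)"
    using i by simp
  show j: "integrable (lebesgue_on \<Omega>) (\<lambda>x. norm (a x) * norm (b x) powr (m - 2) * norm (c x))"
    by (rule Bochner_Integration.integrable_bound[OF s]) (auto intro!: AE_I2 trilinear_pointwise m)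
  show "(LINT x|lebesgue_on \<Omega>. norm (a x) * norm (b x) powr (m - 2) * norm (c x))
      \<le> modular \<Omega> m a + modular \<Omega> m b + modular \<Omega> m c"
    using integral_mono[OF j s trilinear_pointwise] m i by (simp add: modular_def)
qed

text \<open>Scaling substitutes for Hoelder's inequality: writing \<open>a h\<close> as
  \<open>d\<close> times \<open>a h / d\<close>, the integral is at most \<open>d\<close> times a
  sum of modulars, and the one of \<open>a h / d\<close> is eventually below 1.\<close>

lemma trilinear_small:
  fixes a :: "'i \<Rightarrow> 'a::euclidean_space \<Rightarrow> 'b::euclidean_space" and b :: "'i \<Rightarrow> 'a \<Rightarrow> 'c::euclidean_space"
    and c :: "'i \<Rightarrow> 'a \<Rightarrow> 'd::euclidean_space"
  assumes L: "eventually (\<lambda>h. a h \<in> Lq \<Omega> m \<and> b h \<in> Lq \<Omega> m \<and> c h \<in> Lq \<Omega> m) F" and m: "m \<ge> 2"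
    and a: "((\<lambda>h. modular \<Omega> m (a h)) \<longlongrightarrow> 0) F"
    and bc: "eventually (\<lambda>h. modular \<Omega> m (b h) \<le> C \<and> modular \<Omega> m (c h) \<le> C) F"
  shows "((\<lambda>h. LINT x|lebesgue_on \<Omega>. norm (a h x) * norm (b h x) powr (m - 2) * norm (c h x)) \<longlongrightarrow> 0) F"
    (is "(?I \<longlongrightarrow> 0) F")
proof (rule tendstoI)
  fix e :: real assume e: "e > 0"
  \<comment> \<open>So that \<open>d\<close> times the final bound
    \<open>1 + (\<bar>C\<bar> + \<bar>C\<bar>) + 1\<close> equals \<open>e\<close>.\<close>
  define d where "d = e / (2 * \<bar>C\<bar> + 2)"
  have d: "d > 0" using e by (simp add: d_def)
  have "eventually (\<lambda>h. modular \<Omega> m (a h) < d powr m) F"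
    using order_tendstoD(2)[OF a, of "d powr m"] d by simp
  with L bc show "eventually (\<lambda>h. dist (?I h) 0 < e) F"
  proof eventually_elim
    case (elim h)
    have s: "(\<lambda>x. (1 / d) *\<^sub>R a h x) \<in> Lq \<Omega> m"
      "modular \<Omega> m (\<lambda>x. (1 / d) *\<^sub>R a h x) = modular \<Omega> m (a h) / d powr m"
      using Lq_scale[of "a h" \<Omega> m "1 / d"] elim d by (auto simp: powr_divide)
    have eq: "norm (a h x) * norm (b h x) powr (m - 2) * norm (c h x)
      = d * (norm ((1 / d) *\<^sub>R a h x) * norm (b h x) powr (m - 2) * norm (c h x))" for x using d by simp
    have "?I h = d * (LINT x|lebesgue_on \<Omega>. norm ((1 / d) *\<^sub>R a h x) * norm (b h x) powr (m - 2) * norm (c h x))"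
      by (simp only: eq integral_mult_right_zero)
    also have "\<dots> \<le> d * (modular \<Omega> m (a h) / d powr m + modular \<Omega> m (b h) + modular \<Omega> m (c h))"
      using trilinear(2)[OF s(1)] elim m s(2) d by (intro mult_left_mono) auto
    also have "\<dots> < d * (1 + (\<bar>C\<bar> + \<bar>C\<bar>) + 1)"
    proof -
      have "modular \<Omega> m (a h) / d powr m < 1" using elim d by (simp add: divide_less_eq)
      moreover have "modular \<Omega> m (b h) \<le> \<bar>C\<bar>" "modular \<Omega> m (c h) \<le> \<bar>C\<bar>" using elim by auto
      ultimately have "modular \<Omega> m (a h) / d powr m + modular \<Omega> m (b h) + modular \<Omega> m (c h) < 1 + (\<bar>C\<bar> + \<bar>C\<bar>) + 1"
        by linarith
      then show ?thesis using d by (rule mult_strict_left_mono)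
    qed
    also have "\<dots> = e" by (simp add: d_def field_simps)
    finally have "?I h < e" .
    moreover have "?I h \<ge> 0" by (rule integral_nonneg_AE) simp
    ultimately show ?case by simp
  qed
qed

text \<open>For \<open>r \<ge> 1\<close> this is the mean value theorem. For \<open>r < 1\<close>
  the derivative of the power blows up at zero; the factor \<open>y\<close> compensates, and
  \<open>a / b \<le> (a / b) powr r\<close> for \<open>a < b\<close> replaces the
  derivative.\<close>

lemma abs_powr_diff_mult_le:
  fixes x y r :: real
  assumes "x \<ge> 0" "y \<ge> 0" "r \<ge> 0"
  shows "\<bar>x powr r - y powr r\<bar> * y \<le> (r + 1) * \<bar>x - y\<bar> * (x powr r + y powr r)"
proof (cases "x = 0 \<or> y = 0 \<or> r = 0")
  case True
  then show ?thesis using assms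
    by (auto simp: abs_if mult_nonneg_nonneg algebra_simps add_increasing split: if_splits)
next
  case False
  then have xy: "x > 0" "y > 0" "r > 0" using assms by auto
  have main: "\<bar>x powr r - y powr r\<bar> * y \<le> r * \<bar>x - y\<bar> * (x powr r + y powr r)" if "r \<ge> 1"
  proof -
    have mv: "b powr r - a powr r \<le> r * b powr (r - 1) * (b - a)" if "0 < a" "a < b" for a b :: real
    proof -
      have "\<exists>z>a. z < b \<and> b powr r - a powr r = (b - a) * (r * z powr (r - 1))"
        by (rule MVT2) (use that in \<open>auto intro!: has_real_derivative_powr\<close>)
      then obtain z where z: "a < z" "z < b" "b powr r - a powr r = (b - a) * (r * z powr (r - 1))"
        by blast
      have "z powr (r - 1) \<le> b powr (r - 1)" using z that \<open>r \<ge> 1\<close> by (intro powr_mono2) auto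
      then show ?thesis using z that xy by (simp add: mult_left_mono mult.commute)
    qed
    consider "x < y" | "y < x" | "x = y" by linarith
    then show ?thesis
    proof cases
      case 1
      have "\<bar>x powr r - y powr r\<bar> * y \<le> (r * y powr (r - 1) * (y - x)) * y"
        using mv[of x y] xy 1 powr_mono2[of r x y] by (intro mult_right_mono) auto
      also have "\<dots> = r * \<bar>x - y\<bar> * (y powr r)" using 1 xy by (simp add: powr_diff)
      also have "\<dots> \<le> r * \<bar>x - y\<bar> * (x powr r + y powr r)" using xy by (intro mult_left_mono) auto
      finally show ?thesis .
    next
      case 2
      have "\<bar>x powr r - y powr r\<bar> * y \<le> (r * x powr (r - 1) * (x - y)) * x"
        using mv[of y x] xy 2 powr_mono2[of r y x] by (intro mult_mono) auto
      also have "\<dots> = r * \<bar>x - y\<bar> * (x powr r)" using 2 xy by (simp add: powr_diff)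
      also have "\<dots> \<le> r * \<bar>x - y\<bar> * (x powr r + y powr r)" using xy by (intro mult_left_mono) auto
      finally show ?thesis .
    qed auto
  qed
  have main1: "\<bar>x powr r - y powr r\<bar> * y \<le> \<bar>x - y\<bar> * (x powr r + y powr r)" if "r < 1"
  proof -
    have conc: "b powr r - a powr r \<le> b powr r / b * (b - a)" if "0 < a" "a < b" for a b :: real
    proof -
      have "(a / b) powr 1 \<le> (a / b) powr r" using that \<open>r < 1\<close> by (intro powr_mono') auto
      then have "a / b \<le> a powr r / b powr r" using that by (simp add: powr_divide)
      then have "b powr r * (a / b) \<le> b powr r * (a powr r / b powr r)" by (intro mult_left_mono) auto
      then have 1: "b powr r * (a / b) \<le> a powr r" using that by simp
      have 2: "b powr r / b * (b - a) = b powr r - b powr r * (a / b)" using that by (simp add: field_simps)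
      show ?thesis unfolding 2 using 1 by simp
    qed
    consider "x < y" | "y < x" | "x = y" by linarith
    then show ?thesis
    proof cases
      case 1
      have "\<bar>x powr r - y powr r\<bar> * y \<le> (y powr r / y * (y - x)) * y"
        using conc[of x y] xy 1 powr_mono2[of r x y] by (intro mult_right_mono) auto
      also have "\<dots> = \<bar>x - y\<bar> * (y powr r)" using 1 xy by simp
      also have "\<dots> \<le> \<bar>x - y\<bar> * (x powr r + y powr r)" by (intro mult_left_mono) auto
      finally show ?thesis .
    next
      case 2
      have "\<bar>x powr r - y powr r\<bar> * y \<le> (x powr r / x * (x - y)) * x"
        using conc[of y x] xy 2 powr_mono2[of r y x] by (intro mult_mono) auto
      also have "\<dots> = \<bar>x - y\<bar> * (x powr r)" using 2 xy by simp
      also have "\<dots> \<le> \<bar>x - y\<bar> * (x powr r + y powr r)" by (intro mult_left_mono) auto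
      finally show ?thesis .
    qed auto
  qed
  let ?Z = "\<bar>x - y\<bar> * (x powr r + y powr r)"
  have Z: "?Z \<ge> 0" by simp
  have "r * ?Z \<ge> 0" using xy by simp
  then have "\<bar>x powr r - y powr r\<bar> * y \<le> r * ?Z + ?Z"
  proof (cases "r \<ge> 1")
    case True
    from main[OF True] have "\<bar>x powr r - y powr r\<bar> * y \<le> r * ?Z" by (simp only: mult.assoc)
    then show ?thesis by (rule add_increasing2[OF Z])
  next
    case False
    then have "r < 1" by simp
    from main1[OF this] show ?thesis by (rule add_increasing[OF \<open>r * ?Z \<ge> 0\<close>])
  qed
  then show ?thesis by (simp add: algebra_simps)
qed

text \<open>The damping nonlinearity. For \<open>m = 2\<close> the convention about
  \<open>0 powr 0\<close> does not matter, since the scalar multiplies \<open>v\<close>.\<close>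

definition power_map :: "real \<Rightarrow> 'b::euclidean_space \<Rightarrow> 'b" where
  "power_map m v = norm v powr (m - 2) *\<^sub>R v"

lemma power_map_diff_le:
  fixes v w :: "'b::euclidean_space"
  assumes "m \<ge> 2"
  shows "norm (power_map m v - power_map m w) \<le> m * (norm (v - w) * norm v powr (m - 2) + norm (v - w) * norm w powr (m - 2))"
proof -
  let ?r = "m - 2"
  let ?D = "norm (v - w)" and ?S = "norm v powr ?r + norm w powr ?r"
  have "power_map m v - power_map m w = norm v powr ?r *\<^sub>R (v - w) + (norm v powr ?r - norm w powr ?r) *\<^sub>R w"
    by (simp add: power_map_def algebra_simps)
  then have "norm (power_map m v - power_map m w) \<le> norm v powr ?r * ?D + \<bar>norm v powr ?r - norm w powr ?r\<bar> * norm w"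
    using norm_triangle_ineq[of "norm v powr ?r *\<^sub>R (v - w)" "(norm v powr ?r - norm w powr ?r) *\<^sub>R w"] by simp
  also have "\<bar>norm v powr ?r - norm w powr ?r\<bar> * norm w \<le> (?r + 1) * \<bar>norm v - norm w\<bar> * ?S"
    by (rule abs_powr_diff_mult_le) (use assms in auto)
  also have "\<dots> \<le> (?r + 1) * ?D * ?S"
    using assms norm_triangle_ineq3[of v w] by (intro mult_right_mono mult_left_mono) auto
  also have "norm v powr ?r * ?D \<le> ?D * ?S"
  proof -
    have "?D * norm v powr ?r \<le> ?D * ?S" by (intro mult_left_mono) auto
    then show ?thesis by (simp add: mult.commute)
  qed
  finally have "norm (power_map m v - power_map m w) \<le> ?D * ?S + (?r + 1) * ?D * ?S" by simp
  also have "\<dots> = m * (?D * norm v powr ?r + ?D * norm w powr ?r)" by (simp add: algebra_simps)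
  finally show ?thesis .
qed

lemma norm_power_map: "norm (power_map m v) = norm v * norm v powr (m - 2)"
  by (simp add: power_map_def)

lemma power_map_measurable [measurable]: "power_map m \<in> borel_measurable borel"
  unfolding power_map_def[abs_def] by measurable

lemma norm_matrix_vector_le:
  fixes A :: "real^'n^'n"
  shows "norm (A *v v) \<le> norm A * norm v"
proof -
  have "norm (A *v v) = L2_set (\<lambda>i. (A *v v) $ i) UNIV" by (simp add: norm_vec_def L2_set_def)
  also have "\<dots> \<le> L2_set (\<lambda>i. norm (A $ i) * norm v) UNIV"
  proof -
    have "(\<Sum>i\<in>UNIV. ((A *v v) $ i)\<^sup>2) \<le> (\<Sum>i\<in>UNIV. (norm (A $ i) * norm v)\<^sup>2)"
    proof (rule sum_mono)
      fix i
      have "\<bar>(A *v v) $ i\<bar> \<le> norm (A $ i) * norm v"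
        by (simp add: matrix_mult_dot Cauchy_Schwarz_ineq2)
      then show "((A *v v) $ i)\<^sup>2 \<le> (norm (A $ i) * norm v)\<^sup>2" by (simp add: abs_le_square_iff[symmetric] abs_mult)
    qed
    then show ?thesis unfolding L2_set_def by (rule real_sqrt_le_mono)
  qed
  also have "\<dots> = norm A * norm v"
    by (simp add: L2_set_left_distrib norm_vec_def[of A])
  finally show ?thesis .
qed

definition pairing :: "(real^'n) set \<Rightarrow> real \<Rightarrow> real^'n^'n \<Rightarrow> (real^'n \<Rightarrow> real^'n) \<Rightarrow> (real^'n \<Rightarrow> real^'n) \<Rightarrow> real" where
  "pairing \<Omega> m B a b = (LINT x|lebesgue_on \<Omega>. (B *v power_map m (a x)) \<bullet> b x)"

lemma mv_measurable [measurable]: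
  "f \<in> borel_measurable M \<Longrightarrow> (\<lambda>x. (B :: real^'n^'n) *v f x) \<in> borel_measurable M"
  by (rule borel_measurable_continuous_on[of "(*v) B"]) (auto intro: matrix_vector_mult_linear_continuous_on)

lemma pairing_pointwise:
  fixes B :: "real^'n^'n"
  shows "\<bar>(B *v power_map m v) \<bullet> w\<bar> \<le> norm B * (norm v * norm v powr (m - 2) * norm w)"
proof -
  have "\<bar>(B *v power_map m v) \<bullet> w\<bar> \<le> norm (B *v power_map m v) * norm w" by (rule Cauchy_Schwarz_ineq2)
  also have "\<dots> \<le> norm B * norm (power_map m v) * norm w" by (intro mult_right_mono norm_matrix_vector_le) auto
  finally show ?thesis by (simp add: norm_power_map mult.assoc)
qed

lemma pairing_integrable:
  fixes B :: "real^'n^'n"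
  assumes "a \<in> Lq \<Omega> m" "b \<in> Lq \<Omega> m" "m \<ge> 2"
  shows "integrable (lebesgue_on \<Omega>) (\<lambda>x. (B *v power_map m (a x)) \<bullet> b x)"
proof -
  note [measurable] = LqD(1)[OF assms(1)] LqD(1)[OF assms(2)]
  have "integrable (lebesgue_on \<Omega>) (\<lambda>x. norm B * (norm (a x) * norm (a x) powr (m - 2) * norm (b x)))"
    using trilinear(1)[OF assms(1,1,2,3)] by simp
  then show ?thesis
    by (rule Bochner_Integration.integrable_bound) (auto intro!: AE_I2 pairing_pointwise order_trans[OF pairing_pointwise])
qed

lemma pairing_scale: "pairing \<Omega> m B a (\<lambda>x. c *\<^sub>R b x) = c * pairing \<Omega> m B a b"
  unfolding pairing_def by simp

lemma pairing_diff:
  assumes "a \<in> Lq \<Omega> m" "b \<in> Lq \<Omega> m" "b' \<in> Lq \<Omega> m" "m \<ge> 2"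
  shows "pairing \<Omega> m B a (\<lambda>x. b x - b' x) = pairing \<Omega> m B a b - pairing \<Omega> m B a b'"
  unfolding pairing_def
  using pairing_integrable[OF assms(1,2,4), of B] pairing_integrable[OF assms(1,3,4), of B]
  by (simp add: inner_diff_right)

text \<open>Pointwise, either \<open>\<mu> * y \<le> x\<close> and a factor \<open>y\<close> is
  replaced by \<open>x / \<mu>\<close>, or \<open>x\<close> is replaced by \<open>\<mu> * y\<close>.
  The free \<open>\<mu>\<close> later makes the contribution of the second function small.\<close>

lemma pairing_bound:
  fixes a b :: "real^'n \<Rightarrow> real^'n"
  assumes "a \<in> Lq \<Omega> m" "b \<in> Lq \<Omega> m" "m \<ge> 2" "\<mu> > 0"
  shows "\<bar>pairing \<Omega> m B a b\<bar> \<le> norm B * (modular \<Omega> m a / \<mu> + \<mu> powr (m - 1) * modular \<Omega> m b)"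
proof -
  have pw: "x * x powr (m - 2) * y \<le> x powr m / \<mu> + \<mu> powr (m - 1) * y powr m" if "x \<ge> 0" "y \<ge> 0" for x y :: real
  proof (cases "x = 0 \<or> y = 0")
    case False
    then have xy: "x > 0" "y > 0" using that by auto
    have e: "z * z powr (m - 2) = z powr (m - 1)" if "z > 0" for z
    proof -
      have "z * z powr (m - 2) = z powr 1 * z powr (m - 2)" using that by simp
      also have "\<dots> = z powr (m - 1)" by (simp only: powr_add[symmetric]) simp
      finally show ?thesis .
    qed
    have e2: "z powr (m - 1) * z = z powr m" if "z > 0" for z
    proof -
      have "z powr (m - 1) * z = z powr (m - 1) * z powr 1" using that by simp
      also have "\<dots> = z powr m" by (simp only: powr_add[symmetric]) simp
      finally show ?thesis .
    qed
    show ?thesis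
    proof (cases "\<mu> * y \<le> x")
      case True
      have "x powr (m - 1) * y \<le> x powr (m - 1) * (x / \<mu>)"
        using True assms(4) by (intro mult_left_mono) (auto simp: field_simps)
      also have "\<dots> = x powr m / \<mu>" using e2[OF xy(1)] by simp
      also have "\<dots> \<le> x powr m / \<mu> + \<mu> powr (m - 1) * y powr m" by simp
      finally show ?thesis by (simp add: e xy)
    next
      case False
      have "x powr (m - 1) * y \<le> (\<mu> * y) powr (m - 1) * y"
        using False xy assms by (intro mult_right_mono powr_mono2) auto
      also have "\<dots> = \<mu> powr (m - 1) * y powr m" using e2[OF xy(2)] xy assms(4) by (simp add: powr_mult)
      also have "\<dots> \<le> x powr m / \<mu> + \<mu> powr (m - 1) * y powr m" using assms(4) by simp
      finally show ?thesis by (simp add: e xy)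
    qed
  qed (use assms in auto)
  note i = LqD(2)[OF assms(1)] LqD(2)[OF assms(2)]
  have "\<bar>pairing \<Omega> m B a b\<bar> \<le> (LINT x|lebesgue_on \<Omega>. \<bar>(B *v power_map m (a x)) \<bullet> b x\<bar>)"
    unfolding pairing_def by (rule integral_abs_bound)
  also have "\<dots> \<le> (LINT x|lebesgue_on \<Omega>. norm B * (norm (a x) powr m / \<mu> + \<mu> powr (m - 1) * norm (b x) powr m))"
  proof (rule integral_mono)
    show "integrable (lebesgue_on \<Omega>) (\<lambda>x. \<bar>(B *v power_map m (a x)) \<bullet> b x\<bar>)"
      using pairing_integrable[OF assms(1-3)] by (rule integrable_abs)
    show "\<bar>(B *v power_map m (a x)) \<bullet> b x\<bar> \<le> norm B * (norm (a x) powr m / \<mu> + \<mu> powr (m - 1) * norm (b x) powr m)" for x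
      by (rule order_trans[OF pairing_pointwise mult_left_mono[OF pw]]) auto
  qed (use i in auto)
  also have "\<dots> = norm B * (modular \<Omega> m a / \<mu> + \<mu> powr (m - 1) * modular \<Omega> m b)"
    using i by (simp add: modular_def)
  finally show ?thesis .
qed

text \<open>The three arguments are exchanged one at a time. Each difference contains a factor with
  vanishing modular (or a small matrix) next to factors with bounded modular, so
  \<open>trilinear_small\<close> applies.\<close>

lemma pairing_tendsto:
  fixes a :: "real \<Rightarrow> real^'n \<Rightarrow> real^'n"
  assumes m: "m \<ge> 2"
    and L: "eventually (\<lambda>h. a h \<in> Lq \<Omega> m \<and> b h \<in> Lq \<Omega> m) F" "a0 \<in> Lq \<Omega> m" "b0 \<in> Lq \<Omega> m"
    and B: "(B \<longlongrightarrow> B0) F"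
    and a: "((\<lambda>h. modular \<Omega> m (\<lambda>x. a h x - a0 x)) \<longlongrightarrow> 0) F"
    and b: "((\<lambda>h. modular \<Omega> m (\<lambda>x. b h x - b0 x)) \<longlongrightarrow> 0) F"
  shows "((\<lambda>h. pairing \<Omega> m (B h) (a h) (b h)) \<longlongrightarrow> pairing \<Omega> m B0 a0 b0) F"
proof -
  let ?M = "lebesgue_on \<Omega>"
  let ?m = "modular \<Omega> m"
  \<comment> \<open>One bound serving all functions involved: members of the families within modular
    distance 1 of their limits, and the limits themselves.\<close>
  define C where "C = 2 powr m * (1 + ?m a0) + 2 powr m * (1 + ?m b0) + ?m a0 + ?m b0"
  have bdd: "?m f \<le> 2 powr m * (1 + ?m f0)" if "f \<in> Lq \<Omega> m" "f0 \<in> Lq \<Omega> m" "?m (\<lambda>x. f x - f0 x) < 1"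
    for f f0 :: "real^'n \<Rightarrow> real^'n"
  proof -
    have "?m (\<lambda>x. (f x - f0 x) + f0 x) \<le> 2 powr m * (?m (\<lambda>x. f x - f0 x) + ?m f0)"
      using m by (intro Lq_add(2) Lq_diff that) auto
    also have "\<dots> \<le> 2 powr m * (1 + ?m f0)" using that by (intro mult_left_mono) auto
    finally show ?thesis by simp
  qed
  have C0: "?m a0 \<le> C" "?m b0 \<le> C" "2 powr m * (1 + ?m a0) \<le> C" "2 powr m * (1 + ?m b0) \<le> C"
    using modular_nonneg[of \<Omega> m a0] modular_nonneg[of \<Omega> m b0] by (auto simp: C_def add_increasing add_increasing2)
  have ev: "eventually (\<lambda>h. a h \<in> Lq \<Omega> m \<and> b h \<in> Lq \<Omega> m \<and> ?m (a h) \<le> C \<and> ?m (b h) \<le> C) F"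
    using L(1) order_tendstoD(2)[OF a zero_less_one] order_tendstoD(2)[OF b zero_less_one]
  proof eventually_elim
    case (elim h)
    then show ?case using bdd[of "a h" a0] bdd[of "b h" b0] L(2,3) C0 by (auto intro: order_trans)
  qed
  have dL: "eventually (\<lambda>h. (\<lambda>x. a h x - a0 x) \<in> Lq \<Omega> m \<and> (\<lambda>x. b h x - b0 x) \<in> Lq \<Omega> m) F"
    using L(1) by eventually_elim (use L m in \<open>auto intro!: Lq_diff\<close>)
  let ?T1 = "\<lambda>h. LINT x|?M. norm (a h x - a0 x) * norm (a h x) powr (m - 2) * norm (b h x)"
  let ?T2 = "\<lambda>h. LINT x|?M. norm (a h x - a0 x) * norm (a0 x) powr (m - 2) * norm (b h x)"
  let ?T3 = "\<lambda>h. LINT x|?M. norm (b h x - b0 x) * norm (a0 x) powr (m - 2) * norm (a0 x)"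
  have T1: "(?T1 \<longlongrightarrow> 0) F"
    by (rule trilinear_small[OF _ m a, of _ _ C]) (use ev dL in \<open>eventually_elim; simp\<close>)+
  have T2: "(?T2 \<longlongrightarrow> 0) F"
    by (rule trilinear_small[OF _ m a, of "\<lambda>_. a0" b C]; (use ev dL in \<open>eventually_elim\<close>); use L C0 in simp)
  have T3: "(?T3 \<longlongrightarrow> 0) F"
    by (rule trilinear_small[OF _ m b, of "\<lambda>_. a0" "\<lambda>_. a0" C]; (use ev dL in \<open>eventually_elim\<close>); use L C0 in simp)
  have bound: "eventually (\<lambda>h. \<bar>pairing \<Omega> m (B h) (a h) (b h) - pairing \<Omega> m B0 a0 b0\<bar>
     \<le> norm (B h - B0) * (2 * C) + norm B0 * (m * (?T1 h + ?T2 h)) + norm B0 * ?T3 h) F"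
    using ev dL
  proof eventually_elim
    case (elim h)
    have ah: "a h \<in> Lq \<Omega> m" "b h \<in> Lq \<Omega> m" and da: "(\<lambda>x. a h x - a0 x) \<in> Lq \<Omega> m" "(\<lambda>x. b h x - b0 x) \<in> Lq \<Omega> m"
      using elim by auto
    have 1: "pairing \<Omega> m (B h) (a h) (b h) - pairing \<Omega> m B0 (a h) (b h) = pairing \<Omega> m (B h - B0) (a h) (b h)"
      unfolding pairing_def
      using pairing_integrable[OF ah m, of "B h"] pairing_integrable[OF ah m, of B0]
      by (simp add: matrix_vector_mult_diff_rdistrib inner_diff_left)
    have 2: "\<bar>pairing \<Omega> m (B h - B0) (a h) (b h)\<bar> \<le> norm (B h - B0) * (2 * C)"
      by (rule order_trans[OF pairing_bound[OF ah m zero_less_one] mult_left_mono]) (use elim in auto)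
    have i3: "integrable ?M (\<lambda>x. norm (a h x - a0 x) * norm (a h x) powr (m - 2) * norm (b h x))"
      "integrable ?M (\<lambda>x. norm (a h x - a0 x) * norm (a0 x) powr (m - 2) * norm (b h x))"
      "integrable ?M (\<lambda>x. norm (b h x - b0 x) * norm (a0 x) powr (m - 2) * norm (a0 x))"
      using trilinear(1) ah da L m by blast+
    have "\<bar>pairing \<Omega> m B0 (a h) (b h) - pairing \<Omega> m B0 a0 (b h)\<bar>
       = \<bar>LINT x|?M. (B0 *v (power_map m (a h x) - power_map m (a0 x))) \<bullet> b h x\<bar>"
      unfolding pairing_def
      using pairing_integrable[OF ah m, of B0] pairing_integrable[OF L(2) ah(2) m, of B0]
      by (simp add: matrix_vector_mult_diff_distrib inner_diff_left)
    also have "\<dots> \<le> (LINT x|?M. \<bar>(B0 *v (power_map m (a h x) - power_map m (a0 x))) \<bullet> b h x\<bar>)"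
      by (rule integral_abs_bound)
    also have "\<dots> \<le> (LINT x|?M. norm B0 * (m * (norm (a h x - a0 x) * norm (a h x) powr (m - 2) * norm (b h x)
        + norm (a h x - a0 x) * norm (a0 x) powr (m - 2) * norm (b h x))))"
    proof (rule integral_mono)
      show "integrable ?M (\<lambda>x. \<bar>(B0 *v (power_map m (a h x) - power_map m (a0 x))) \<bullet> b h x\<bar>)"
        using pairing_integrable[OF ah m, of B0] pairing_integrable[OF L(2) ah(2) m, of B0]
        by (simp add: matrix_vector_mult_diff_distrib inner_diff_left)
      show "\<bar>(B0 *v (power_map m (a h x) - power_map m (a0 x))) \<bullet> b h x\<bar> \<le> norm B0 * (m * (norm (a h x - a0 x) * norm (a h x) powr (m - 2) * norm (b h x)
        + norm (a h x - a0 x) * norm (a0 x) powr (m - 2) * norm (b h x)))" for x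
      proof -
        have "\<bar>(B0 *v (power_map m (a h x) - power_map m (a0 x))) \<bullet> b h x\<bar> \<le> norm (B0 *v (power_map m (a h x) - power_map m (a0 x))) * norm (b h x)"
          by (rule Cauchy_Schwarz_ineq2)
        also have "\<dots> \<le> (norm B0 * norm (power_map m (a h x) - power_map m (a0 x))) * norm (b h x)"
          by (intro mult_right_mono norm_matrix_vector_le) auto
        also have "\<dots> \<le> (norm B0 * (m * (norm (a h x - a0 x) * norm (a h x) powr (m - 2) + norm (a h x - a0 x) * norm (a0 x) powr (m - 2)))) * norm (b h x)"
          by (intro mult_right_mono mult_left_mono power_map_diff_le m) auto
        also have "\<dots> = norm B0 * (m * (norm (a h x - a0 x) * norm (a h x) powr (m - 2) * norm (b h x)
        + norm (a h x - a0 x) * norm (a0 x) powr (m - 2) * norm (b h x)))" by (simp add: distrib_right distrib_left mult.assoc)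
        finally show ?thesis .
      qed
    qed (use i3 in auto)
    also have "\<dots> = norm B0 * (m * (?T1 h + ?T2 h))" using i3 by simp
    finally have 3: "\<bar>pairing \<Omega> m B0 (a h) (b h) - pairing \<Omega> m B0 a0 (b h)\<bar> \<le> norm B0 * (m * (?T1 h + ?T2 h))" .
    have "\<bar>pairing \<Omega> m B0 a0 (b h) - pairing \<Omega> m B0 a0 b0\<bar> = \<bar>pairing \<Omega> m B0 a0 (\<lambda>x. b h x - b0 x)\<bar>"
      using pairing_diff[OF L(2) ah(2) L(3) m] by simp
    also have "\<dots> \<le> (LINT x|?M. \<bar>(B0 *v power_map m (a0 x)) \<bullet> (b h x - b0 x)\<bar>)"
      unfolding pairing_def by (rule integral_abs_bound)
    also have "\<dots> \<le> (LINT x|?M. norm B0 * (norm (b h x - b0 x) * norm (a0 x) powr (m - 2) * norm (a0 x)))"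
    proof (rule integral_mono)
      show "integrable ?M (\<lambda>x. \<bar>(B0 *v power_map m (a0 x)) \<bullet> (b h x - b0 x)\<bar>)"
        using pairing_integrable[OF L(2) da(2) m] by (rule integrable_abs)
      show "\<bar>(B0 *v power_map m (a0 x)) \<bullet> (b h x - b0 x)\<bar> \<le> norm B0 * (norm (b h x - b0 x) * norm (a0 x) powr (m - 2) * norm (a0 x))" for x
        using pairing_pointwise[of B0 m "a0 x" "b h x - b0 x"] by (simp add: mult_ac)
    qed (use i3 in auto)
    also have "\<dots> = norm B0 * ?T3 h" by simp
    finally have 4: "\<bar>pairing \<Omega> m B0 a0 (b h) - pairing \<Omega> m B0 a0 b0\<bar> \<le> norm B0 * ?T3 h" .
    show ?case using 1 2 3 4 by linarith
  qed
  have "((\<lambda>h. norm (B h - B0) * (2 * C) + norm B0 * (m * (?T1 h + ?T2 h)) + norm B0 * ?T3 h)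
     \<longlongrightarrow> 0 * (2 * C) + norm B0 * (m * (0 + 0)) + norm B0 * 0) F"
    by (intro tendsto_add tendsto_mult tendsto_const T1 T2 T3 tendsto_norm_zero LIM_zero B)
  then have "((\<lambda>h. pairing \<Omega> m (B h) (a h) (b h) - pairing \<Omega> m B0 a0 b0) \<longlongrightarrow> 0) F"
    by (intro Lim_null_comparison[OF bound[folded real_norm_def]]) simp
  then show ?thesis by (rule LIM_zero_cancel)
qed

section \<open>Weak gradients and the Sobolev inequality\<close>

lemma finite_measure_bounded_open:
  "open \<Omega> \<Longrightarrow> bounded \<Omega> \<Longrightarrow> finite_measure (lebesgue_on \<Omega>)"
  by (intro finite_measure_lebesgue_on lmeasurable_open)

lemma L2_inner:
  fixes f h :: "'a::euclidean_space \<Rightarrow> 'b::euclidean_space"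
  assumes "f \<in> Lq \<Omega> 2" "h \<in> Lq \<Omega> 2"
  shows "integrable (lebesgue_on \<Omega>) (\<lambda>x. norm (f x) * norm (h x))"
    "integrable (lebesgue_on \<Omega>) (\<lambda>x. f x \<bullet> h x)"
    "(LINT x|lebesgue_on \<Omega>. norm (f x) * norm (h x)) \<le> sqrt (modular \<Omega> 2 f * modular \<Omega> 2 h)"
    "\<bar>LINT x|lebesgue_on \<Omega>. f x \<bullet> h x\<bar> \<le> sqrt (modular \<Omega> 2 f * modular \<Omega> 2 h)"
proof -
  note [measurable] = LqD(1)[OF assms(1)] LqD(1)[OF assms(2)]
  have i: "integrable (lebesgue_on \<Omega>) (\<lambda>x. (norm (f x))\<^sup>2)" "integrable (lebesgue_on \<Omega>) (\<lambda>x. (norm (h x))\<^sup>2)"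
    using LqD(2)[OF assms(1)] LqD(2)[OF assms(2)] by simp_all
  have y: "2 * (x * z) \<le> t * x\<^sup>2 + z\<^sup>2 / t" if "t > 0" for x z t :: real
  proof -
    have "0 \<le> (sqrt t * x - z / sqrt t)\<^sup>2" by simp
    also have "\<dots> = t * x\<^sup>2 + z\<^sup>2 / t - 2 * (x * z)"
      using that by (simp add: power2_eq_square algebra_simps)
    finally show ?thesis by simp
  qed
  have s: "integrable (lebesgue_on \<Omega>) (\<lambda>x. t * (norm (f x))\<^sup>2 + (norm (h x))\<^sup>2 / t)" for t using i by simp
  show n: "integrable (lebesgue_on \<Omega>) (\<lambda>x. norm (f x) * norm (h x))"
  proof (rule Bochner_Integration.integrable_bound[OF s[of 1]])
    have "norm (norm (f x) * norm (h x)) \<le> norm (1 * (norm (f x))\<^sup>2 + (norm (h x))\<^sup>2 / 1)" for x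
    proof -
      have "0 \<le> norm (f x) * norm (h x)" by simp
      moreover have "2 * (norm (f x) * norm (h x)) \<le> (norm (f x))\<^sup>2 + (norm (h x))\<^sup>2"
        using y[of 1 "norm (f x)" "norm (h x)"] by simp
      ultimately have "norm (f x) * norm (h x) \<le> (norm (f x))\<^sup>2 + (norm (h x))\<^sup>2" by linarith
      then show ?thesis by simp
    qed
    then show "AE x in lebesgue_on \<Omega>. norm (norm (f x) * norm (h x)) \<le> norm (1 * (norm (f x))\<^sup>2 + (norm (h x))\<^sup>2 / 1)"
      by (rule AE_I2)
  qed measurable
  show d: "integrable (lebesgue_on \<Omega>) (\<lambda>x. f x \<bullet> h x)"
    by (rule Bochner_Integration.integrable_bound[OF n]) (auto intro!: AE_I2 Cauchy_Schwarz_ineq2)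
  show N: "(LINT x|lebesgue_on \<Omega>. norm (f x) * norm (h x)) \<le> sqrt (modular \<Omega> 2 f * modular \<Omega> 2 h)"
  proof (rule le_sqrt_mult_of_young[OF modular_nonneg modular_nonneg])
    fix t :: real assume t: "t > 0"
    have "2 * (LINT x|lebesgue_on \<Omega>. norm (f x) * norm (h x)) = (LINT x|lebesgue_on \<Omega>. 2 * (norm (f x) * norm (h x)))" by simp
    also have "\<dots> \<le> (LINT x|lebesgue_on \<Omega>. t * (norm (f x))\<^sup>2 + (norm (h x))\<^sup>2 / t)"
      using n by (intro integral_mono[OF _ s] y t) simp
    also have "\<dots> = t * modular \<Omega> 2 f + modular \<Omega> 2 h / t" using i by (simp add: modular_def)
    finally show "2 * (LINT x|lebesgue_on \<Omega>. norm (f x) * norm (h x)) \<le> t * modular \<Omega> 2 f + modular \<Omega> 2 h / t" .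
  qed
  have "\<bar>LINT x|lebesgue_on \<Omega>. f x \<bullet> h x\<bar> \<le> (LINT x|lebesgue_on \<Omega>. \<bar>f x \<bullet> h x\<bar>)"
    by (rule integral_abs_bound)
  also have "\<dots> \<le> (LINT x|lebesgue_on \<Omega>. norm (f x) * norm (h x))"
    using d n by (intro integral_mono integrable_abs Cauchy_Schwarz_ineq2)
  finally show "\<bar>LINT x|lebesgue_on \<Omega>. f x \<bullet> h x\<bar> \<le> sqrt (modular \<Omega> 2 f * modular \<Omega> 2 h)" using N by simp
qed

lemma modular_2_inner: "modular \<Omega> 2 f = (LINT x|lebesgue_on \<Omega>. f x \<bullet> f x)"
  by (simp add: modular_def power2_norm_eq_inner)

lemma modular_2_add:
  fixes f h :: "'a::euclidean_space \<Rightarrow> 'b::euclidean_space"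
  assumes "f \<in> Lq \<Omega> 2" "h \<in> Lq \<Omega> 2"
  shows "modular \<Omega> 2 (\<lambda>x. f x + h x) \<le> (sqrt (modular \<Omega> 2 f) + sqrt (modular \<Omega> 2 h))\<^sup>2"
proof -
  have e: "(a + b) \<bullet> (a + b) = a \<bullet> a + 2 * (a \<bullet> b) + b \<bullet> b" for a b :: 'b
    by (simp add: inner_add_left inner_add_right inner_commute)
  have "modular \<Omega> 2 (\<lambda>x. f x + h x) = modular \<Omega> 2 f + 2 * (LINT x|lebesgue_on \<Omega>. f x \<bullet> h x) + modular \<Omega> 2 h"
    unfolding modular_2_inner e
    using L2_inner(2)[OF assms(1,1)] L2_inner(2)[OF assms] L2_inner(2)[OF assms(2,2)] by simp
  also have "\<dots> \<le> modular \<Omega> 2 f + 2 * (sqrt (modular \<Omega> 2 f) * sqrt (modular \<Omega> 2 h)) + modular \<Omega> 2 h"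
    using L2_inner(4)[OF assms] by (simp add: real_sqrt_mult abs_le_iff)
  also have "\<dots> = (sqrt (modular \<Omega> 2 f) + sqrt (modular \<Omega> 2 h))\<^sup>2"
    by (simp add: power2_sum modular_nonneg)
  finally show ?thesis .
qed

lemma modular_cong_AE:
  assumes "f \<in> borel_measurable (lebesgue_on \<Omega>)" "h \<in> borel_measurable (lebesgue_on \<Omega>)"
    "AE x in lebesgue_on \<Omega>. f x = h x"
  shows "modular \<Omega> q f = modular \<Omega> q h"
  unfolding modular_def using assms by (intro integral_cong_AE) auto

lemma nth_L2:
  fixes v :: "'a::euclidean_space \<Rightarrow> 'b::euclidean_space^'m"
  assumes "v \<in> Lq \<Omega> 2"
  shows "(\<lambda>x. v x $ i) \<in> Lq \<Omega> 2"
proof -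
  note [measurable] = LqD(1)[OF assms]
  have [measurable]: "(\<lambda>x. v x $ i) \<in> borel_measurable (lebesgue_on \<Omega>)"
    by (rule borel_measurable_continuous_on[of "\<lambda>y. y $ i"]) (auto intro: continuous_intros)
  have "integrable (lebesgue_on \<Omega>) (\<lambda>x. norm (v x $ i) powr 2)"
    by (rule Bochner_Integration.integrable_bound[OF LqD(2)[OF assms]])
       (auto intro!: AE_I2 power_mono Finite_Cartesian_Product.norm_nth_le)
  then show ?thesis by (simp add: Lq_def)
qed

lemma Basis_axis: "b \<in> (Basis :: (real^'n) set) \<longleftrightarrow> (\<exists>j. b = axis j 1)"
  by (auto simp: Basis_vec_def)

text \<open>The classical gradient, a continuous representative for test functions, in contrast to
  \<open>grad\<close>, which is a chosen weak gradient and only determined almost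
  everywhere.\<close>

definition cgrad :: "(real^'n \<Rightarrow> real^'n) \<Rightarrow> real^'n \<Rightarrow> real^'n^'n" where
  "cgrad \<phi> x = (\<chi> i j. frechet_derivative \<phi> (at x) (axis j 1) $ i)"

locale bounded_domain =
  fixes \<Omega> :: "(real^'n) set"
  assumes op: "open \<Omega>" and bd: "bounded \<Omega>"

sublocale bounded_domain \<subseteq> finite_measure "lebesgue_on \<Omega>"
  by (rule finite_measure_bounded_open[OF op bd])

context bounded_domain
begin

lemma dom_lebesgue: "\<Omega> \<in> sets lebesgue" using op by auto

lemma continuous_measurable: "continuous_on UNIV f \<Longrightarrow> f \<in> borel_measurable (lebesgue_on \<Omega>)"
  for f :: "real^'n \<Rightarrow> 'b::euclidean_space"
  by (rule continuous_imp_measurable_on_sets_lebesgue[OF continuous_on_subset]) (use dom_lebesgue in auto)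

lemma continuous_Lq:
  fixes f :: "real^'n \<Rightarrow> 'b::euclidean_space"
  assumes "continuous_on UNIV f" "\<And>x. x \<notin> \<Omega> \<Longrightarrow> f x = 0" "q > 0"
  shows "f \<in> Lq \<Omega> q"
proof -
  obtain C where C: "C \<ge> 0" "\<And>x. norm (f x) \<le> C" using continuous_vanishing_bounded[OF assms(1) bd assms(2)] by blast
  note [measurable] = continuous_measurable[OF assms(1)]
  have "integrable (lebesgue_on \<Omega>) (\<lambda>x. norm (f x) powr q)"
    using C assms(3) by (intro integrable_const_bound[of _ "C powr q"]) (auto intro!: AE_I2 powr_mono2)
  then show ?thesis by (simp add: Lq_def)
qed

lemma L2_mult_integrable:
  fixes f h :: "real^'n \<Rightarrow> real"
  assumes f: "f \<in> Lq \<Omega> 2" and h: "continuous_on UNIV h" "\<And>x. x \<notin> \<Omega> \<Longrightarrow> h x = 0"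
  shows "integrable (lebesgue_on \<Omega>) (\<lambda>x. f x * h x)"
  using L2_inner(2)[OF f continuous_Lq[OF h]] by simp

lemma L2_integrable: "f \<in> Lq \<Omega> 2 \<Longrightarrow> integrable (lebesgue_on \<Omega>) f" for f :: "real^'n \<Rightarrow> real"
proof -
  assume f: "f \<in> Lq \<Omega> 2"
  have "(\<lambda>x::real^'n. 1::real) \<in> Lq \<Omega> 2" by (simp add: Lq_def)
  from L2_inner(2)[OF f this] show ?thesis by simp
qed

lemma test_D_support: "test_function \<Omega> \<psi> \<Longrightarrow> x \<notin> \<Omega> \<Longrightarrow> frechet_derivative \<psi> (at x) v = 0"
  by (simp add: test_function_support(2))

lemma weak_gradient_diff:
  assumes v: "v \<in> Lq \<Omega> 2" "w \<in> Lq \<Omega> 2" and G: "weak_gradient \<Omega> v G" "weak_gradient \<Omega> w H"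
  shows "weak_gradient \<Omega> (\<lambda>x. v x - w x) (\<lambda>x. G x - H x)"
proof -
  have L: "G \<in> Lq \<Omega> 2" "H \<in> Lq \<Omega> 2" using G by (auto simp: weak_gradient_def)
  show ?thesis unfolding weak_gradient_def
  proof (intro conjI allI impI)
    show "(\<lambda>x. G x - H x) \<in> Lq \<Omega> 2" using L by (intro Lq_diff) auto
    fix \<psi> :: "real^'n \<Rightarrow> real" and i j assume \<psi>: "test_function \<Omega> \<psi>"
    let ?D = "\<lambda>x. frechet_derivative \<psi> (at x) (axis j 1)"
    note c = test_function_derivative[OF \<psi>] and s = test_function_support(1)[OF \<psi>] test_D_support[OF \<psi>]
    have I: "integrable (lebesgue_on \<Omega>) (\<lambda>x. v x $ i * ?D x)" "integrable (lebesgue_on \<Omega>) (\<lambda>x. w x $ i * ?D x)"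
      "integrable (lebesgue_on \<Omega>) (\<lambda>x. G x $ i $ j * \<psi> x)" "integrable (lebesgue_on \<Omega>) (\<lambda>x. H x $ i $ j * \<psi> x)"
      using c s by (auto intro!: L2_mult_integrable nth_L2 v L)
    show "(LINT x|lebesgue_on \<Omega>. (v x - w x) $ i * ?D x) = - (LINT x|lebesgue_on \<Omega>. (G x - H x) $ i $ j * \<psi> x)"
      using I G \<psi> by (simp add: left_diff_distrib weak_gradient_def)
  qed
qed

text \<open>Each component of the difference annihilates all test functions. Since
  \<open>grad\<close> is a choice, even its additivity holds only almost everywhere and rests on
  this.\<close>

lemma weak_gradient_unique:
  assumes G: "weak_gradient \<Omega> v G" "weak_gradient \<Omega> v H"
  shows "AE x in lebesgue_on \<Omega>. G x = H x"
proof -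
  have L: "G \<in> Lq \<Omega> 2" "H \<in> Lq \<Omega> 2" using G by (auto simp: weak_gradient_def)
  have "AE x in lebesgue_on \<Omega>. G x $ i $ j - H x $ i $ j = 0" for i j
  proof (rule AE_zero_of_test_functions[OF op])
    have L': "(\<lambda>x. G x $ i $ j) \<in> Lq \<Omega> 2" "(\<lambda>x. H x $ i $ j) \<in> Lq \<Omega> 2"
      by (auto intro!: nth_L2 L)
    then show "integrable (lebesgue_on \<Omega>) (\<lambda>x. G x $ i $ j - H x $ i $ j)"
      by (auto intro: L2_integrable)
    fix \<psi> :: "real^'n \<Rightarrow> real" assume \<psi>: "test_function \<Omega> \<psi>"
    have I: "integrable (lebesgue_on \<Omega>) (\<lambda>x. G x $ i $ j * \<psi> x)" "integrable (lebesgue_on \<Omega>) (\<lambda>x. H x $ i $ j * \<psi> x)"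
      using test_function_derivative(3)[OF \<psi>] test_function_support(1)[OF \<psi>]
      by (auto intro!: L2_mult_integrable L')
    have "(LINT x|lebesgue_on \<Omega>. G x $ i $ j * \<psi> x) = (LINT x|lebesgue_on \<Omega>. H x $ i $ j * \<psi> x)"
      using G \<psi> by (auto simp: weak_gradient_def)
    then show "(LINT x|lebesgue_on \<Omega>. (G x $ i $ j - H x $ i $ j) * \<psi> x) = 0"
      using I by (simp add: left_diff_distrib)
  qed
  then have "AE x in lebesgue_on \<Omega>. \<forall>i j. G x $ i $ j - H x $ i $ j = 0"
    by (simp add: AE_all_countable)
  then show ?thesis by eventually_elim (simp add: vec_eq_iff)
qed

lemma H1D: "v \<in> H1 \<Omega> \<Longrightarrow> v \<in> Lq \<Omega> 2" "v \<in> H1 \<Omega> \<Longrightarrow> weak_gradient \<Omega> v (grad \<Omega> v)"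
  "v \<in> H1 \<Omega> \<Longrightarrow> grad \<Omega> v \<in> Lq \<Omega> 2"
proof -
  show "v \<in> H1 \<Omega> \<Longrightarrow> v \<in> Lq \<Omega> 2" by (simp add: H1_def)
  show "v \<in> H1 \<Omega> \<Longrightarrow> weak_gradient \<Omega> v (grad \<Omega> v)" unfolding H1_def grad_def by (rule someI_ex[of "weak_gradient \<Omega> v"]) blast
  then show "v \<in> H1 \<Omega> \<Longrightarrow> grad \<Omega> v \<in> Lq \<Omega> 2" by (simp add: weak_gradient_def)
qed

lemma H1_diff:
  assumes "v \<in> H1 \<Omega>" "w \<in> H1 \<Omega>"
  shows "(\<lambda>x. v x - w x) \<in> H1 \<Omega>"
    and "AE x in lebesgue_on \<Omega>. grad \<Omega> (\<lambda>x. v x - w x) x = grad \<Omega> v x - grad \<Omega> w x"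
proof -
  note wg = weak_gradient_diff[OF H1D(1)[OF assms(1)] H1D(1)[OF assms(2)] H1D(2)[OF assms(1)] H1D(2)[OF assms(2)]]
  show H: "(\<lambda>x. v x - w x) \<in> H1 \<Omega>" using wg assms by (auto simp: H1_def intro!: Lq_diff)
  show "AE x in lebesgue_on \<Omega>. grad \<Omega> (\<lambda>x. v x - w x) x = grad \<Omega> v x - grad \<Omega> w x"
    by (rule weak_gradient_unique[OF H1D(2)[OF H] wg])
qed

lemma grad_diff_modular:
  assumes "v \<in> H1 \<Omega>" "w \<in> H1 \<Omega>"
  shows "modular \<Omega> 2 (grad \<Omega> (\<lambda>x. v x - w x)) = modular \<Omega> 2 (\<lambda>x. grad \<Omega> v x - grad \<Omega> w x)"
  by (rule modular_cong_AE[OF _ _ H1_diff(2)[OF assms]])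
     (use LqD(1)[OF H1D(3)[OF assms(1)]] LqD(1)[OF H1D(3)[OF assms(2)]] LqD(1)[OF H1D(3)[OF H1_diff(1)[OF assms]]] in auto)

lemma H1_norm_square: "(H1_norm \<Omega> v)\<^sup>2 = modular \<Omega> 2 v + modular \<Omega> 2 (grad \<Omega> v)"
  by (simp add: H1_norm_def Lq_norm_2_square modular_nonneg)

lemma H1_norm_diff_square:
  assumes "v \<in> H1 \<Omega>" "w \<in> H1 \<Omega>"
  shows "(H1_norm \<Omega> (\<lambda>x. v x - w x))\<^sup>2 = modular \<Omega> 2 (\<lambda>x. v x - w x) + modular \<Omega> 2 (\<lambda>x. grad \<Omega> v x - grad \<Omega> w x)"
  by (simp add: H1_norm_square grad_diff_modular[OF assms])

lemma H1_norm_self: "v \<in> H1 \<Omega> \<Longrightarrow> H1_norm \<Omega> (\<lambda>x. v x - v x) = 0"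
  using H1_norm_diff_square[of v v] by (simp add: modular_def)

lemma cube_exists: "\<exists>R>0. \<forall>x\<in>\<Omega>. \<forall>b\<in>Basis. \<bar>x \<bullet> b\<bar> < R"
proof -
  obtain R where R: "R > 0" "\<And>x. x \<in> \<Omega> \<Longrightarrow> norm x < R"
    using bd unfolding bounded_pos_less by blast
  have "\<bar>x \<bullet> b\<bar> < R" if "x \<in> \<Omega>" "b \<in> Basis" for x b
    using Basis_le_norm[OF that(2), of x] R(2)[OF that(1)] by simp
  then show ?thesis using R by blast
qed

lemma outside_cube: "(\<forall>x\<in>\<Omega>. \<forall>b\<in>Basis. \<bar>x \<bullet> b\<bar> < R) \<Longrightarrow> x \<notin> cube R \<Longrightarrow> x \<notin> \<Omega>"
  by (force simp: mem_box)

lemma integration_by_parts: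
  assumes \<phi>: "test_function \<Omega> \<phi>" and \<psi>: "test_function \<Omega> (\<psi> :: real^'n \<Rightarrow> real)"
  shows "(LINT x|lebesgue_on \<Omega>. \<phi> x $ i * frechet_derivative \<psi> (at x) (axis j 1))
    = - (LINT x|lebesgue_on \<Omega>. cgrad \<phi> x $ i $ j * \<psi> x)"
proof -
  obtain R where R: "R > 0" "\<forall>x\<in>\<Omega>. \<forall>b\<in>Basis. \<bar>x \<bullet> b\<bar> < R" using cube_exists by blast
  let ?b = "axis j 1 :: real^'n"
  have b: "?b \<in> Basis" by (auto simp: Basis_axis)
  let ?D\<phi> = "\<lambda>x v. frechet_derivative \<phi> (at x) v $ i" and ?D\<psi> = "\<lambda>x. frechet_derivative \<psi> (at x)"
  note c = test_function_derivative[OF \<phi>] test_function_derivative[OF \<psi>]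
  note s = test_function_support(1)[OF \<phi>] test_D_support[OF \<phi>] test_function_support(1)[OF \<psi>] test_D_support[OF \<psi>]
  have d: "((\<lambda>x. \<phi> x $ i * \<psi> x) has_derivative (\<lambda>v. \<phi> x $ i * ?D\<psi> x v + ?D\<phi> x v * \<psi> x)) (at x)" for x
    by (intro has_derivative_mult c bounded_linear.has_derivative[OF bounded_linear_vec_nth])
  have c1: "continuous_on UNIV (\<lambda>x. \<phi> x $ i * ?D\<psi> x ?b)" "continuous_on UNIV (\<lambda>x. ?D\<phi> x ?b * \<psi> x)"
    using c by (auto intro!: continuous_intros)
  have z: "\<phi> x $ i * ?D\<psi> x ?b = 0" "?D\<phi> x ?b * \<psi> x = 0" if "x \<notin> \<Omega>" for x
    using s that by auto
  note L = lebesgue_on_eq_cube_integral[OF _ dom_lebesgue]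
  have "(LINT x|lebesgue_on \<Omega>. \<phi> x $ i * ?D\<psi> x ?b) + (LINT x|lebesgue_on \<Omega>. ?D\<phi> x ?b * \<psi> x)
    = integral (cube R) (\<lambda>x. \<phi> x $ i * ?D\<psi> x ?b) + integral (cube R) (\<lambda>x. ?D\<phi> x ?b * \<psi> x)"
    using L(2)[OF c1(1), of R] L(2)[OF c1(2), of R] z outside_cube[OF R(2)] by simp
  also have "\<dots> = integral (cube R) (\<lambda>x. \<phi> x $ i * ?D\<psi> x ?b + ?D\<phi> x ?b * \<psi> x)"
    by (rule Henstock_Kurzweil_Integration.integral_add[symmetric]; rule integrable_continuous; rule continuous_on_subset[OF _ subset_UNIV]; rule c1)
  also have "\<dots> = 0"
  proof (rule integral_derivative_zero[OF d b _ _ R(1)])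
    show "continuous_on UNIV (\<lambda>x. \<phi> x $ i * ?D\<psi> x ?b + ?D\<phi> x ?b * \<psi> x)" using c1 by (rule continuous_on_add)
    show "\<bar>x \<bullet> ?b\<bar> < R" if "\<phi> x $ i * \<psi> x \<noteq> 0" for x using s that R(2) b by auto
  qed
  finally show ?thesis by (simp add: cgrad_def)
qed

lemma cgrad_test:
  assumes \<phi>: "test_function \<Omega> \<phi>"
  shows "continuous_on UNIV (cgrad \<phi>)" "x \<notin> \<Omega> \<Longrightarrow> cgrad \<phi> x = 0" "weak_gradient \<Omega> \<phi> (cgrad \<phi>)" "\<phi> \<in> H1 \<Omega>"
proof -
  show c: "continuous_on UNIV (cgrad \<phi>)"
    unfolding cgrad_def[abs_def] using test_function_derivative(2)[OF \<phi>]
    by (intro continuous_on_vec_lambda continuous_on_component)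
  show z: "x \<notin> \<Omega> \<Longrightarrow> cgrad \<phi> x = 0" for x
    using test_D_support[OF \<phi>] by (simp add: cgrad_def vec_eq_iff)
  show w: "weak_gradient \<Omega> \<phi> (cgrad \<phi>)"
    unfolding weak_gradient_def using integration_by_parts[OF \<phi>] continuous_Lq[OF c z] by auto
  have "\<phi> \<in> Lq \<Omega> 2"
    using test_function_derivative(3)[OF \<phi>] test_function_support(1)[OF \<phi>] by (intro continuous_Lq) auto
  then show "\<phi> \<in> H1 \<Omega>" using w by (auto simp: H1_def)
qed

text \<open>The scalar bound is applied to each component with the norm of the full gradient matrix
  as majorant. The factors \<open>?n powr m\<close> and \<open>?n\<close> come from bounding the
  norm by \<open>?n\<close> times the largest component and its power by the sum over all
  components.\<close>

lemma sobolev_test: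
  assumes m: "m \<ge> 2" and n: "CARD('n) \<ge> 3 \<Longrightarrow> m \<le> 2 * real CARD('n) / (real CARD('n) - 2)"
  shows "\<exists>S\<ge>0. \<forall>\<phi> K. test_function \<Omega> \<phi> \<longrightarrow> K > 0 \<longrightarrow> modular \<Omega> 2 (cgrad \<phi>) \<le> K \<longrightarrow> modular \<Omega> m \<phi> \<le> S * K powr (m / 2)"
proof -
  obtain R where R: "R > 0" "\<forall>x\<in>\<Omega>. \<forall>b\<in>Basis. \<bar>x \<bullet> b\<bar> < R" using cube_exists by blast
  have n': "DIM(real^'n) \<ge> 3 \<Longrightarrow> m \<le> 2 * real DIM(real^'n) / (real DIM(real^'n) - 2)" using n by simp
  obtain S where S: "S \<ge> 0" "\<And>(\<phi> :: real^'n \<Rightarrow> real) \<phi>' N K. cube_function \<phi> \<phi>' N R \<Longrightarrow> K > 0 \<Longrightarrow>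
    integral (cube R) (\<lambda>x. (N x)\<^sup>2) \<le> K \<Longrightarrow> integral (cube R) (\<lambda>x. \<bar>\<phi> x\<bar> powr m) \<le> S * K powr (m / 2)"
    using sobolev_cube[OF R(1) m n'] by blast
  let ?n = "real CARD('n)"
  have "modular \<Omega> m \<phi> \<le> (?n powr m * (?n * S)) * K powr (m / 2)"
    if \<phi>: "test_function \<Omega> \<phi>" and K: "K > 0" "modular \<Omega> 2 (cgrad \<phi>) \<le> K" for \<phi> K
  proof -
    note c = test_function_derivative[OF \<phi>] and g = cgrad_test[OF \<phi>]
    have z: "\<phi> x = 0" if "x \<notin> \<Omega>" for x using test_function_support(1)[OF \<phi>] that by blast
    note L = lebesgue_on_eq_cube_integral[OF _ dom_lebesgue]
    have cp: "continuous_on UNIV (\<lambda>x. norm (\<phi> x) powr m)"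
      by (rule continuous_on_powr') (use c m in \<open>auto intro!: continuous_intros\<close>)
    have cpi: "continuous_on UNIV (\<lambda>x. \<bar>\<phi> x $ i\<bar> powr m)" for i
      by (rule continuous_on_powr') (use c m in \<open>auto intro!: continuous_intros\<close>)
    have K': "integral (cube R) (\<lambda>x. (norm (cgrad \<phi> x))\<^sup>2) \<le> K"
      using L(2)[of "\<lambda>x. (norm (cgrad \<phi> x))\<^sup>2" R] K(2) g outside_cube[OF R(2)]
      by (simp add: modular_def continuous_intros)
    have comp: "integral (cube R) (\<lambda>x. \<bar>\<phi> x $ i\<bar> powr m) \<le> S * K powr (m / 2)" for i
    proof (rule S(2)[OF _ K(1) K'])
      show "cube_function (\<lambda>x. \<phi> x $ i) (\<lambda>x v. frechet_derivative \<phi> (at x) v $ i) (\<lambda>x. norm (cgrad \<phi> x)) R"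
      proof
        show "((\<lambda>x. \<phi> x $ i) has_derivative (\<lambda>v. frechet_derivative \<phi> (at x) v $ i)) (at x)" for x
          by (intro bounded_linear.has_derivative[OF bounded_linear_vec_nth] c)
        show "\<bar>x \<bullet> b\<bar> < R" if "b \<in> Basis" "\<phi> x $ i \<noteq> 0" for x b
          using z[of x] that R(2) by auto
        show "continuous_on UNIV (\<lambda>x. norm (cgrad \<phi> x))" using g by (intro continuous_intros)
        show "\<bar>frechet_derivative \<phi> (at x) b $ i\<bar> \<le> norm (cgrad \<phi> x)" if "b \<in> Basis" for x b
        proof -
          obtain j where j: "b = axis j 1" using \<open>b \<in> Basis\<close> by (auto simp: Basis_axis)
          have "\<bar>frechet_derivative \<phi> (at x) b $ i\<bar> = \<bar>cgrad \<phi> x $ i $ j\<bar>" by (simp add: cgrad_def j)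
          also have "\<dots> \<le> norm (cgrad \<phi> x $ i)" by (rule component_le_norm_cart)
          also have "\<dots> \<le> norm (cgrad \<phi> x)" by (rule Finite_Cartesian_Product.norm_nth_le)
          finally show ?thesis .
        qed
      qed (use R in auto)
    qed
    have pw: "norm (\<phi> x) powr m \<le> ?n powr m * (\<Sum>i\<in>UNIV. \<bar>\<phi> x $ i\<bar> powr m)" for x
    proof -
      obtain i where i: "\<And>k. \<bar>\<phi> x $ k\<bar> \<le> \<bar>\<phi> x $ i\<bar>"
      proof -
        have "Max (range (\<lambda>k. \<bar>\<phi> x $ k\<bar>)) \<in> range (\<lambda>k. \<bar>\<phi> x $ k\<bar>)" by (rule Max_in) auto
        then obtain i where "Max (range (\<lambda>k. \<bar>\<phi> x $ k\<bar>)) = \<bar>\<phi> x $ i\<bar>" by blast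
        moreover have "\<bar>\<phi> x $ k\<bar> \<le> Max (range (\<lambda>k. \<bar>\<phi> x $ k\<bar>))" for k by (rule Max_ge) auto
        ultimately show thesis using that[of i] by simp
      qed
      have "norm (\<phi> x) \<le> (\<Sum>k\<in>UNIV. \<bar>\<phi> x $ k\<bar>)" by (rule norm_le_l1_cart)
      also have "\<dots> \<le> (\<Sum>k\<in>(UNIV::'n set). \<bar>\<phi> x $ i\<bar>)" by (intro sum_mono i)
      finally have "norm (\<phi> x) powr m \<le> (?n * \<bar>\<phi> x $ i\<bar>) powr m" using m by (intro powr_mono2) auto
      also have "\<dots> = ?n powr m * \<bar>\<phi> x $ i\<bar> powr m" by (simp add: powr_mult)
      also have "\<dots> \<le> ?n powr m * (\<Sum>i\<in>UNIV. \<bar>\<phi> x $ i\<bar> powr m)"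
        by (intro mult_left_mono member_le_sum) auto
      finally show ?thesis .
    qed
    have "modular \<Omega> m \<phi> = integral (cube R) (\<lambda>x. norm (\<phi> x) powr m)"
      unfolding modular_def using L(2)[OF cp, of R] z outside_cube[OF R(2)] m by simp
    also have "\<dots> \<le> integral (cube R) (\<lambda>x. ?n powr m * (\<Sum>i\<in>UNIV. \<bar>\<phi> x $ i\<bar> powr m))"
      by (rule integral_le) (auto intro!: integrable_continuous continuous_intros continuous_on_subset[OF cp] continuous_on_subset[OF cpi] pw)
    also have "\<dots> = ?n powr m * (\<Sum>i\<in>UNIV. integral (cube R) (\<lambda>x. \<bar>\<phi> x $ i\<bar> powr m))"
      by (simp add: Henstock_Kurzweil_Integration.integral_sum integrable_continuous continuous_on_subset[OF cpi])
    also have "\<dots> \<le> ?n powr m * (\<Sum>i\<in>(UNIV::'n set). S * K powr (m / 2))"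
      by (intro mult_left_mono sum_mono comp) auto
    finally show ?thesis by (simp add: mult.assoc)
  qed
  moreover have "?n powr m * (?n * S) \<ge> 0" using S by simp
  ultimately show ?thesis by blast
qed

text \<open>Approximating test functions satisfy the bound; along a subsequence they converge almost
  everywhere, and Fatou's lemma passes the bound to the limit.\<close>

lemma sobolev_H10:
  assumes m: "m \<ge> 2" and n: "CARD('n) \<ge> 3 \<Longrightarrow> m \<le> 2 * real CARD('n) / (real CARD('n) - 2)"
  shows "\<exists>S\<ge>0. \<forall>v\<in>H10 \<Omega>. v \<in> Lq \<Omega> m \<longrightarrow> modular \<Omega> m v \<le> S * modular \<Omega> 2 (grad \<Omega> v) powr (m / 2)"
proof -
  obtain S where S: "S \<ge> 0" "\<And>\<phi> K. test_function \<Omega> \<phi> \<Longrightarrow> K > 0 \<Longrightarrow> modular \<Omega> 2 (cgrad \<phi>) \<le> K \<Longrightarrow> modular \<Omega> m \<phi> \<le> S * K powr (m / 2)"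
    using sobolev_test[OF m n] by blast
  have "modular \<Omega> m v \<le> S * modular \<Omega> 2 (grad \<Omega> v) powr (m / 2)" if v: "v \<in> H10 \<Omega>" and vm: "v \<in> Lq \<Omega> m" for v
  proof -
    obtain \<phi> where \<phi>: "\<And>k. test_function \<Omega> (\<phi> k)" "(\<lambda>k::nat. H1_norm \<Omega> (\<lambda>x. \<phi> k x - v x)) \<longlonglongrightarrow> 0" and v1: "v \<in> H1 \<Omega>"
      using v by (auto simp: H10_def)
    have "(\<lambda>k. (H1_norm \<Omega> (\<lambda>x. \<phi> k x - v x))\<^sup>2) \<longlonglongrightarrow> 0\<^sup>2" by (intro tendsto_intros \<phi>)
    then have lim: "(\<lambda>k. modular \<Omega> 2 (\<lambda>x. \<phi> k x - v x) + modular \<Omega> 2 (\<lambda>x. grad \<Omega> (\<phi> k) x - grad \<Omega> v x)) \<longlonglongrightarrow> 0"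
      by (simp add: H1_norm_diff_square[OF cgrad_test(4)[OF \<phi>(1)] v1])
    have l1: "(\<lambda>k. modular \<Omega> 2 (\<lambda>x. \<phi> k x - v x)) \<longlonglongrightarrow> 0"
      by (rule tendsto_sandwich[OF _ _ tendsto_const lim]) (auto intro!: always_eventually simp: modular_nonneg)
    have l2: "(\<lambda>k. modular \<Omega> 2 (\<lambda>x. grad \<Omega> (\<phi> k) x - grad \<Omega> v x)) \<longlonglongrightarrow> 0"
      by (rule tendsto_sandwich[OF _ _ tendsto_const lim]) (auto intro!: always_eventually simp: modular_nonneg)
    \<comment> \<open>A level strictly above the limit is eventually respected by the approximations
      and is positive even if the gradient vanishes. It is lowered to the limit value
      afterwards.\<close>
    have main: "modular \<Omega> m v \<le> S * K powr (m / 2)" if K: "K > modular \<Omega> 2 (grad \<Omega> v)" for K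
    proof -
      let ?a = "modular \<Omega> 2 (grad \<Omega> v)"
      have K0: "K > 0" using K modular_nonneg[of \<Omega> 2 "grad \<Omega> v"] by linarith
      have tri: "modular \<Omega> 2 (cgrad (\<phi> k)) \<le> (sqrt ?a + sqrt (modular \<Omega> 2 (\<lambda>x. grad \<Omega> (\<phi> k) x - grad \<Omega> v x)))\<^sup>2" for k
      proof -
        let ?d = "\<lambda>x. grad \<Omega> (\<phi> k) x - grad \<Omega> v x"
        note Gv = H1D(3)[OF v1] and Gk = H1D(3)[OF cgrad_test(4)[OF \<phi>(1)[of k]]]
        have d: "?d \<in> Lq \<Omega> 2" by (intro Lq_diff Gv Gk) simp
        have wc: "weak_gradient \<Omega> (\<phi> k) (cgrad (\<phi> k))" by (rule cgrad_test(3)[OF \<phi>(1)])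
        have "modular \<Omega> 2 (cgrad (\<phi> k)) = modular \<Omega> 2 (grad \<Omega> (\<phi> k))"
          by (rule modular_cong_AE[OF _ LqD(1)[OF Gk] weak_gradient_unique[OF wc H1D(2)[OF cgrad_test(4)[OF \<phi>(1)]]]])
             (use wc in \<open>auto simp: weak_gradient_def Lq_def\<close>)
        also have "\<dots> = modular \<Omega> 2 (\<lambda>x. grad \<Omega> v x + ?d x)" by simp
        also have "\<dots> \<le> (sqrt ?a + sqrt (modular \<Omega> 2 ?d))\<^sup>2" by (rule modular_2_add[OF Gv d])
        finally show ?thesis .
      qed
      have "(\<lambda>k. (sqrt ?a + sqrt (modular \<Omega> 2 (\<lambda>x. grad \<Omega> (\<phi> k) x - grad \<Omega> v x)))\<^sup>2) \<longlonglongrightarrow> (sqrt ?a + sqrt 0)\<^sup>2"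
        by (intro tendsto_intros l2)
      moreover have "(sqrt ?a + sqrt 0)\<^sup>2 < K" using K by (simp add: modular_nonneg)
      ultimately have "eventually (\<lambda>k. (sqrt ?a + sqrt (modular \<Omega> 2 (\<lambda>x. grad \<Omega> (\<phi> k) x - grad \<Omega> v x)))\<^sup>2 < K) sequentially"
        by (rule order_tendstoD)
      then have ev: "eventually (\<lambda>k. modular \<Omega> m (\<phi> k) \<le> S * K powr (m / 2)) sequentially"
      proof eventually_elim
        case (elim k)
        then show ?case using tri[of k] by (intro S(2) \<phi>(1) K0) linarith
      qed
      have i: "integrable (lebesgue_on \<Omega>) (\<lambda>x. (norm (\<phi> k x - v x))\<^sup>2)" for k
        using LqD(2)[OF H1D(1)[OF H1_diff(1)[OF cgrad_test(4)[OF \<phi>(1)[of k]] v1]]] by simp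
      have "(\<lambda>k. LINT x|lebesgue_on \<Omega>. norm ((norm (\<phi> k x - v x))\<^sup>2)) \<longlonglongrightarrow> 0"
        using l1 by (simp add: modular_def)
      from tendsto_L1_AE_subseq[OF i this]
      obtain r where r: "strict_mono r" "AE x in lebesgue_on \<Omega>. (\<lambda>k. (norm (\<phi> (r k) x - v x))\<^sup>2) \<longlonglongrightarrow> 0" by blast
      have \<phi>m: "\<phi> k \<in> Lq \<Omega> m" for k
        using test_function_derivative(3)[OF \<phi>(1)] test_function_support(1)[OF \<phi>(1)] m by (intro continuous_Lq) auto
      note [measurable] = LqD(1)[OF vm] LqD(1)[OF \<phi>m]
      have conv: "AE x in lebesgue_on \<Omega>. (\<lambda>k. ennreal (norm (\<phi> (r k) x) powr m)) \<longlonglongrightarrow> ennreal (norm (v x) powr m)"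
        using r(2)
      proof eventually_elim
        case (elim x)
        have "(\<lambda>k. sqrt ((norm (\<phi> (r k) x - v x))\<^sup>2)) \<longlonglongrightarrow> sqrt 0" by (intro tendsto_intros elim)
        then have "(\<lambda>k. \<phi> (r k) x) \<longlonglongrightarrow> v x" by (simp add: LIM_zero_iff tendsto_norm_zero_iff)
        then have "(\<lambda>k. norm (\<phi> (r k) x) powr m) \<longlonglongrightarrow> norm (v x) powr m"
          by (intro tendsto_powr' tendsto_intros) (use m in auto)
        then show ?case by (rule tendsto_ennrealI)
      qed
      have "ennreal (modular \<Omega> m v) = (\<integral>\<^sup>+x. ennreal (norm (v x) powr m) \<partial>lebesgue_on \<Omega>)"
        unfolding modular_def by (rule nn_integral_eq_integral[symmetric, OF LqD(2)[OF vm]]) simp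
      also have "\<dots> = (\<integral>\<^sup>+x. liminf (\<lambda>k. ennreal (norm (\<phi> (r k) x) powr m)) \<partial>lebesgue_on \<Omega>)"
      proof (rule nn_integral_cong_AE, use conv in eventually_elim)
        case (elim x)
        show ?case using lim_imp_Liminf[OF sequentially_bot elim] by simp
      qed
      also have "\<dots> \<le> liminf (\<lambda>k. \<integral>\<^sup>+x. ennreal (norm (\<phi> (r k) x) powr m) \<partial>lebesgue_on \<Omega>)"
        by (rule nn_integral_liminf) measurable
      also have "\<dots> \<le> ennreal (S * K powr (m / 2))"
      proof (rule Liminf_le)
        have "eventually (\<lambda>k. modular \<Omega> m (\<phi> (r k)) \<le> S * K powr (m / 2)) sequentially"
          using eventually_subseq[OF r(1) ev] .
        then show "eventually (\<lambda>k. (\<integral>\<^sup>+x. ennreal (norm (\<phi> (r k) x) powr m) \<partial>lebesgue_on \<Omega>) \<le> ennreal (S * K powr (m / 2))) sequentially"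
        proof eventually_elim
          case (elim k)
          have "(\<integral>\<^sup>+x. ennreal (norm (\<phi> (r k) x) powr m) \<partial>lebesgue_on \<Omega>) = ennreal (modular \<Omega> m (\<phi> (r k)))"
            unfolding modular_def by (rule nn_integral_eq_integral[OF LqD(2)[OF \<phi>m]]) simp
          then show ?case using elim by (simp add: ennreal_leI)
        qed
      qed simp
      finally show ?thesis using S(1) by (simp add: ennreal_le_iff)
    qed
    have "((\<lambda>e. S * (modular \<Omega> 2 (grad \<Omega> v) + e) powr (m / 2)) \<longlongrightarrow> S * (modular \<Omega> 2 (grad \<Omega> v) + 0) powr (m / 2)) (at_right 0)"
      by (intro tendsto_intros tendsto_powr')
         (use m in \<open>auto intro!: eventually_mono[OF eventually_at_right_less[of 0]] add_nonneg_nonneg simp: modular_nonneg\<close>)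
    moreover have "eventually (\<lambda>e. modular \<Omega> m v \<le> S * (modular \<Omega> 2 (grad \<Omega> v) + e) powr (m / 2)) (at_right 0)"
      using eventually_at_right_less[of 0] by eventually_elim (rule main, simp)
    ultimately have "modular \<Omega> m v \<le> S * (modular \<Omega> 2 (grad \<Omega> v) + 0) powr (m / 2)"
      by (rule tendsto_lowerbound) simp
    then show ?thesis by simp
  qed
  then show ?thesis using S(1) by blast
qed

end

section \<open>The weak solution\<close>

text \<open>The primitive of \<open>f\<close> vanishes identically, and its derivative at a point of
  continuity is \<open>f s\<close>. This localises in time an identity known only after
  integration.\<close>

lemma zero_of_integrals_zero:
  fixes f :: "real \<Rightarrow> real"
  assumes int: "\<And>t. 0 \<le> t \<Longrightarrow> t < T \<Longrightarrow> set_integrable lborel {0<..<t} f \<and> (LINT s:{0<..<t}|lborel. f s) = 0"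
    and cont: "continuous_on {0<..<T} f" and s: "0 < s" "s < T"
  shows "f s = 0"
proof -
  define b where "b = (s + T) / 2"
  have b: "s < b" "b < T" using s by (auto simp: b_def)
  have I: "f integrable_on {0..t}" "integral {0..t} f = 0" if "0 \<le> t" "t < T" for t
    using set_borel_integral_eq_integral[of "{0<..<t}" f] int[OF that]
    by (auto simp: integrable_on_open_interval_real integral_open_interval_real)
  have "continuous (at s) f" using cont s by (simp add: continuous_on_eq_continuous_at)
  then have "((\<lambda>u. integral {0..u} f) has_vector_derivative f s) (at s within {0..b})"
    using integral_has_vector_derivative_continuous_at[of f 0 b s "{}"] I(1)[of b] b s
    by (auto intro: continuous_at_imp_continuous_within)
  then have 1: "((\<lambda>u. integral {0..u} f) has_vector_derivative f s) (at s)"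
    using b s by (simp add: at_within_Icc_at)
  have "((\<lambda>u. 0) has_vector_derivative (0::real)) (at s)" by simp
  then have "((\<lambda>u. integral {0..u} f) has_vector_derivative 0) (at s)"
    by (rule has_vector_derivative_transform_within_open[of _ _ _ "{0<..<b}"]) (use b s I in auto)
  from vector_derivative_unique_at[OF 1 this] show ?thesis .
qed

locale memory_solution = bounded_domain \<Omega> for \<Omega> :: "(real^'n) set" +
  fixes A :: "real \<Rightarrow> real^'n^'n" and g :: "real \<Rightarrow> real" and m :: real
    and u0 :: "real^'n \<Rightarrow> real^'n" and u :: "real \<Rightarrow> real^'n \<Rightarrow> real^'n"
  assumes A_cont: "continuous_on {0..} A"
    and g_nonneg: "\<And>t. t \<ge> 0 \<Longrightarrow> g t \<ge> 0" and g_anti: "antimono_on {0..} g"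
    and g_continuous: "continuous_on {0..} g"
    and m_ge2: "m \<ge> 2"
    and sol: "\<And>T. T > 0 \<Longrightarrow> weak_solution T \<Omega> A g m u0 u"
begin

text \<open>All functions of time are extended to negative times by their value at \<open>0\<close>, which makes them
  continuous on the whole line.\<close>

definition gg :: "real \<Rightarrow> real" where "gg t = g (max 0 t)"

definition Gu :: "real \<Rightarrow> real^'n \<Rightarrow> real^'n^'n" where "Gu t = grad \<Omega> (u (max 0 t))"

definition KK :: "real \<Rightarrow> real \<Rightarrow> real" where
  "KK s t = (LINT x|lebesgue_on \<Omega>. Gu s x \<bullet> Gu t x)"

definition WW :: "real \<Rightarrow> real \<Rightarrow> real" where
  "WW t r = KK t r - integral {0..t} (\<lambda>s. gg (t - s) * KK s r)"

lemma gg_props: "gg t \<ge> 0" "gg t \<le> g 0" "continuous_on UNIV gg"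
proof -
  show "gg t \<ge> 0" by (simp add: gg_def g_nonneg)
  show "gg t \<le> g 0" unfolding gg_def using g_anti by (auto simp: monotone_on_def)
  show "continuous_on UNIV gg" unfolding gg_def
    by (rule continuous_on_compose2[OF g_continuous]) (auto intro: continuous_intros)
qed

lemma u_H10: "t \<ge> 0 \<Longrightarrow> u t \<in> H10 \<Omega>"
  using sol[of "t + 1"] by (auto simp: weak_solution_def cont_H10_def)

lemma u_H1: "t \<ge> 0 \<Longrightarrow> u t \<in> H1 \<Omega>" using u_H10 by (auto simp: H10_def)

lemma Gu_L2: "Gu t \<in> Lq \<Omega> 2" unfolding Gu_def by (intro H1D(3) u_H1) simp

lemma KK_sym: "KK s t = KK t s" by (simp add: KK_def inner_commute)

lemma KK_self: "KK t t = modular \<Omega> 2 (Gu t)" by (simp add: KK_def modular_2_inner)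

lemma modular_Gu_diff: "modular \<Omega> 2 (\<lambda>x. Gu s x - Gu t x) = KK s s - 2 * KK s t + KK t t"
proof -
  have e: "(a - b) \<bullet> (a - b) = a \<bullet> a - 2 * (a \<bullet> b) + b \<bullet> b" for a b :: "real^'n^'n"
    by (simp add: inner_diff_left inner_diff_right inner_commute)
  show ?thesis unfolding modular_2_inner e KK_def
    using L2_inner(2)[OF Gu_L2[of s] Gu_L2[of s]] L2_inner(2)[OF Gu_L2[of s] Gu_L2[of t]] L2_inner(2)[OF Gu_L2[of t] Gu_L2[of t]]
    by simp
qed

lemma Gu_continuous:
  "((\<lambda>s. modular \<Omega> 2 (\<lambda>x. Gu s x - Gu t x)) \<longlongrightarrow> 0) (at t within {0..})" if t: "t \<ge> 0"
proof -
  have "((\<lambda>s. H1_norm \<Omega> (\<lambda>x. u s x - u t x)) \<longlongrightarrow> 0) (at t within {0..<t+1})"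
    using sol[of "t + 1"] t by (auto simp: weak_solution_def cont_H10_def)
  moreover have "at t within {0..<t+1} = at t within {0..}"
    by (rule at_within_nhd[of _ "{..<t+1}"]) auto
  ultimately have "((\<lambda>s. H1_norm \<Omega> (\<lambda>x. u s x - u t x)) \<longlongrightarrow> 0) (at t within {0..})" by simp
  then have "((\<lambda>s. (H1_norm \<Omega> (\<lambda>x. u s x - u t x))\<^sup>2) \<longlongrightarrow> 0\<^sup>2) (at t within {0..})" by (intro tendsto_intros)
  then have lim: "((\<lambda>s. (H1_norm \<Omega> (\<lambda>x. u s x - u t x))\<^sup>2) \<longlongrightarrow> 0) (at t within {0..})" by simp
  show ?thesis
  proof (rule tendsto_sandwich[OF _ _ tendsto_const lim])
    show "eventually (\<lambda>s. 0 \<le> modular \<Omega> 2 (\<lambda>x. Gu s x - Gu t x)) (at t within {0..})"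
      by (simp add: modular_nonneg)
    have "modular \<Omega> 2 (\<lambda>x. Gu s x - Gu t x) \<le> (H1_norm \<Omega> (\<lambda>x. u s x - u t x))\<^sup>2" if "s \<ge> 0" for s
      using that t by (simp add: H1_norm_diff_square[OF u_H1 u_H1] Gu_def max_def modular_nonneg)
    then show "eventually (\<lambda>s. modular \<Omega> 2 (\<lambda>x. Gu s x - Gu t x) \<le> (H1_norm \<Omega> (\<lambda>x. u s x - u t x))\<^sup>2) (at t within {0..})"
      by (auto simp: eventually_at_filter)
  qed
qed

lemma Gu_seq:
  assumes "X \<longlonglongrightarrow> t"
  shows "(\<lambda>k. modular \<Omega> 2 (\<lambda>x. Gu (X k) x - Gu t x)) \<longlonglongrightarrow> 0"
proof -
  let ?d = "\<lambda>s. modular \<Omega> 2 (\<lambda>x. Gu s x - Gu (max 0 t) x)"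
  have c: "continuous (at (max 0 t) within {0..}) ?d"
    using Gu_continuous[of "max 0 t"] by (simp add: continuous_within modular_def)
  have "(\<lambda>k. max 0 (X k)) \<longlonglongrightarrow> max 0 t" using assms by (intro tendsto_intros)
  then have "(?d \<circ> (\<lambda>k. max 0 (X k))) \<longlonglongrightarrow> ?d (max 0 t)"
    using c unfolding continuous_within_sequentially by auto
  then show ?thesis by (simp add: o_def Gu_def modular_def)
qed

text \<open>Adding and subtracting the mixed term and applying Cauchy-Schwarz reduces joint
  continuity to the continuity of the gradient in the square-integrable norm.\<close>

lemma KK_cont: "continuous_on UNIV (\<lambda>z. KK (fst z) (snd z))"
  unfolding continuous_on_sequentially
proof (intro allI ballI impI)
  fix X :: "nat \<Rightarrow> real \<times> real" and z assume "(\<forall>n. X n \<in> UNIV) \<and> X \<longlonglongrightarrow> z"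
  then have X: "(\<lambda>n. fst (X n)) \<longlonglongrightarrow> fst z" "(\<lambda>n. snd (X n)) \<longlonglongrightarrow> snd z"
    by (auto intro: tendsto_fst tendsto_snd)
  let ?a = "\<lambda>n. Gu (fst (X n))" and ?b = "\<lambda>n. Gu (snd (X n))"
  let ?az = "Gu (fst z)" and ?bz = "Gu (snd z)"
  let ?da = "\<lambda>n. modular \<Omega> 2 (\<lambda>x. ?a n x - ?az x)" and ?db = "\<lambda>n. modular \<Omega> 2 (\<lambda>x. ?b n x - ?bz x)"
  have bnd: "norm (KK (fst (X n)) (snd (X n)) - KK (fst z) (snd z))
     \<le> sqrt (?da n * (sqrt (modular \<Omega> 2 ?bz) + sqrt (?db n))\<^sup>2) + sqrt (modular \<Omega> 2 ?az * ?db n)" for n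
  proof -
    have da: "(\<lambda>x. ?a n x - ?az x) \<in> Lq \<Omega> 2" and db: "(\<lambda>x. ?b n x - ?bz x) \<in> Lq \<Omega> 2" by (intro Lq_diff Gu_L2; simp)+
    have "KK (fst (X n)) (snd (X n)) - KK (fst z) (snd z)
      = (LINT x|lebesgue_on \<Omega>. (?a n x - ?az x) \<bullet> ?b n x) + (LINT x|lebesgue_on \<Omega>. ?az x \<bullet> (?b n x - ?bz x))"
      unfolding KK_def using L2_inner(2)[OF Gu_L2 Gu_L2] by (simp add: inner_diff_left inner_diff_right)
    then have "norm (KK (fst (X n)) (snd (X n)) - KK (fst z) (snd z))
       \<le> sqrt (?da n * modular \<Omega> 2 (?b n)) + sqrt (modular \<Omega> 2 ?az * ?db n)"
      using L2_inner(4)[OF da Gu_L2[of "snd (X n)"]] L2_inner(4)[OF Gu_L2[of "fst z"] db]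
      by simp
    also have "modular \<Omega> 2 (?b n) = modular \<Omega> 2 (\<lambda>x. ?bz x + (?b n x - ?bz x))" by simp
    also have "sqrt (?da n * modular \<Omega> 2 (\<lambda>x. ?bz x + (?b n x - ?bz x))) \<le> sqrt (?da n * (sqrt (modular \<Omega> 2 ?bz) + sqrt (?db n))\<^sup>2)"
      by (intro real_sqrt_le_mono mult_left_mono modular_2_add Gu_L2 db modular_nonneg)
    finally show ?thesis by simp
  qed
  have "(\<lambda>n. sqrt (?da n * (sqrt (modular \<Omega> 2 ?bz) + sqrt (?db n))\<^sup>2) + sqrt (modular \<Omega> 2 ?az * ?db n))
     \<longlonglongrightarrow> sqrt (0 * (sqrt (modular \<Omega> 2 ?bz) + sqrt 0)\<^sup>2) + sqrt (modular \<Omega> 2 ?az * 0)"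
    by (intro tendsto_intros Gu_seq X)
  then have "(\<lambda>n. KK (fst (X n)) (snd (X n)) - KK (fst z) (snd z)) \<longlonglongrightarrow> 0"
    by (intro Lim_null_comparison[OF always_eventually[OF allI[OF bnd]]]) simp
  then show "((\<lambda>z. KK (fst z) (snd z)) \<circ> X) \<longlonglongrightarrow> KK (fst z) (snd z)"
    by (simp add: o_def LIM_zero_iff)
qed

lemma cont_KK [continuous_intros]:
  "continuous_on S a \<Longrightarrow> continuous_on S b \<Longrightarrow> continuous_on S (\<lambda>x. KK (a x) (b x))"
  using continuous_on_compose2[OF KK_cont, of S "\<lambda>x. (a x, b x)"] by (auto intro: continuous_intros)

lemma cont_gg [continuous_intros]: "continuous_on S a \<Longrightarrow> continuous_on S (\<lambda>x. gg (a x))"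
  by (rule continuous_on_compose2[OF gg_props(3)]) auto

lemma gradient_field_AE:
  assumes "gradient_field T \<Omega> u Du" "0 \<le> t" "t < T"
  shows "AE x in lebesgue_on \<Omega>. Du t x = Gu t x" "Du t \<in> Lq \<Omega> 2"
proof -
  have w: "weak_gradient \<Omega> (u t) (Du t)" using assms by (auto simp: gradient_field_def)
  show "AE x in lebesgue_on \<Omega>. Du t x = Gu t x"
    using weak_gradient_unique[OF w H1D(2)[OF u_H1]] assms by (simp add: Gu_def max_def)
  show "Du t \<in> Lq \<Omega> 2" using w by (simp add: weak_gradient_def)
qed

lemma Du_inner:
  assumes "gradient_field T \<Omega> u Du" "0 \<le> t" "t < T"
  shows "integrable (lebesgue_on \<Omega>) (\<lambda>x. Du t x \<bullet> Gu r x)" "(LINT x|lebesgue_on \<Omega>. Du t x \<bullet> Gu r x) = KK t r"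
proof -
  note D = gradient_field_AE[OF assms]
  note [measurable] = LqD(1)[OF D(2)] LqD(1)[OF Gu_L2]
  show "integrable (lebesgue_on \<Omega>) (\<lambda>x. Du t x \<bullet> Gu r x)" by (rule L2_inner(2)[OF D(2) Gu_L2])
  show "(LINT x|lebesgue_on \<Omega>. Du t x \<bullet> Gu r x) = KK t r"
    unfolding KK_def by (rule integral_cong_AE) (use D(1) in \<open>measurable, eventually_elim, simp\<close>)
qed

text \<open>Fubini: pairing the pointwise memory integral with a fixed gradient equals the memory
  integral of the pairings. This expresses the memory term of the equation through the kernel
  alone.\<close>

lemma memory_inner:
  assumes Du: "gradient_field T \<Omega> u Du" and s: "0 \<le> s" "s < T"
    and int: "AE x in lebesgue_on \<Omega>. set_integrable lborel {0..s} (\<lambda>\<tau>. g (s - \<tau>) *\<^sub>R Du \<tau> x)"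
  shows "(LINT x|lebesgue_on \<Omega>. memory g Du s x \<bullet> Gu r x) = integral {0..s} (\<lambda>\<tau>. gg (s - \<tau>) * KK \<tau> r)"
proof -
  define M where "M = restrict_space lborel {0..s}"
  have spM: "space M = {0..s}" by (simp add: M_def space_restrict_space)
  have fM: "finite_measure M"
    by (rule finite_measureI) (use s in \<open>simp add: M_def emeasure_restrict_space space_restrict_space\<close>)
  interpret M: finite_measure M by (rule fM)
  interpret P: pair_sigma_finite M "lebesgue_on \<Omega>" by standard
  let ?N = "M \<Otimes>\<^sub>M lebesgue_on \<Omega>"
  have fst_b: "fst \<in> ?N \<rightarrow>\<^sub>M borel"
    by (rule measurable_compose[OF measurable_fst]) (simp add: M_def measurable_restrict_space1)
  have snd_b: "snd \<in> ?N \<rightarrow>\<^sub>M borel"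
    by (rule measurable_compose[OF measurable_snd]) (intro measurable_restrict_space1 measurable_completion, simp)
  \<comment> \<open>The completed measure on \<open>\<Omega>\<close> has at least the Borel sets as
    measurable sets, so the joint Borel measurability of \<open>Du\<close> carries over to the
    product space.\<close>
  have id: "(\<lambda>z. z) \<in> ?N \<rightarrow>\<^sub>M restrict_space borel ({0..<T} \<times> \<Omega>)"
  proof (rule measurable_restrict_space2)
    show "(\<lambda>z. z) \<in> space ?N \<rightarrow> {0..<T} \<times> \<Omega>"
      using s by (auto simp: space_pair_measure spM space_restrict_space)
    show "(\<lambda>z. z) \<in> ?N \<rightarrow>\<^sub>M borel"
      using measurable_Pair[OF fst_b snd_b] by (simp add: borel_prod)
  qed
  have Dm: "(\<lambda>z. Du (fst z) (snd z)) \<in> borel_measurable ?N"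
    by (rule measurable_compose[OF id]) (use Du in \<open>simp add: gradient_field_def\<close>)
  have Gm: "(\<lambda>z. Gu r (snd z)) \<in> borel_measurable ?N"
    by (rule measurable_compose[OF measurable_snd LqD(1)[OF Gu_L2]])
  have gm: "(\<lambda>z. gg (s - fst z)) \<in> borel_measurable ?N"
    by (rule measurable_compose[OF fst_b]) (intro borel_measurable_continuous_onI continuous_intros)
  define f where "f \<tau> x = gg (s - \<tau>) * (Du \<tau> x \<bullet> Gu r x)" for \<tau> x
  have fm: "case_prod f \<in> borel_measurable ?N"
    unfolding split_beta' f_def using Dm Gm gm by (intro borel_measurable_times borel_measurable_inner)
  \<comment> \<open>The kernel is continuous on a compact interval; this uniform bound yields the
    absolute integrability that Fubini needs.\<close>
  obtain C where C: "\<And>\<tau>. \<tau> \<in> {0..s} \<Longrightarrow> KK \<tau> \<tau> \<le> C"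
  proof -
    have "bounded ((\<lambda>\<tau>. KK \<tau> \<tau>) ` {0..s})"
      by (intro compact_imp_bounded compact_continuous_image continuous_intros) auto
    then show thesis using that by (auto simp: bounded_iff) (meson abs_le_D1 atLeastAtMost_iff)
  qed
  have fi: "integrable ?N (case_prod f)"
  proof (rule P.Fubini_integrable[OF fm])
    show "AE \<tau> in M. integrable (lebesgue_on \<Omega>) (\<lambda>x. case (\<tau>, x) of (a, b) \<Rightarrow> f a b)"
      using Du_inner(1)[OF Du] s by (intro AE_I2) (auto simp: spM f_def)
    show "integrable M (\<lambda>\<tau>. LINT x|lebesgue_on \<Omega>. norm (case (\<tau>, x) of (a, b) \<Rightarrow> f a b))"
    proof (rule M.integrable_const_bound[of _ "g 0 * sqrt (C * KK r r)"])
      have "norm (LINT x|lebesgue_on \<Omega>. norm (f \<tau> x)) \<le> g 0 * sqrt (C * KK r r)" if "\<tau> \<in> {0..s}" for \<tau>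
      proof -
        have t: "0 \<le> \<tau>" "\<tau> < T" using that s by auto
        note D = gradient_field_AE[OF Du t]
        have mD: "modular \<Omega> 2 (Du \<tau>) = KK \<tau> \<tau>"
          unfolding KK_self by (rule modular_cong_AE[OF LqD(1)[OF D(2)] LqD(1)[OF Gu_L2] D(1)])
        have "(LINT x|lebesgue_on \<Omega>. norm (f \<tau> x)) \<le> (LINT x|lebesgue_on \<Omega>. g 0 * (norm (Du \<tau> x) * norm (Gu r x)))"
        proof (rule integral_mono)
          show "integrable (lebesgue_on \<Omega>) (\<lambda>x. norm (f \<tau> x))"
            unfolding f_def using Du_inner(1)[OF Du t] by (intro integrable_norm integrable_mult_right) auto
          show "integrable (lebesgue_on \<Omega>) (\<lambda>x. g 0 * (norm (Du \<tau> x) * norm (Gu r x)))"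
            using L2_inner(1)[OF D(2) Gu_L2] by simp
          show "norm (f \<tau> x) \<le> g 0 * (norm (Du \<tau> x) * norm (Gu r x))" for x
            unfolding f_def real_norm_def abs_mult
            using gg_props(1,2)[of "s - \<tau>"] Cauchy_Schwarz_ineq2[of "Du \<tau> x" "Gu r x"]
            by (intro mult_mono) auto
        qed
        also have "\<dots> = g 0 * (LINT x|lebesgue_on \<Omega>. norm (Du \<tau> x) * norm (Gu r x))" by simp
        also have "\<dots> \<le> g 0 * sqrt (C * KK r r)"
        proof (rule mult_left_mono)
          have "(LINT x|lebesgue_on \<Omega>. norm (Du \<tau> x) * norm (Gu r x)) \<le> sqrt (KK \<tau> \<tau> * KK r r)"
            using L2_inner(3)[OF D(2) Gu_L2[of r]] by (simp add: mD KK_self)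
          also have "\<dots> \<le> sqrt (C * KK r r)"
            using C[OF that] by (intro real_sqrt_le_mono mult_right_mono) (simp_all add: KK_self modular_nonneg)
          finally show "(LINT x|lebesgue_on \<Omega>. norm (Du \<tau> x) * norm (Gu r x)) \<le> sqrt (C * KK r r)" .
        qed (simp add: g_nonneg)
        finally show ?thesis by simp
      qed
      then show "AE \<tau> in M. norm (LINT x|lebesgue_on \<Omega>. norm (case (\<tau>, x) of (a, b) \<Rightarrow> f a b)) \<le> g 0 * sqrt (C * KK r r)"
        by (intro AE_I2) (simp add: spM)
      have "case_prod (\<lambda>\<tau> x. norm (f \<tau> x)) \<in> borel_measurable ?N"
        using measurable_compose[OF fm borel_measurable_norm] by (simp add: split_beta')
      then show "(\<lambda>\<tau>. LINT x|lebesgue_on \<Omega>. norm (case (\<tau>, x) of (a, b) \<Rightarrow> f a b)) \<in> borel_measurable M"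
        by simp
    qed
  qed
  have cg: "(indicator {0..s} \<tau> *\<^sub>R (g (s - \<tau>) *\<^sub>R Du \<tau> x)) = indicator {0..s} \<tau> *\<^sub>R (gg (s - \<tau>) *\<^sub>R Du \<tau> x)" for \<tau> x
    by (auto simp: indicator_def gg_def)
  have mem: "memory g Du s x = (LINT \<tau>|M. gg (s - \<tau>) *\<^sub>R Du \<tau> x)" for x
    unfolding memory_def set_lebesgue_integral_def M_def cg
    by (subst integral_restrict_space) auto
  have "(LINT x|lebesgue_on \<Omega>. memory g Du s x \<bullet> Gu r x) = (LINT x|lebesgue_on \<Omega>. LINT \<tau>|M. f \<tau> x)"
  proof (rule integral_cong_AE)
    have sw: "case_prod (\<lambda>x \<tau>. gg (s - \<tau>) *\<^sub>R Du \<tau> x) \<in> borel_measurable (lebesgue_on \<Omega> \<Otimes>\<^sub>M M)"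
      using measurable_pair_swap[OF borel_measurable_scaleR[OF gm Dm]] by simp
    have "(\<lambda>x. memory g Du s x) \<in> borel_measurable (lebesgue_on \<Omega>)"
      unfolding mem by (rule M.borel_measurable_lebesgue_integral[OF sw])
    then show "(\<lambda>x. memory g Du s x \<bullet> Gu r x) \<in> borel_measurable (lebesgue_on \<Omega>)"
      using LqD(1)[OF Gu_L2] by (rule borel_measurable_inner)
    have "case_prod (\<lambda>x \<tau>. f \<tau> x) \<in> borel_measurable (lebesgue_on \<Omega> \<Otimes>\<^sub>M M)"
      using measurable_pair_swap[OF fm] by simp
    then show "(\<lambda>x. LINT \<tau>|M. f \<tau> x) \<in> borel_measurable (lebesgue_on \<Omega>)"
      by (rule M.borel_measurable_lebesgue_integral)
    show "AE x in lebesgue_on \<Omega>. memory g Du s x \<bullet> Gu r x = (LINT \<tau>|M. f \<tau> x)"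
      using int
    proof eventually_elim
      case (elim x)
      then have "integrable lborel (\<lambda>\<tau>. indicator {0..s} \<tau> *\<^sub>R (gg (s - \<tau>) *\<^sub>R Du \<tau> x))"
        by (simp only: set_integrable_def cg)
      then have "integrable M (\<lambda>\<tau>. gg (s - \<tau>) *\<^sub>R Du \<tau> x)"
        unfolding M_def by (subst integrable_restrict_space) auto
      then have "(LINT \<tau>|M. gg (s - \<tau>) *\<^sub>R Du \<tau> x) \<bullet> Gu r x = (LINT \<tau>|M. (gg (s - \<tau>) *\<^sub>R Du \<tau> x) \<bullet> Gu r x)"
        by (intro integral_inner_left[symmetric])
      then show ?case by (simp add: mem f_def)
    qed
  qed
  also have "\<dots> = (LINT \<tau>|M. LINT x|lebesgue_on \<Omega>. f \<tau> x)" by (rule P.Fubini_integral[OF fi])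
  also have "\<dots> = (LINT \<tau>|M. gg (s - \<tau>) * KK \<tau> r)"
    by (rule Bochner_Integration.integral_cong) (use Du_inner(2)[OF Du] s in \<open>auto simp: spM f_def\<close>)
  also have "\<dots> = (LINT \<tau>:{0..s}|lborel. gg (s - \<tau>) * KK \<tau> r)"
    unfolding M_def set_lebesgue_integral_def by (subst integral_restrict_space) auto
  also have "\<dots> = integral {0..s} (\<lambda>\<tau>. gg (s - \<tau>) * KK \<tau> r)"
    by (rule set_borel_integral_eq_integral(2)) (intro borel_integrable_atLeastAtMost' continuous_intros)
  finally show ?thesis .
qed

lemma WW_cont: "continuous_on {0..} (\<lambda>s. WW s r)"
  unfolding WW_def by (intro continuous_intros continuous_on_integral_upto)

lemma A_tendsto: "t > 0 \<Longrightarrow> (A \<longlongrightarrow> A t) (at t)"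
proof -
  assume t: "t > 0"
  have "continuous_on {0<..} A" by (rule continuous_on_subset[OF A_cont]) auto
  then have "isCont A t" using t by (simp add: continuous_on_eq_continuous_at)
  then show ?thesis by (simp add: isCont_def)
qed

text \<open>Testing with the constant-in-time function \<open>u r\<close> gives an identity
  integrated over each \<open>(0, t)\<close>; both integrands are continuous in time, so it holds at
  every instant. The time \<open>r\<close> is positive because \<open>u r\<close> is known to have
  values in \<open>L^m\<close> only there.\<close>

lemma weak_form:
  assumes T: "T > 0"
  shows "\<exists>ut. C1_Lq_with_derivative {0<..<T} \<Omega> m u ut \<and>
    (\<forall>s\<in>{0<..<T}. \<forall>r\<in>{0<..<T}. WW s r = - pairing \<Omega> m (A s) (ut s) (u r))"
proof -
  obtain Du ut where Du: "gradient_field T \<Omega> u Du" and ut: "C1_Lq_with_derivative {0<..<T} \<Omega> m u ut"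
    and int: "\<And>s. s \<in> {0..<T} \<Longrightarrow> AE x in lebesgue_on \<Omega>. set_integrable lborel {0..s} (\<lambda>\<tau>. g (s - \<tau>) *\<^sub>R Du \<tau> x)"
    and eq: "\<And>t \<phi>. t \<in> {0..<T} \<Longrightarrow> cont_H10 {0..<T} \<Omega> \<phi> \<Longrightarrow>
         (let F = (\<lambda>s x. (Du s x - memory g Du s x) \<bullet> grad \<Omega> (\<phi> s) x);
              D = (\<lambda>s x. (A s *v (norm (ut s x) powr (m - 2) *\<^sub>R ut s x)) \<bullet> \<phi> s x)
          in (\<forall>s\<in>{0<..<t}. integrable (lebesgue_on \<Omega>) (F s) \<and> integrable (lebesgue_on \<Omega>) (D s)) \<and>
             set_integrable lborel {0<..<t} (\<lambda>s. LINT x|lebesgue_on \<Omega>. F s x) \<and>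
             set_integrable lborel {0<..<t} (\<lambda>s. LINT x|lebesgue_on \<Omega>. D s x) \<and>
             (LINT s:{0<..<t}|lborel. LINT x|lebesgue_on \<Omega>. F s x) +
             (LINT s:{0<..<t}|lborel. LINT x|lebesgue_on \<Omega>. D s x) = 0)"
    using sol[OF T] unfolding weak_solution_def by blast
  have "WW s r = - pairing \<Omega> m (A s) (ut s) (u r)" if s: "s \<in> {0<..<T}" and r: "r \<in> {0<..<T}" for s r
  proof -
    have r0: "r \<ge> 0" using r by simp
    have Gr: "grad \<Omega> (u r) = Gu r" using r0 by (simp add: Gu_def max_def)
    have c: "cont_H10 {0..<T} \<Omega> (\<lambda>_. u r)"
      unfolding cont_H10_def using u_H10[OF r0] H1_norm_self[OF u_H1[OF r0]] by auto
    let ?F = "\<lambda>s x. (Du s x - memory g Du s x) \<bullet> Gu r x"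
    let ?D = "\<lambda>s. pairing \<Omega> m (A s) (ut s) (u r)"
    have E: "\<And>s. s \<in> {0<..<t} \<Longrightarrow> integrable (lebesgue_on \<Omega>) (?F s)"
        "set_integrable lborel {0<..<t} (\<lambda>s. LINT x|lebesgue_on \<Omega>. ?F s x)"
        "set_integrable lborel {0<..<t} ?D"
        "(LINT s:{0<..<t}|lborel. LINT x|lebesgue_on \<Omega>. ?F s x) + (LINT s:{0<..<t}|lborel. ?D s) = 0"
      if "t \<in> {0..<T}" for t
      using eq[OF that c] unfolding Let_def Gr pairing_def power_map_def by blast+
    have F: "(LINT x|lebesgue_on \<Omega>. ?F s x) = WW s r" if t: "t \<in> {0..<T}" "s \<in> {0<..<t}" for s t
    proof -
      have s: "0 \<le> s" "s < T" "s \<in> {0..<T}" using t by auto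
      note D = Du_inner[OF Du s(1,2), of r]
      have "integrable (lebesgue_on \<Omega>) (\<lambda>x. Du s x \<bullet> Gu r x - ?F s x)"
        using D(1) E(1)[OF t] by (rule Bochner_Integration.integrable_diff)
      then have i: "integrable (lebesgue_on \<Omega>) (\<lambda>x. memory g Du s x \<bullet> Gu r x)"
        by (simp add: inner_diff_left)
      have "(LINT x|lebesgue_on \<Omega>. ?F s x) = KK s r - (LINT x|lebesgue_on \<Omega>. memory g Du s x \<bullet> Gu r x)"
        using D i by (simp add: inner_diff_left)
      then show ?thesis using memory_inner[OF Du s(1,2) int[OF s(3)], of r] by (simp add: WW_def)
    qed
    have "WW s r + ?D s = 0"
    proof (rule zero_of_integrals_zero[of T "\<lambda>s. WW s r + ?D s"])
      fix t assume "0 \<le> t" "t < T"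
      then have t: "t \<in> {0..<T}" by simp
      have i1: "set_integrable lborel {0<..<t} (\<lambda>s. WW s r)"
        using E(2)[OF t] F[OF t] by (subst set_integrable_cong[OF refl refl, of _ _ "\<lambda>s. LINT x|lebesgue_on \<Omega>. ?F s x"]) auto
      have "(LINT s:{0<..<t}|lborel. WW s r) = (LINT s:{0<..<t}|lborel. LINT x|lebesgue_on \<Omega>. ?F s x)"
        using F[OF t] by (intro set_lebesgue_integral_cong) auto
      then show "set_integrable lborel {0<..<t} (\<lambda>s. WW s r + ?D s) \<and> (LINT s:{0<..<t}|lborel. WW s r + ?D s) = 0"
        using i1 E(3,4)[OF t] by (simp add: set_integral_add)
    next
      have "continuous_on {0<..<T} (\<lambda>s. WW s r)" by (rule continuous_on_subset[OF WW_cont]) force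
      moreover have "continuous_on {0<..<T} ?D"
      \<comment> \<open>Continuity of the damping term in time: \<open>A\<close> and the velocity
        are continuous, while the second argument of the pairing is frozen at
        \<open>u r\<close>.\<close>
      proof (intro continuous_at_imp_continuous_on ballI)
        fix t assume t: "t \<in> {0<..<T}"
        have atw: "at t within {0<..<T} = at t" by (rule at_within_open[OF t]) simp
        have L: "u r \<in> Lq \<Omega> m" "\<And>s. s \<in> {0<..<T} \<Longrightarrow> ut s \<in> Lq \<Omega> m"
          using ut r by (auto simp: C1_Lq_with_derivative_def)
        have "((\<lambda>s. Lq_norm \<Omega> m (\<lambda>x. ut s x - ut t x)) \<longlongrightarrow> 0) (at t within {0<..<T})"
          using ut t by (auto simp: C1_Lq_with_derivative_def)
        then have "((\<lambda>s. Lq_norm \<Omega> m (\<lambda>x. ut s x - ut t x)) \<longlongrightarrow> 0) (at t)" unfolding atw .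
        then have l: "((\<lambda>s. modular \<Omega> m (\<lambda>x. ut s x - ut t x)) \<longlongrightarrow> 0) (at t)"
          using m_ge2 by (intro modular_tendsto_0) auto
        have ev: "eventually (\<lambda>s. ut s \<in> Lq \<Omega> m \<and> u r \<in> Lq \<Omega> m) (at t)"
          using eventually_at_in_open'[of "{0<..<T}" t] t by (auto elim!: eventually_mono intro: L)
        have "((\<lambda>s. ?D s) \<longlongrightarrow> ?D t) (at t)"
          by (rule pairing_tendsto[OF m_ge2 ev L(2)[OF t] L(1) A_tendsto l]) (use t in \<open>auto simp: modular_def\<close>)
        then show "isCont ?D t" by (simp add: isCont_def)
      qed
      ultimately show "continuous_on {0<..<T} (\<lambda>s. WW s r + ?D s)" by (rule continuous_on_add)
    qed (use s in auto)
    then show ?thesis by simp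
  qed
  then show ?thesis using ut by blast
qed

text \<open>The time derivative provided by the notion of solution may depend on the horizon \<open>T\<close>; at time
  \<open>t\<close> the horizon \<open>t + 1\<close> is used.\<close>

definition ut :: "real \<Rightarrow> real \<Rightarrow> real^'n \<Rightarrow> real^'n" where
  "ut T = (SOME v. C1_Lq_with_derivative {0<..<T} \<Omega> m u v \<and>
    (\<forall>s\<in>{0<..<T}. \<forall>r\<in>{0<..<T}. WW s r = - pairing \<Omega> m (A s) (v s) (u r)))"

lemma ut_props:
  assumes "T > 0"
  shows "C1_Lq_with_derivative {0<..<T} \<Omega> m u (ut T)"
    "s \<in> {0<..<T} \<Longrightarrow> r \<in> {0<..<T} \<Longrightarrow> WW s r = - pairing \<Omega> m (A s) (ut T s) (u r)"
  using someI_ex[OF weak_form[OF assms]] unfolding ut_def by auto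

definition PP :: "real \<Rightarrow> real" where
  "PP t = pairing \<Omega> m (A t) (ut (t + 1) t) (ut (t + 1) t)"

text \<open>The quotient of \<open>WW\<close> in its second argument is minus the pairing with the
  difference quotient of \<open>u\<close>, which converges in \<open>L^m\<close> to the velocity. In
  the second limit the matrix and the velocity inside the pairing converge as well.\<close>

lemma limits:
  assumes t: "t > 0"
  shows "((\<lambda>h. (WW t (t + h) - WW t t) / h) \<longlongrightarrow> - PP t) (at_right 0)"
    "((\<lambda>h. (WW (t + h) (t + h) - WW (t + h) t) / h) \<longlongrightarrow> - PP t) (at_right 0)"
proof -
  define T where "T = t + 1"
  define v where "v = ut T"
  have T: "T > 0" "t \<in> {0<..<T}" using t by (auto simp: T_def)
  note C = ut_props(1)[OF T(1), folded v_def, unfolded C1_Lq_with_derivative_def]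
  note W = ut_props(2)[OF T(1), folded v_def]
  have L: "u s \<in> Lq \<Omega> m" "v s \<in> Lq \<Omega> m" if "s \<in> {0<..<T}" for s using C that by auto
  have shift: "filterlim (\<lambda>h. t + h) (at t within {0<..<T}) (at_right 0)"
  proof -
    have "((\<lambda>h. t + h) \<longlongrightarrow> t + 0) (at_right 0)" by (intro tendsto_intros)
    moreover have "eventually (\<lambda>h. t + h \<in> {0<..<T} \<and> t + h \<noteq> t) (at_right 0)"
      using t by (auto simp: eventually_at_right_field T_def intro!: exI[of _ 1])
    ultimately show ?thesis by (simp add: filterlim_at)
  qed
  have evh: "eventually (\<lambda>h. h > 0 \<and> t + h \<in> {0<..<T}) (at_right 0)"
    using t by (auto simp: eventually_at_right_field T_def intro!: exI[of _ 1])
  let ?q = "\<lambda>h x. (1 / h) *\<^sub>R (u (t + h) x - u t x)"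
  have "((\<lambda>s. modular \<Omega> m (\<lambda>x. (1 / (s - t)) *\<^sub>R (u s x - u t x) - v t x)) \<longlongrightarrow> 0) (at t within {0<..<T})"
    using C T m_ge2 by (intro modular_tendsto_0) auto
  from filterlim_compose[OF this shift]
  have lq: "((\<lambda>h. modular \<Omega> m (\<lambda>x. ?q h x - v t x)) \<longlongrightarrow> 0) (at_right 0)" by simp
  have "((\<lambda>s. modular \<Omega> m (\<lambda>x. v s x - v t x)) \<longlongrightarrow> 0) (at t within {0<..<T})"
    using C T m_ge2 by (intro modular_tendsto_0) auto
  from filterlim_compose[OF this shift]
  have lv: "((\<lambda>h. modular \<Omega> m (\<lambda>x. v (t + h) x - v t x)) \<longlongrightarrow> 0) (at_right 0)" .
  have "(A \<longlongrightarrow> A t) (at t within {0<..<T})" by (rule tendsto_within_subset[OF A_tendsto[OF t]]) simp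
  from filterlim_compose[OF this shift]
  have lA: "((\<lambda>h. A (t + h)) \<longlongrightarrow> A t) (at_right 0)" .
  have Lqh: "?q h \<in> Lq \<Omega> m" if "t + h \<in> {0<..<T}" for h
    using L[OF that] L[OF T(2)] m_ge2 by (intro Lq_scale(1) Lq_diff) auto
  have quot: "(WW s (t + h) - WW s t) / h = - pairing \<Omega> m (A s) (v s) (?q h)"
    if "s \<in> {0<..<T}" "t + h \<in> {0<..<T}" for s h
    using W[OF that(1,2)] W[OF that(1) T(2)] pairing_diff[OF L(2)[OF that(1)] L(1)[OF that(2)] L(1)[OF T(2)] m_ge2]
    by (simp add: pairing_scale diff_divide_distrib)
  have P: "PP t = pairing \<Omega> m (A t) (v t) (v t)" by (simp add: PP_def v_def T_def)
  have "((\<lambda>h. - pairing \<Omega> m (A t) (v t) (?q h)) \<longlongrightarrow> - PP t) (at_right 0)"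
    unfolding P
    by (intro tendsto_minus pairing_tendsto[OF m_ge2 _ _ _ _ _ lq])
       (use evh L[OF T(2)] in \<open>auto simp: modular_def elim!: eventually_mono intro: Lqh\<close>)
  then show "((\<lambda>h. (WW t (t + h) - WW t t) / h) \<longlongrightarrow> - PP t) (at_right 0)"
    by (rule Lim_transform_eventually) (use evh in \<open>eventually_elim, use quot[OF T(2)] in simp\<close>)
  have "((\<lambda>h. - pairing \<Omega> m (A (t + h)) (v (t + h)) (?q h)) \<longlongrightarrow> - PP t) (at_right 0)"
    unfolding P
    by (intro tendsto_minus pairing_tendsto[OF m_ge2 _ _ _ lA lv lq])
       (use evh L[OF T(2)] L in \<open>auto elim!: eventually_mono intro: Lqh\<close>)
  then show "((\<lambda>h. (WW (t + h) (t + h) - WW (t + h) t) / h) \<longlongrightarrow> - PP t) (at_right 0)"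
    by (rule Lim_transform_eventually) (use evh in \<open>eventually_elim, use quot in simp\<close>)
qed

text \<open>Coercivity of \<open>A t\<close> times \<open>norm w powr (m - 2)\<close>, integrated:
  the damping power controls the velocity in \<open>L^m\<close>.\<close>

lemma PP_ge:
  assumes c0: "c0 > 0" "\<And>t v. t \<ge> 0 \<Longrightarrow> (A t *v v) \<bullet> v \<ge> c0 * (norm v)\<^sup>2" and t: "t > 0"
  shows "c0 * modular \<Omega> m (ut (t + 1) t) \<le> PP t" "ut (t + 1) t \<in> Lq \<Omega> m" "u t \<in> Lq \<Omega> m"
proof -
  let ?v = "ut (t + 1) t"
  show L: "?v \<in> Lq \<Omega> m" "u t \<in> Lq \<Omega> m"
    using ut_props(1)[of "t + 1"] t by (auto simp: C1_Lq_with_derivative_def)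
  have pw: "c0 * norm w powr m \<le> (A t *v power_map m w) \<bullet> w" for w
  proof -
    have "norm w powr (m - 2) * (c0 * (norm w)\<^sup>2) \<le> norm w powr (m - 2) * ((A t *v w) \<bullet> w)"
      using c0(2)[of t w] t by (intro mult_left_mono) auto
    moreover have "norm w powr (m - 2) * (norm w)\<^sup>2 = norm w powr m"
    proof -
      have "norm w powr (m - 2) * norm w powr 2 = norm w powr m" by (simp only: powr_add[symmetric]) simp
      then show ?thesis by simp
    qed
    ultimately show ?thesis by (simp add: power_map_def matrix_vector_mult_scaleR mult_ac)
  qed
  have "c0 * modular \<Omega> m ?v = (LINT x|lebesgue_on \<Omega>. c0 * norm (?v x) powr m)" by (simp add: modular_def)
  also have "\<dots> \<le> PP t" unfolding PP_def pairing_def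
    using LqD(2)[OF L(1)] pairing_integrable[OF L(1,1) m_ge2] by (intro integral_mono pw) auto
  finally show "c0 * modular \<Omega> m ?v \<le> PP t" .
qed

text \<open>At equal times \<open>WW t t\<close> is minus the pairing of the velocity with
  \<open>u t\<close>. Young's inequality separates the two; the velocity is bounded through
  \<open>PP t\<close> with a factor \<open>1 / c0\<close>, and \<open>u t\<close> through the
  Sobolev constant \<open>S\<close>.\<close>

lemma damping_bound:
  assumes c0: "c0 > 0" "\<And>t v. t \<ge> 0 \<Longrightarrow> (A t *v v) \<bullet> v \<ge> c0 * (norm v)\<^sup>2"
    and A: "bounded (A ` {0..})" and n: "CARD('n) \<ge> 3 \<Longrightarrow> m \<le> 2 * real CARD('n) / (real CARD('n) - 2)"
  shows "\<exists>B\<ge>0. \<forall>t>0. \<forall>\<mu>>0. \<bar>WW t t\<bar> \<le> B * (PP t / \<mu> + \<mu> powr (m - 1) * KK t t powr (m / 2))"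
proof -
  obtain a where a: "a > 0" "\<And>t. t \<ge> 0 \<Longrightarrow> norm (A t) \<le> a"
    using A unfolding bounded_pos by auto
  obtain S where S: "S \<ge> 0" "\<And>v. v \<in> H10 \<Omega> \<Longrightarrow> v \<in> Lq \<Omega> m \<Longrightarrow> modular \<Omega> m v \<le> S * modular \<Omega> 2 (grad \<Omega> v) powr (m / 2)"
    using sobolev_H10[OF m_ge2 n] by blast
  define B where "B = a * (1 / c0 + S)"
  have "\<bar>WW t t\<bar> \<le> B * (PP t / \<mu> + \<mu> powr (m - 1) * KK t t powr (m / 2))" if t: "t > 0" and \<mu>: "\<mu> > 0" for t \<mu>
  proof -
    note P = PP_ge[OF c0 t]
    let ?v = "ut (t + 1) t" and ?K = "\<mu> powr (m - 1) * KK t t powr (m / 2)"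
    have P0: "PP t / \<mu> \<ge> 0" using P(1) c0(1) modular_nonneg[of \<Omega> m ?v] \<mu>
      by (smt (verit) divide_nonneg_pos mult_nonneg_nonneg)
    have "\<bar>WW t t\<bar> = \<bar>pairing \<Omega> m (A t) ?v (u t)\<bar>"
      using ut_props(2)[of "t + 1" t t] t by simp
    also have "\<dots> \<le> norm (A t) * (modular \<Omega> m ?v / \<mu> + \<mu> powr (m - 1) * modular \<Omega> m (u t))"
      by (rule pairing_bound[OF P(2,3) m_ge2 \<mu>])
    also have "\<dots> \<le> a * (PP t / c0 / \<mu> + \<mu> powr (m - 1) * (S * KK t t powr (m / 2)))"
    proof (intro mult_mono add_mono divide_right_mono mult_left_mono)
      show "modular \<Omega> m ?v \<le> PP t / c0" using P(1) c0(1) by (simp add: field_simps)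
      show "modular \<Omega> m (u t) \<le> S * KK t t powr (m / 2)"
        using S(2)[OF u_H10 P(3)] t by (simp add: KK_self Gu_def max_def)
      show "0 \<le> modular \<Omega> m ?v / \<mu> + \<mu> powr (m - 1) * modular \<Omega> m (u t)"
        using \<mu> modular_nonneg[of \<Omega> m] by (intro add_nonneg_nonneg mult_nonneg_nonneg divide_nonneg_pos) auto
    qed (use a t \<mu> modular_nonneg in auto)
    also have "\<dots> = a * (1 / c0 * (PP t / \<mu>) + S * ?K)" by simp
    also have "\<dots> \<le> a * ((1 / c0 + S) * (PP t / \<mu>) + (1 / c0 + S) * ?K)"
      using a c0 S(1) P0 by (intro mult_left_mono add_mono mult_right_mono) auto
    also have "\<dots> = B * (PP t / \<mu> + ?K)" unfolding B_def by (simp only: distrib_left[symmetric] mult.assoc)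
    finally show ?thesis .
  qed
  moreover have "B \<ge> 0" using a c0 S by (simp add: B_def)
  ultimately show ?thesis by blast
qed

end

section \<open>Decay of the energy\<close>

lemma set_lborel_integral_Icc:
  fixes f h :: "real \<Rightarrow> real"
  assumes "continuous_on {0..t} h" "\<And>s. 0 \<le> s \<Longrightarrow> s \<le> t \<Longrightarrow> f s = h s"
  shows "(LINT s:{0..t}|lborel. f s) = integral {0..t} h"
proof -
  have "(LINT s:{0..t}|lborel. f s) = (LINT s:{0..t}|lborel. h s)"
    using assms(2) by (intro set_lebesgue_integral_cong) auto
  then show ?thesis
    using set_borel_integral_eq_integral(2)[OF borel_integrable_atLeastAtMost'[OF assms(1)]] by simp
qed

theorem theorem3p3:
  fixes \<Omega> :: "(real^'n) set"
    and A :: "real \<Rightarrow> real^'n^'n"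
    and g g' \<xi> :: "real \<Rightarrow> real"
    and c0 l p m :: real
    and u0 :: "real^'n \<Rightarrow> real^'n"
    and u :: "real \<Rightarrow> real^'n \<Rightarrow> real^'n"
  assumes "open \<Omega>" and "connected \<Omega>" and "\<Omega> \<noteq> {}" and "bounded \<Omega>" and "smooth_boundary \<Omega>"
    and "continuous_on {0..} A" and "bounded (A ` {0..})"
    and "c0 > 0" and "\<And>t v. t \<ge> 0 \<Longrightarrow> (A t *v v) \<bullet> v \<ge> c0 * (norm v)\<^sup>2"
    and "\<And>t. t \<ge> 0 \<Longrightarrow> g t \<ge> 0" and "g 0 > 0" and "antimono_on {0..} g"
    and "\<And>t. t \<ge> 0 \<Longrightarrow> (g has_real_derivative g' t) (at t within {0..})"
    and "set_integrable lborel {0..} g" and "1 - (LINT s:{0..}|lborel. g s) = l" and "l > 0"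
    and "1 \<le> p" and "p < 3/2"
    and "\<And>t. t \<ge> 0 \<Longrightarrow> \<xi> t \<ge> 0" and "antimono_on {0..} \<xi>" and "\<xi> differentiable_on {0..}"
    and "\<And>t. t \<ge> 0 \<Longrightarrow> g' t \<le> - \<xi> t * g t powr p"
    and "2 \<le> m" and "CARD('n) \<ge> 3 \<Longrightarrow> m \<le> 2 * real CARD('n) / (real CARD('n) - 2)"
    and "\<And>T. T > 0 \<Longrightarrow> weak_solution T \<Omega> A g m u0 u"
  shows "\<exists>L0>0. \<exists>L1>0.
    (p = 1 \<longrightarrow> (\<forall>t\<ge>0. energy \<Omega> g u t \<le> L0 * exp (- L1 * (LINT s:{0..t}|lborel. \<xi> s)))) \<and>
    (p > 1 \<longrightarrow> (\<forall>t\<ge>0. energy \<Omega> g u t \<le>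
        L0 * (1 + (LINT s:{0..t}|lborel. \<xi> s powr (2*p - 1))) powr (-1 / (2*p - 2)))) \<and>
    (p > 1 \<and>
     (\<integral>\<^sup>+ t\<in>{0..}. ennreal ((1 + (LINT s:{0..t}|lborel. \<xi> s powr (2*p - 1))) powr (-1 / (2*p - 2))) \<partial>lborel) < \<infinity>
     \<longrightarrow> (\<forall>t\<ge>0. energy \<Omega> g u t \<le>
        L0 * (1 + (LINT s:{0..t}|lborel. \<xi> s powr p)) powr (-1 / (p - 1))))"
proof -
  note g_nonneg = assms(10) and g_anti = assms(12) and g_deriv = assms(13)
    and \<xi>_nonneg = assms(19) and \<xi>_anti = assms(20) and g'_le = assms(22)
  have g_cont: "continuous_on {0..} g"
    by (rule DERIV_continuous_on[where D = g']) (use g_deriv in auto)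
  interpret memory_solution \<Omega> A g m u0 u
    by unfold_locales (use assms g_cont in auto)
  define X where "X t = \<xi> (max 0 t)" for t
  have \<xi>_cont: "continuous_on {0..} \<xi>" by (rule differentiable_imp_continuous_on[OF assms(21)])
  have X_cont: "continuous_on UNIV X" unfolding X_def
    by (rule continuous_on_compose2[OF \<xi>_cont]) (auto intro: continuous_intros)
  have X_nonneg: "X t \<ge> 0" for t using \<xi>_nonneg by (simp add: X_def)
  have X_eq: "s \<ge> 0 \<Longrightarrow> \<xi> s = X s" for s by (simp add: X_def max_def)
  have gg_eq: "s \<ge> 0 \<Longrightarrow> g s = gg s" for s by (simp add: gg_def max_def)
  have int_gg: "(LINT s:{0..t}|lborel. g s) = integral {0..t} gg" for t
    by (rule set_lborel_integral_Icc) (auto intro: continuous_intros gg_eq)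
  have int_g_le: "l \<le> 1 - integral {0..t} gg" for t
  proof -
    have "(LINT s:{0..t}|lborel. g s) \<le> (LINT s:{0..}|lborel. g s)"
      unfolding set_lebesgue_integral_def
    proof (rule integral_mono)
      show "integrable lborel (\<lambda>s. indicator {0..t} s *\<^sub>R g s)"
        using set_integrable_subset[OF assms(14), of "{0..t}"] by (auto simp: set_integrable_def)
      show "integrable lborel (\<lambda>s. indicator {0..} s *\<^sub>R g s)" using assms(14) by (simp add: set_integrable_def)
      show "indicator {0..t} s *\<^sub>R g s \<le> indicator {0..} s *\<^sub>R g s" for s
        using g_nonneg[of s] by (auto simp: indicator_def)
    qed
    then show ?thesis using assms(15) int_gg[of t] by simp
  qed
  \<comment> \<open>The mean value theorem gives an intermediate time \<open>z\<close>; monotonicity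
    of \<open>\<xi>\<close> and \<open>g\<close> replaces it by the right endpoint, where the
    product is smallest.\<close>
  have decr: "h * (X (s + h) * gg (s + h) powr p) \<le> gg s - gg (s + h)" if s: "0 \<le> s" "h \<ge> 0" for s h
  proof (cases "h = 0")
    case False
    then have h: "h > 0" using s by simp
    have "continuous_on {s..s+h} g" by (rule continuous_on_subset[OF g_cont]) (use s in auto)
    moreover have "(g has_derivative (\<lambda>y. g' x * y)) (at x)" if "s < x" "x < s + h" for x
    proof -
      have "at x within {0..} = at x" using that s by (intro at_within_interior) auto
      then show ?thesis using g_deriv[of x] that s by (simp add: has_field_derivative_def)
    qed
    ultimately obtain z where z: "s < z" "z < s + h" "g (s + h) - g s = g' z * (s + h - s)"
      using mvt[of s "s + h" g "\<lambda>x y. g' x * y"] h by auto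
    have "\<xi> (s + h) * g (s + h) powr p \<le> \<xi> z * g z powr p"
      using \<xi>_anti g_anti z s h \<xi>_nonneg[of z] g_nonneg[of "s + h"] assms(17)
      by (intro mult_mono powr_mono2) (auto simp: monotone_on_def)
    then have "g' z \<le> - (\<xi> (s + h) * g (s + h) powr p)" using g'_le[of z] z s by simp
    then have "g' z * h \<le> - (\<xi> (s + h) * g (s + h) powr p) * h" using h by (intro mult_right_mono) auto
    then show ?thesis using z s h gg_eq[of s] gg_eq[of "s + h"] X_eq[of "s + h"] by (simp add: mult.commute)
  qed simp
  have KK_CS: "(KK s t - KK t t)\<^sup>2 \<le> (KK s s - 2 * KK s t + KK t t) * KK t t" for s t
  proof -
    have d: "(\<lambda>x. Gu s x - Gu t x) \<in> Lq \<Omega> 2" by (intro Lq_diff Gu_L2) simp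
    have "KK s t - KK t t = (LINT x|lebesgue_on \<Omega>. (Gu s x - Gu t x) \<bullet> Gu t x)"
      unfolding KK_def using L2_inner(2)[OF Gu_L2 Gu_L2] by (simp add: inner_diff_left)
    then have "\<bar>KK s t - KK t t\<bar> \<le> sqrt ((KK s s - 2 * KK s t + KK t t) * KK t t)"
      using L2_inner(4)[OF d Gu_L2[of t]] by (simp add: modular_Gu_diff KK_self[of t])
    then have "\<bar>KK s t - KK t t\<bar>\<^sup>2 \<le> (sqrt ((KK s s - 2 * KK s t + KK t t) * KK t t))\<^sup>2"
      by (intro power_mono) auto
    moreover have "(KK s s - 2 * KK s t + KK t t) * KK t t \<ge> 0"
      using modular_nonneg[of \<Omega> 2 "\<lambda>x. Gu s x - Gu t x"] modular_nonneg[of \<Omega> 2 "Gu t"]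
      by (simp only: modular_Gu_diff KK_self[of t, symmetric]) (rule mult_nonneg_nonneg)
    ultimately show ?thesis by simp
  qed
  have KK_q: "0 \<le> KK s s - 2 * KK s t + KK t t" "KK s s - 2 * KK s t + KK t t \<le> 2 * (KK s s + KK t t)" for s t
  proof -
    show "0 \<le> KK s s - 2 * KK s t + KK t t" unfolding modular_Gu_diff[symmetric] by (rule modular_nonneg)
    \<comment> \<open>Cauchy-Schwarz followed by the arithmetic-geometric mean; it bounds the
      squared distance of two gradients by twice the sum of their squared norms.\<close>
    have "2 * \<bar>KK s t\<bar> \<le> KK s s + KK t t"
    proof -
      have "0 \<le> (sqrt (KK s s) - sqrt (KK t t))\<^sup>2" by simp
      then have "2 * sqrt (KK s s * KK t t) \<le> KK s s + KK t t"
        by (simp add: power2_diff KK_self modular_nonneg real_sqrt_mult)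
      moreover have "\<bar>KK s t\<bar> \<le> sqrt (KK s s * KK t t)"
        using L2_inner(4)[OF Gu_L2[of s] Gu_L2[of t]] by (simp only: KK_self KK_def[of s t])
      ultimately show ?thesis by linarith
    qed
    then have "- (2 * KK s t) \<le> KK s s + KK t t" using abs_ge_minus_self[of "KK s t"] by linarith
    then show "KK s s - 2 * KK s t + KK t t \<le> 2 * (KK s s + KK t t)" by simp
  qed
  have PP_nonneg: "PP t \<ge> 0" if "t > 0" for t
    using PP_ge(1)[OF assms(8,9) that] assms(8) modular_nonneg[of \<Omega> m "ut (t + 1) t"]
    by (meson less_imp_le mult_nonneg_nonneg order_trans)
  obtain B where B: "B \<ge> 0" "\<And>t \<mu>. t > 0 \<Longrightarrow> \<mu> > 0 \<Longrightarrow>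
      \<bar>WW t t\<bar> \<le> B * (PP t / \<mu> + \<mu> powr (m - 1) * KK t t powr (m / 2))"
    using damping_bound[OF assms(8,9,7,24)] by blast
  interpret E0: memory_energy KK gg X p l PP
  proof
    show "KK s t = KK t s" for s t by (rule KK_sym)
    show "0 \<le> KK t t" for t by (simp add: KK_self modular_nonneg)
    show "gg t \<le> gg s" if "0 \<le> s" "s \<le> t" for s t
      using g_anti that by (auto simp: gg_def monotone_on_def)
    show "X t \<le> X s" if "0 \<le> s" "s \<le> t" for s t
      using \<xi>_anti that by (auto simp: X_def monotone_on_def)
  qed (use KK_cont KK_q KK_CS gg_props int_g_le assms(16,17,18) decr X_cont X_nonneg PP_nonneg in auto)
  have W: "E0.W = WW" by (intro ext) (simp add: E0.W_def WW_def)
  interpret E: memory_energy_damped KK gg X p l PP B m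
    by unfold_locales (use assms(23) B limits KK_q(2) in \<open>auto simp: W\<close>)
  have energy: "energy \<Omega> g u t = E0.en t" if t: "t \<ge> 0" for t
  proof -
    have G: "grad \<Omega> (u s) = Gu s" if "s \<ge> 0" for s using that by (simp add: Gu_def max_def)
    have "(LINT \<tau>:{0..t}|lborel. g (t - \<tau>) * (Lq_norm \<Omega> 2 (\<lambda>x. grad \<Omega> (u t) x - grad \<Omega> (u \<tau>) x))\<^sup>2)
      = integral {0..t} (\<lambda>s. gg (t - s) * E0.q t s)"
    proof (rule set_lborel_integral_Icc)
      show "continuous_on {0..t} (\<lambda>s. gg (t - s) * E0.q t s)" by (intro continuous_intros)
      show "g (t - s) * (Lq_norm \<Omega> 2 (\<lambda>x. grad \<Omega> (u t) x - grad \<Omega> (u s) x))\<^sup>2 = gg (t - s) * E0.q t s"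
        if "0 \<le> s" "s \<le> t" for s
        using that t by (simp add: G gg_eq Lq_norm_2_square modular_Gu_diff E0.q_def)
    qed
    then show ?thesis using t
      by (simp add: energy_def E0.en_def E0.memq_def int_gg G Lq_norm_2_square KK_self)
  qed
  have int_X: "(LINT s:{0..t}|lborel. \<xi> s) = integral {0..t} X" for t
    by (rule set_lborel_integral_Icc) (auto intro: continuous_on_subset[OF X_cont] X_eq)
  have Xr: "continuous_on S (\<lambda>s. X s powr r)" if "r > 0" for r S
    by (rule continuous_on_powr') (use X_nonneg that in \<open>auto intro: continuous_on_subset[OF X_cont]\<close>)
  have int_Xr: "(LINT s:{0..t}|lborel. \<xi> s powr r) = integral {0..t} (\<lambda>s. X s powr r)" if "r > 0" for r t
    by (rule set_lborel_integral_Icc) (use Xr[OF that] in \<open>auto simp: X_eq\<close>)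
  show ?thesis
  proof (cases "p = 1")
    \<comment> \<open>For \<open>p = 1\<close> only the exponential estimate says anything, so its
      constants serve throughout.\<close>
    case True
    then obtain L c where "L > 0" "c > 0" "\<And>t. t \<ge> 0 \<Longrightarrow> E0.en t \<le> L * exp (- c * integral {0..t} X)"
      using E.en_decay(1) by blast
    then show ?thesis using True
      by (intro exI[of _ L] conjI exI[of _ c]) (auto simp: energy int_X)
  next
    case False
    then have p: "p > 1" using assms(17) by simp
    then have r: "2 * p - 1 > 0" "p > 0" by auto
    obtain L where L: "L > 0" "\<And>t. t \<ge> 0 \<Longrightarrow> E0.en t \<le> L * (1 + integral {0..t} (\<lambda>s. X s powr (2 * p - 1))) powr (-1 / (2 * p - 2))"
      using E.en_decay(2)[OF p] by blast
    let ?y = "\<lambda>t. (1 + integral {0..t} (\<lambda>s. X s powr (2 * p - 1))) powr (-1 / (2 * p - 2))"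
    have I0: "integral {0..t} (\<lambda>s. X s powr (2 * p - 1)) \<ge> 0" for t
      by (intro integral_nonneg integrable_continuous_real Xr r) auto
    have y_cont: "continuous_on {0..t} ?y" for t
    proof (intro continuous_on_powr continuous_on_add continuous_on_const)
      have "continuous_on {0..} (\<lambda>t. integral {0..t} (\<lambda>s. X s powr (2 * p - 1)))"
        by (rule continuous_on_integral_upto) (intro continuous_on_compose2[OF Xr[OF r(1), of UNIV]] continuous_intros, auto)
      then show "continuous_on {0..t} (\<lambda>t. integral {0..t} (\<lambda>s. X s powr (2 * p - 1)))"
        by (rule continuous_on_subset) auto
      show "\<forall>x\<in>{0..t}. 1 + integral {0..x} (\<lambda>s. X s powr (2 * p - 1)) \<noteq> 0" using I0 by (smt (verit))
    qed
    let ?N = "\<integral>\<^sup>+ t\<in>{0..}. ennreal ((1 + (LINT s:{0..t}|lborel. \<xi> s powr (2*p - 1))) powr (-1 / (2*p - 2))) \<partial>lborel"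
    have third: "\<exists>L3>0. \<forall>t\<ge>0. E0.en t \<le> L3 * (1 + integral {0..t} (\<lambda>s. X s powr p)) powr (-1 / (p - 1))"
      if fin: "?N < \<infinity>"
    \<comment> \<open>The first polynomial estimate and finiteness of the given integral make the
      energy integrable in time; the bound \<open>D\<close> is \<open>L\<close> times that
      integral.\<close>
    proof (rule E.en_decay(3)[OF p, of "L * enn2real ?N"])
      fix t :: real assume t: "t \<ge> 0"
      have en_cont: "continuous_on {0..t} E0.en" by (rule continuous_on_subset[OF E0.en_cont]) auto
      have "integral {0..t} E0.en \<le> integral {0..t} (\<lambda>s. L * ?y s)"
        by (rule integral_le[OF integrable_continuous_real[OF en_cont]
              integrable_continuous_real[OF continuous_on_mult[OF continuous_on_const y_cont]]]) (use L(2) in auto)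
      also have "\<dots> = L * integral {0..t} ?y" by simp
      also have "\<dots> \<le> L * enn2real ?N"
      proof (rule mult_left_mono)
        have "ennreal (integral {0..t} ?y) = (\<integral>\<^sup>+ s. ennreal (?y s) * indicator {0..t} s \<partial>lborel)"
          by (rule nn_integral_has_integral_lebesgue'[symmetric])
             (simp, rule integrable_integral[OF integrable_continuous_real[OF y_cont]])
        also have "\<dots> \<le> ?N"
          by (rule nn_integral_mono) (auto simp: int_Xr[OF r(1)] indicator_def)
        finally have "enn2real (ennreal (integral {0..t} ?y)) \<le> enn2real ?N"
          using fin by (intro enn2real_mono) auto
        moreover have "integral {0..t} ?y \<ge> 0"
          by (intro integral_nonneg integrable_continuous_real y_cont) auto
        ultimately show "integral {0..t} ?y \<le> enn2real ?N" by simp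
      qed (use L in auto)
      finally show "integral {0..t} E0.en \<le> L * enn2real ?N" .
    qed
    \<comment> \<open>If the integral is infinite any positive constant will do. This fixes
      \<open>L3\<close> without assuming finiteness, so that a single constant can be chosen for all
      claims.\<close>
    obtain L3 where L3: "L3 > 0" "?N < \<infinity> \<longrightarrow>
        (\<forall>t\<ge>0. E0.en t \<le> L3 * (1 + integral {0..t} (\<lambda>s. X s powr p)) powr (-1 / (p - 1)))"
      using third by (cases "?N < \<infinity>") (blast, meson zero_less_one)
    have L0: "max L L3 > 0" using L(1) by simp
    \<comment> \<open>Enlarging the constant is harmless because the decaying factors are
      nonnegative.\<close>
    have mx: "a \<le> max L L3 * b" if "a \<le> L * b \<or> a \<le> L3 * b" "b \<ge> 0" for a b :: real
      using that mult_right_mono[of L "max L L3" b] mult_right_mono[of L3 "max L L3" b] by linarith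
    have "energy \<Omega> g u t \<le> max L L3 * (1 + (LINT s:{0..t}|lborel. \<xi> s powr (2*p - 1))) powr (-1 / (2*p - 2))"
      if "t \<ge> 0" for t
      unfolding energy[OF that] int_Xr[OF r(1)] using L(2)[OF that] by (intro mx) auto
    moreover have "energy \<Omega> g u t \<le> max L L3 * (1 + (LINT s:{0..t}|lborel. \<xi> s powr p)) powr (-1 / (p - 1))"
      if "?N < \<infinity>" "t \<ge> 0" for t
      unfolding energy[OF that(2)] int_Xr[OF r(2)] using L3(2) that by (intro mx) auto
    ultimately show ?thesis using False L0 zero_less_one by blast
  qed
qed

end
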